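(* Consider the Sinus flow $U(y)=(1+\cos(\pi y))/2$ on $[-1,1]$ and $\beta\in\mathbb{R}$. For any $\alpha\in[\sqrt3\pi/2,+\infty)$, $L_\alpha$ is non-negative and the flow is linearly stable for perturbations of $x$-period $2\pi/\alpha$. For any $\alpha\in(0,\sqrt3\pi/2)$, the index formula $$k_c+k_r+k_i^{\le0}=1$$ holds for the eigenvalues of $J_\alpha L_\alpha$.
   Context: For the Sinus flow, $K_\beta=\frac{\beta-U''}{U-U_\beta}=\pi^2$ with $U_\beta=\frac12-\frac{\beta}{\pi^2}$. On $L^2(-1,1)$ let $J_\alpha=-i\alpha(\beta-U'')$ (multiplication) and $L_\alpha=\frac{1}{\pi^2}-\left(-\frac{d^2}{dy^2}+\alpha^2\right)^{-1}$ (Dirichlet inverse at $y=\pm1$); $\langle f,g\rangle=\int_{-1}^1 f\bar g\,dy$. $k_r$: sum of algebraic multiplicities of positive eigenvalues of $J_\alpha L_\alpha$; $k_c$: sum of algebraic multiplicities of its eigenvalues in the open first and fourth quadrants; $k_i^{\le0}$: total number of non-positive dimensions of $\langle L_\alpha\cdot,\cdot\rangle$ restricted to generalized eigenspaces of nonzero purely imaginary eigenvalues of $J_\alpha L_\alpha$. Linear stability for perturbations of period $2\pi/\alpha$ means that for no wave number $l\alpha$, $l\ge1$ integer, is there a nontrivial solution of $-\phi''+(l\alpha)^2\phi-\frac{\beta-U''}{U-c}\phi=0$ on $(-1,1)$, $\phi(\pm1)=0$, with $\operatorname{Im}c>0$ (i.e. the linearized vorticity equation $\partial_t\omega+U\partial_x\omega-(\beta-U'')\partial_x\psi=0$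 has no exponentially growing modes of that period). *)

theory Defs
  imports "HOL-Analysis.Analysis"
begin

text \<open>Setting: the Sinus flow U(y) = (1 + cos(pi y))/2 on [-1,1], the complex Hilbert
  space L2(-1,1) represented by (equivalence classes modulo a.e. equality of)
  square-integrable functions real => complex on [-1,1].\<close>

definition sinus_U :: "real \<Rightarrow> real" where
  "sinus_U y = (1 + cos (pi * y)) / 2"

definition I11 :: "real set" where
  "I11 = {-1..1}"

definition L2 :: "(real \<Rightarrow> complex) set" where
  "L2 = {f. f \<in> borel_measurable (lebesgue_on I11) \<and>
            integrable (lebesgue_on I11) (\<lambda>y. (cmod (f y))\<^sup>2)}"

definition aeq :: "(real \<Rightarrow> complex) \<Rightarrow> (real \<Rightarrow> complex) \<Rightarrow> bool" where
  "aeq f g \<longleftrightarrow> (AE y in lebesgue_on I11. f y = g y)"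

definition ip :: "(real \<Rightarrow> complex) \<Rightarrow> (real \<Rightarrow> complex) \<Rightarrow> complex" where
  "ip f g = (LINT y | lebesgue_on I11. f y * cnj (g y))"

text \<open>u solves the Dirichlet problem  -u'' + alpha^2 u = f  on (-1,1), u(-1) = u(1) = 0,
  with u in H^2 \<inter> H^1_0 (u is C^1 on [-1,1], u' absolutely continuous with
  derivative u''); u is normalised to vanish outside [-1,1].\<close>
definition dirichlet_solves :: "real \<Rightarrow> (real \<Rightarrow> complex) \<Rightarrow> (real \<Rightarrow> complex) \<Rightarrow> bool" where
  "dirichlet_solves \<alpha> f u \<longleftrightarrow>
     (\<forall>y. y \<notin> I11 \<longrightarrow> u y = 0) \<and> u (-1) = 0 \<and> u 1 = 0 \<and>
     (\<exists>u' u''. (\<forall>y\<in>I11. (u has_vector_derivative u' y) (at y within I11)) \<and>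
               u'' integrable_on I11 \<and>
               (\<forall>y\<in>I11. u' y = u' (-1) + integral {-1..y} u'') \<and>
               (AE y in lebesgue_on I11. - u'' y + complex_of_real (\<alpha>\<^sup>2) * u y = f y))"

definition dirichlet_inv :: "real \<Rightarrow> (real \<Rightarrow> complex) \<Rightarrow> (real \<Rightarrow> complex)" where
  "dirichlet_inv \<alpha> f = (THE u. dirichlet_solves \<alpha> f u)"

definition L_op :: "real \<Rightarrow> (real \<Rightarrow> complex) \<Rightarrow> (real \<Rightarrow> complex)" where
  "L_op \<alpha> f = (\<lambda>y. f y / complex_of_real (pi\<^sup>2) - dirichlet_inv \<alpha> f y)"

definition J_op :: "real \<Rightarrow> real \<Rightarrow> (real \<Rightarrow> complex) \<Rightarrow> (real \<Rightarrow> complex)" where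
  "J_op \<alpha> \<beta> g = (\<lambda>y. - \<i> * complex_of_real (\<alpha> * (\<beta> - deriv (deriv sinus_U) y)) * g y)"

definition JL_op :: "real \<Rightarrow> real \<Rightarrow> (real \<Rightarrow> complex) \<Rightarrow> (real \<Rightarrow> complex)" where
  "JL_op \<alpha> \<beta> f = J_op \<alpha> \<beta> (L_op \<alpha> f)"

definition is_eigenvalue :: "real \<Rightarrow> real \<Rightarrow> complex \<Rightarrow> bool" where
  "is_eigenvalue \<alpha> \<beta> z \<longleftrightarrow>
     (\<exists>f\<in>L2. \<not> aeq f (\<lambda>_. 0) \<and> aeq (JL_op \<alpha> \<beta> f) (\<lambda>y. z * f y))"

definition gen_eigenspace :: "real \<Rightarrow> real \<Rightarrow> complex \<Rightarrow> (real \<Rightarrow> complex) set" where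
  "gen_eigenspace \<alpha> \<beta> z =
     {f \<in> L2. \<exists>k. aeq (((\<lambda>h y. JL_op \<alpha> \<beta> h y - z * h y) ^^ k) f) (\<lambda>_. 0)}"

definition lin_indep_L2 :: "(nat \<Rightarrow> real \<Rightarrow> complex) \<Rightarrow> nat \<Rightarrow> bool" where
  "lin_indep_L2 fs n \<longleftrightarrow>
     (\<forall>c :: nat \<Rightarrow> complex. aeq (\<lambda>y. \<Sum>j<n. c j * fs j y) (\<lambda>_. 0) \<longrightarrow> (\<forall>j<n. c j = 0))"

definition dim_L2 :: "(real \<Rightarrow> complex) set \<Rightarrow> enat" where
  "dim_L2 S = (SUP n \<in> {n. \<exists>fs. (\<forall>j<n. fs j \<in> S) \<and> lin_indep_L2 fs n}. enat n)"

text \<open>Number of non-positive dimensions of <L_alpha . , .> restricted to S: maximal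
  dimension of a subspace of S on which the form is non-positive.\<close>
definition nonpos_dim :: "real \<Rightarrow> (real \<Rightarrow> complex) set \<Rightarrow> enat" where
  "nonpos_dim \<alpha> S = (SUP n \<in> {n. \<exists>fs. (\<forall>j<n. fs j \<in> S) \<and> lin_indep_L2 fs n \<and>
       (\<forall>c :: nat \<Rightarrow> complex.
          Re (ip (L_op \<alpha> (\<lambda>y. \<Sum>j<n. c j * fs j y)) (\<lambda>y. \<Sum>j<n. c j * fs j y)) \<le> 0)}. enat n)"

definition esum :: "(complex \<Rightarrow> bool) \<Rightarrow> (complex \<Rightarrow> enat) \<Rightarrow> enat" where
  "esum P m = (SUP F \<in> {F. finite F \<and> F \<subseteq> {z. P z}}. \<Sum>z\<in>F. m z)"

definition k_r :: "real \<Rightarrow> real \<Rightarrow> enat" where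
  "k_r \<alpha> \<beta> = esum (\<lambda>z. is_eigenvalue \<alpha> \<beta> z \<and> Im z = 0 \<and> Re z > 0)
                     (\<lambda>z. dim_L2 (gen_eigenspace \<alpha> \<beta> z))"

definition k_c :: "real \<Rightarrow> real \<Rightarrow> enat" where
  "k_c \<alpha> \<beta> = esum (\<lambda>z. is_eigenvalue \<alpha> \<beta> z \<and> Re z > 0 \<and> Im z \<noteq> 0)
                     (\<lambda>z. dim_L2 (gen_eigenspace \<alpha> \<beta> z))"

definition k_i_nonpos :: "real \<Rightarrow> real \<Rightarrow> enat" where
  "k_i_nonpos \<alpha> \<beta> = esum (\<lambda>z. is_eigenvalue \<alpha> \<beta> z \<and> Re z = 0 \<and> Im z \<noteq> 0)
                     (\<lambda>z. nonpos_dim \<alpha> (gen_eigenspace \<alpha> \<beta> z))"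

text \<open>Linear stability for perturbations of x-period 2 pi / alpha: for no wave number
  l alpha (l >= 1) is there a nontrivial solution phi of the Rayleigh-Kuo equation
  -phi'' + (l alpha)^2 phi - (beta - U'')/(U - c) phi = 0 on (-1,1), phi(-1) = phi(1) = 0,
  with Im c > 0.\<close>
definition linearly_stable :: "real \<Rightarrow> real \<Rightarrow> bool" where
  "linearly_stable \<alpha> \<beta> \<longleftrightarrow>
     \<not> (\<exists>(l::nat) (c::complex) (\<phi>::real \<Rightarrow> complex) \<phi>' \<phi>''.
          l \<ge> 1 \<and> Im c > 0 \<and>
          continuous_on I11 \<phi> \<and> \<phi> (-1) = 0 \<and> \<phi> 1 = 0 \<and>
          (\<forall>y\<in>{-1<..<1}. (\<phi> has_vector_derivative \<phi>' y) (at y) \<and>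
                           (\<phi>' has_vector_derivative \<phi>'' y) (at y) \<and>
                           - \<phi>'' y + complex_of_real ((real l * \<alpha>)\<^sup>2) * \<phi> y
                             - complex_of_real (\<beta> - deriv (deriv sinus_U) y)
                               / (complex_of_real (sinus_U y) - c) * \<phi> y = 0) \<and>
          (\<exists>y\<in>{-1<..<1}. \<phi> y \<noteq> 0))"

end

theory Submission
  imports Defs "HOL-Complex_Analysis.Great_Picard" "HOL-Computational_Algebra.Fundamental_Theorem_Algebra"
begin

text \<open>
  Write b = \<beta> - U'' and G for the Dirichlet inverse, so that L = 1/\<pi>^2 - G and J L f = -i \<alpha> b L f.
  For \<alpha> \<ge> \<surd>3 \<pi>/2 everything follows from Wirtinger's inequality.

  For smaller \<alpha> the form \<open>\<langle>L f, f\<rangle>\<close> is positive on the hyperplane (G f)(0) = 0, so no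
  two-dimensional subspace is non-positive. As J L is skew for the form, generalised eigenspaces of z and w
  are orthogonal unless z + cnj w = 0; hence the eigenvalues counted by the index contribute
  at most 1 altogether, and it remains to find one eigenfunction f with \<open>\<langle>L f, f\<rangle> \<le> 0\<close>
  (complex conjugation of f replaces z by - cnj z). Replacing
  integrals by Riemann sums gives a real diagonal matrix times a real symmetric one. Such a product
  has an eigenvector on which the symmetric matrix is non-positive, unless that matrix is
  non-negative. In the limit the functions G f converge uniformly by Arzela-Ascoli, say to w, and the
  eigenvalue equation then forces a.e. convergence of the discrete eigenfunctions to
  f = \<pi>^2 b w / (b - \<kappa>).
\<close>

section \<open>Eigenvectors in finite dimension\<close>

text \<open>The threshold comes from the Dirichlet eigenvalues (k pi/2)^2 + \<alpha>^2 of -u'' +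
  \<alpha>^2 u: the first one passes pi^2 at \<alpha> = sqrt 3 pi/2, the second exceeds pi^2 for
  every \<alpha> > 0. Below the threshold this leaves exactly one negative direction, whatever
  \<beta> is. The obstacle is the existence of the eigenfunction. The multiplier b may vanish or
  change sign, J L has essential spectrum on the imaginary axis, and the eigenvalue sought may lie
  inside it. In finite dimension eigenvectors always exist, which is the reason for discretising;
  what must then survive the limit is non-triviality. Norms may drop, because mass can concentrate
  where b = \<kappa>. The sign condition is therefore carried as \<langle>G f, f\<rangle> \<ge>
  1/pi^2 at unit norm: G is smoothing, so this bound passes to the limit, excludes f = 0 there and,
  together with norm at most 1, gives \<langle>L f, f\<rangle> \<le> 0. The eigenvalue must also
  differ from 0, which none of the three counts sees; hence a separate argument that J L has trivial
  kernel.\<close>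

lemma homogeneous_system_nontrivial:
  fixes a :: "'j \<Rightarrow> nat \<Rightarrow> complex"
  assumes "finite J" "card J > n"
  shows "\<exists>c. (\<exists>j\<in>J. c j \<noteq> 0) \<and> (\<forall>i<n. (\<Sum>j\<in>J. c j * a j i) = 0)"
  using assms
proof (induction n arbitrary: J a)
  case 0
  then obtain j where "j \<in> J" by fastforce
  then show ?case by (intro exI[of _ "\<lambda>_. 1"]) auto
next
  case (Suc n)
  show ?case
  proof (cases "\<forall>j\<in>J. a j n = 0")
    case True
    obtain c where "\<exists>j\<in>J. c j \<noteq> 0" "\<forall>i<n. (\<Sum>j\<in>J. c j * a j i) = 0"
      using Suc.IH[of J a] Suc.prems by auto
    then show ?thesis using True by (intro exI[of _ c]) (auto simp: less_Suc_eq)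
  next
    case False
    then obtain k where k: "k \<in> J" "a k n \<noteq> 0" by blast
    define J' where "J' = J - {k}"
    \<comment> \<open>Equation \<open>n\<close> is solved for the unknown \<open>c k\<close>;
      \<open>a'\<close> holds the coefficients that remain after substitution.\<close>
    define a' where "a' j i = a j i - a j n / a k n * a k i" for j i
    have "finite J'" "card J' > n" using Suc.prems k by (auto simp: J'_def)
    from Suc.IH[OF this, of a'] obtain c where c: "\<exists>j\<in>J'. c j \<noteq> 0"
      "\<And>i. i < n \<Longrightarrow> (\<Sum>j\<in>J'. c j * a' j i) = 0" by blast
    define s where "s = - (\<Sum>j\<in>J'. c j * a j n / a k n)"
    define c' where "c' = c(k := s)"
    have J: "J = insert k J'" "k \<notin> J'" using k by (auto simp: J'_def)
    have sum: "(\<Sum>j\<in>J. c' j * a j i) = (\<Sum>j\<in>J'. c j * a' j i)" for i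
    proof -
      have "(\<Sum>j\<in>J. c' j * a j i) = s * a k i + (\<Sum>j\<in>J'. c j * a j i)"
        using J \<open>finite J'\<close> by (auto simp: c'_def intro!: sum.cong)
      also have "\<dots> = (\<Sum>j\<in>J'. c j * a j i - c j * a j n / a k n * a k i)"
        by (simp add: s_def sum_subtractf sum_distrib_right)
      also have "\<dots> = (\<Sum>j\<in>J'. c j * a' j i)"
        by (intro sum.cong) (auto simp: a'_def algebra_simps)
      finally show ?thesis .
    qed
    have "(\<Sum>j\<in>J'. c j * a' j n) = 0" using k by (simp add: a'_def)
    then have "\<forall>i<Suc n. (\<Sum>j\<in>J. c' j * a j i) = 0"
      using c(2) by (auto simp: sum less_Suc_eq)
    moreover have "\<exists>j\<in>J. c' j \<noteq> 0" using c(1) J by (auto simp: c'_def)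
    ultimately show ?thesis by blast
  qed
qed

text \<open>Q may be indefinite and degenerate and the index type infinite, so T may fail to be
  diagonalisable. Eigenvectors are obtained only from a polynomial annihilating a given
  vector.\<close>

locale self_adjoint_form =
  fixes T :: "('i \<Rightarrow> complex) \<Rightarrow> 'i \<Rightarrow> complex"
    and Q :: "('i \<Rightarrow> complex) \<Rightarrow> ('i \<Rightarrow> complex) \<Rightarrow> complex"
  assumes T_lin: "T (\<lambda>i. a * x i + b * y i) = (\<lambda>i. a * T x i + b * T y i)"
    and Q_lin: "Q (\<lambda>i. a * x i + b * y i) v = a * Q x v + b * Q y v"
    and Q_herm: "Q y x = cnj (Q x y)"
    and T_adj: "Q (T x) y = Q x (T y)"
begin

lemma T_scale: "T (\<lambda>i. a * x i) = (\<lambda>i. a * T x i)"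
  using T_lin[of a x 0 x] by simp

lemma T_zero: "T (\<lambda>i. 0) = (\<lambda>i. 0)"
  using T_scale[of 0] by simp

lemma Q_zero: "Q (\<lambda>i. 0) v = 0"
  using Q_lin[of 0 v 0 v v] by simp

text \<open>The vector p(T) e. Annihilating polynomials stand in for finite dimension.\<close>

definition peval :: "complex poly \<Rightarrow> ('i \<Rightarrow> complex) \<Rightarrow> 'i \<Rightarrow> complex" where
  "peval p e = (\<lambda>i. \<Sum>k\<le>degree p. coeff p k * (T ^^ k) e i)"

lemma peval_upto:
  assumes "degree p \<le> n"
  shows "peval p e i = (\<Sum>k\<le>n. coeff p k * (T ^^ k) e i)"
  unfolding peval_def
  by (rule sum.mono_neutral_left) (use assms in \<open>auto simp: coeff_eq_0\<close>)

lemma T_sum: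
  assumes "finite A"
  shows "T (\<lambda>i. \<Sum>k\<in>A. c k * x k i) = (\<lambda>i. \<Sum>k\<in>A. c k * T (x k) i)"
  using assms
proof (induction A rule: finite_induct)
  case empty
  then show ?case by (simp add: T_zero)
next
  case (insert a A)
  then show ?case
    using T_lin[of "c a" "x a" 1 "\<lambda>i. \<Sum>k\<in>A. c k * x k i"] by simp
qed

lemma peval_linear_factor:
  "peval ([:- l, 1:] * p) e = (\<lambda>i. T (peval p e) i - l * peval p e i)"
proof
  fix i
  define n where "n = degree p"
  have "degree ([:- l, 1:] * p) \<le> Suc n"
    using degree_mult_le[of "[:- l, 1:]" p] by (simp add: n_def)
  then have "peval ([:- l, 1:] * p) e i
      = (\<Sum>k\<le>Suc n. coeff ([:- l, 1:] * p) k * (T ^^ k) e i)"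
    by (rule peval_upto)
  also have "\<dots> = (\<Sum>k\<le>Suc n. coeff (pCons 0 p) k * (T ^^ k) e i)
       - l * (\<Sum>k\<le>Suc n. coeff p k * (T ^^ k) e i)"
    by (simp add: sum_subtractf[symmetric] sum_distrib_left algebra_simps
        del: sum.atMost_Suc)
  also have "(\<Sum>k\<le>Suc n. coeff (pCons 0 p) k * (T ^^ k) e i)
       = (\<Sum>k\<le>n. coeff p k * (T ^^ Suc k) e i)"
    by (subst sum.atMost_Suc_shift) simp
  also have "\<dots> = T (peval p e) i"
    unfolding peval_def n_def[symmetric] by (subst T_sum) auto
  also have "(\<Sum>k\<le>Suc n. coeff p k * (T ^^ k) e i) = peval p e i"
    by (rule peval_upto[symmetric]) (simp add: n_def)
  finally show "peval ([:- l, 1:] * p) e i = T (peval p e) i - l * peval p e i" .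
qed

lemma iter_lin: "(T ^^ k) (\<lambda>i. a * x i + b * y i) = (\<lambda>i. a * (T ^^ k) x i + b * (T ^^ k) y i)"
  by (induction k) (auto simp: T_lin)

lemma peval_lin: "peval p (\<lambda>i. a * x i + b * y i) = (\<lambda>i. a * peval p x i + b * peval p y i)"
  by (simp add: peval_def iter_lin sum.distrib sum_distrib_left algebra_simps)

lemma iter_eigen:
  assumes "T v = (\<lambda>i. l * v i)"
  shows "(T ^^ k) v = (\<lambda>i. l ^ k * v i)"
  by (induction k) (auto simp: assms T_scale mult.assoc mult.left_commute)

lemma peval_eigen:
  assumes "T v = (\<lambda>i. l * v i)"
  shows "peval p v = (\<lambda>i. poly p l * v i)"
  by (simp add: peval_def iter_eigen[OF assms] poly_altdef sum_distrib_right mult.assoc)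

lemma Q_scale: "Q (\<lambda>i. a * x i) v = a * Q x v"
  using Q_lin[of a x 0 x v] by simp

lemma Q_sum:
  assumes "finite A"
  shows "Q (\<lambda>i. \<Sum>k\<in>A. c k * x k i) v = (\<Sum>k\<in>A. c k * Q (x k) v)"
  using assms
proof (induction A rule: finite_induct)
  case empty
  then show ?case by (simp add: Q_zero)
next
  case (insert a A)
  then show ?case
    using Q_lin[of "c a" "x a" 1 "\<lambda>i. \<Sum>k\<in>A. c k * x k i"] by simp
qed

lemma Q_iter: "Q ((T ^^ k) x) y = Q x ((T ^^ k) y)"
  by (induction k arbitrary: x y) (auto simp: T_adj funpow_swap1)

text \<open>The powers of T move onto \<open>v\<close>. The eigenvalue has to be real because Q is
  conjugate-linear in its second argument.\<close>

lemma Q_peval_eigen: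
  assumes "T v = (\<lambda>i. l * v i)" "Im l = 0"
  shows "Q (peval p x) v = poly p l * Q x v"
proof -
  have l: "cnj l = l" using assms by (simp add: complex_eq_iff)
  have "Q ((T ^^ k) x) v = l ^ k * Q x v" for k
    using Q_herm[of x "(T ^^ k) v"] Q_herm[of x v]
    by (simp add: Q_iter iter_eigen[OF assms(1)] Q_scale l)
  then show ?thesis
    by (simp add: peval_def Q_sum poly_altdef sum_distrib_right mult.assoc)
qed

text \<open>Split off an eigenvector in the Krylov space of e; its orthogonal complement is again
  invariant, and the degree of the annihilating polynomial drops.\<close>
lemma form_nonneg_if_eigenvectors_positive:
  assumes S_lin: "\<And>a x b y. S x \<Longrightarrow> S y \<Longrightarrow> S (\<lambda>i. a * x i + b * y i)"
    and S_T: "\<And>x. S x \<Longrightarrow> S (T x)"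
    and pos: "\<And>v l. S v \<Longrightarrow> v \<noteq> (\<lambda>i. 0) \<Longrightarrow> T v = (\<lambda>i. l * v i) \<Longrightarrow> Re (Q v v) > 0"
    and "p \<noteq> 0" "peval p e = (\<lambda>i. 0)" "S e"
  shows "Re (Q e e) \<ge> 0"
  using assms(4,5,6)
proof (induction "degree p" arbitrary: p e)
  case 0
  then obtain c where c: "p = [:c:]" "c \<noteq> 0"
    by (metis pCons_eq_0_iff degree_eq_zeroE)
  then have "e = (\<lambda>i. 0)" using 0 by (auto simp: peval_def fun_eq_iff)
  then show ?case by (simp add: Q_zero)
next
  case (Suc d)
  have "\<not> constant (poly p)"
    using Suc.hyps(2) by (simp add: constant_degree)
  then obtain l where "poly p l = 0"
    using fundamental_theorem_of_algebra by blast
  then obtain q where q: "p = [:- l, 1:] * q"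
    by (metis poly_eq_0_iff_dvd dvdE)
  have q_ne: "q \<noteq> 0" using Suc.prems(1) q by auto
  have "degree p = Suc (degree q)"
    unfolding q using q_ne by (subst degree_mult_eq) auto
  with Suc.hyps(2) q_ne have q0: "q \<noteq> 0" "degree q = d" by auto
  \<comment> \<open>Since p = (X - l) q annihilates \<open>e\<close>, the vector q(T) e is killed by
    T - l: it is an eigenvector, or zero, and then q already annihilates \<open>e\<close>.\<close>
  define v where "v = peval q e"
  have Tv: "T v = (\<lambda>i. l * v i)"
    using Suc.prems(2) unfolding q peval_linear_factor v_def[symmetric] fun_eq_iff by simp
  have S_iter: "S ((T ^^ k) e)" for k
    by (induction k) (use Suc.prems S_T in auto)
  have S_sum: "finite A \<Longrightarrow> S (\<lambda>i. \<Sum>k\<in>A. coeff q k * (T ^^ k) e i)" for A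
  proof (induction A rule: finite_induct)
    case empty
    then show ?case using S_lin[of e e 0 0] Suc.prems by simp
  next
    case (insert k A)
    then show ?case using S_lin[OF S_iter[of k] insert.IH, of "coeff q k" 1] by simp
  qed
  have Sv: "S v" unfolding v_def peval_def by (rule S_sum) simp
  show ?case
  proof (cases "v = (\<lambda>i. 0)")
    case True
    then show ?thesis using Suc.hyps(1)[of q e] q0 Suc.prems by (simp add: v_def)
  next
    case False
    then have Qv: "Re (Q v v) > 0" using pos Tv Sv by blast
    have imv: "Im (Q v v) = 0" using Q_herm[of v v] by (metis Im_complex_of_real complex_cnj_cancel_iff complex_eq_iff cnj.simps(2) equation_minus_iff neg_equal_zero)
    \<comment> \<open>Self-adjointness forces an eigenvalue to be real once its eigenvector has
      non-zero form.\<close>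
    have "l * Q v v = cnj l * Q v v"
      using T_adj[of v v] Q_herm[of v "\<lambda>i. l * v i"] Q_herm[of v v] by (simp add: Tv Q_scale)
    then have "Im l = 0" using Qv by (auto simp: complex_eq_iff)
    define t where "t = Q e v / Q v v"
    define e' where "e' = (\<lambda>i. 1 * e i + (- t) * v i)"
    have Se': "S e'" unfolding e'_def by (rule S_lin[OF Suc.prems(3) Sv])
    have Qvne: "Q v v \<noteq> 0" using Qv by auto
    have e'v: "Q e' v = 0" unfolding e'_def Q_lin t_def using Qvne by simp
    have ve': "Q v e' = 0" using Q_herm[of v e'] e'v by simp
    have ee: "e = (\<lambda>i. 1 * e' i + t * v i)" by (simp add: e'_def)
    have "Q e e = Q e' e + t * Q v e" by (subst ee, subst Q_lin) simp
    also have "Q e' e = cnj (Q e e')" using Q_herm by blast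
    also have "Q e e' = Q e' e'" by (subst ee, subst Q_lin) (simp add: ve')
    also have "Q v e = cnj (Q e v)" using Q_herm by blast
    also have "Q e v = t * Q v v" by (subst ee, subst Q_lin) (simp add: e'v)
    finally have "Q e e = cnj (Q e' e') + (t * cnj t) * cnj (Q v v)" by simp
    then have "Re (Q e e) = Re (Q e' e') + (cmod t)\<^sup>2 * Re (Q v v)"
      using imv by (simp add: complex_mult_cnj cmod_power2)
    moreover have "peval q e' = (\<lambda>i. 0)"
    proof -
      \<comment> \<open>By linearity q(T) e' is a multiple of \<open>v\<close>. It is also
        Q-orthogonal to \<open>v\<close>, and Q v v is non-zero, so the multiple is 0.\<close>
      have *: "peval q e' = (\<lambda>i. (1 - t * poly q l) * v i)"
        unfolding e'_def peval_lin peval_eigen[OF Tv] v_def[symmetric] by (auto simp: algebra_simps)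
      have "Q (peval q e') v = 0"
        using Q_peval_eigen[OF Tv \<open>Im l = 0\<close>, of q e'] e'v by simp
      then have "1 - t * poly q l = 0" unfolding * Q_scale using Qvne by simp
      then show ?thesis unfolding * by simp
    qed
    then have "Re (Q e' e') \<ge> 0" using Suc.hyps(1)[of q e'] q0 Se' by simp
    ultimately show ?thesis using Qv by (simp add: add_nonneg_nonneg)
  qed
qed

end

text \<open>With D the diagonal matrix of \<open>d\<close>, the expression \<langle>M D M x,
  y\<rangle> is Hermitian, so D M is self-adjoint for the form \<langle>M x, y\<rangle>. A vector of
  negative form is then incompatible with positivity on all eigenvectors. D may be singular, hence M
  and not the inverse of D supplies the form.\<close>

lemma nonpositive_eigenvector_exists:
  fixes M :: "nat \<Rightarrow> nat \<Rightarrow> real" and d :: "nat \<Rightarrow> real" and e :: "nat \<Rightarrow> complex"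
  assumes sym: "\<And>i j. M i j = M j i"
    and neg: "Re (\<Sum>i<n. (\<Sum>j<n. M i j * e j) * cnj (e i)) < 0"
  obtains x :: "nat \<Rightarrow> complex" and \<zeta> :: complex where "\<exists>i<n. x i \<noteq> 0" "\<And>i. i < n \<Longrightarrow> d i * (\<Sum>j<n. M i j * x j) = \<zeta> * x i"
    "Re (\<Sum>i<n. (\<Sum>j<n. M i j * x j) * cnj (x i)) \<le> 0"
proof -
  define L where "L x i = (\<Sum>j<n. complex_of_real (M i j) * x j)" for x :: "nat \<Rightarrow> complex" and i
  \<comment> \<open>Vectors are functions on the naturals. T produces 0 from index \<open>n\<close>
    on, so those supported below \<open>n\<close> form the invariant space to which the Krylov
    argument is applied.\<close>
  define T where "T x i = (if i < n then d i * L x i else 0)" for x :: "nat \<Rightarrow> complex" and i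
  define Q where "Q x y = (\<Sum>i<n. L x i * cnj (y i))" for x y :: "nat \<Rightarrow> complex"
  have L_lin: "L (\<lambda>i. a * x i + b * y i) = (\<lambda>i. a * L x i + b * L y i)" for a b x y
    by (auto simp: L_def sum.distrib sum_distrib_left algebra_simps)
  have Q_sym: "Q x y = (\<Sum>j<n. x j * cnj (L y j))" for x y
  proof -
    have "Q x y = (\<Sum>i<n. \<Sum>j<n. M i j * x j * cnj (y i))"
      by (simp add: Q_def L_def sum_distrib_right)
    also have "\<dots> = (\<Sum>j<n. \<Sum>i<n. M i j * x j * cnj (y i))"
      by (rule sum.swap)
    also have "\<dots> = (\<Sum>j<n. x j * cnj (L y j))"
      by (intro sum.cong refl) (simp add: L_def sum_distrib_left sym algebra_simps)
    finally show ?thesis .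
  qed
  interpret self_adjoint_form T Q
  proof
    show "T (\<lambda>i. a * x i + b * y i) = (\<lambda>i. a * T x i + b * T y i)" for a b x y
      by (auto simp: T_def L_lin algebra_simps)
    show "Q (\<lambda>i. a * x i + b * y i) v = a * Q x v + b * Q y v" for a b x y v
      by (simp add: Q_def L_lin sum.distrib sum_distrib_left algebra_simps)
    show "Q y x = cnj (Q x y)" for x y
      by (subst Q_sym) (simp add: Q_def algebra_simps)
    show "Q (T x) y = Q x (T y)" for x y
      by (subst Q_sym) (simp add: T_def Q_def algebra_simps)
  qed
  define e' where "e' i = (if i < n then e i else 0)" for i
  have "Q e' e' = (\<Sum>i<n. (\<Sum>j<n. M i j * e j) * cnj (e i))"
    by (simp add: Q_def L_def e'_def)
  then have neg': "Re (Q e' e') < 0" using neg by simp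
  have supp: "i \<ge> n \<Longrightarrow> (T ^^ k) e' i = 0" for k i
    by (cases k) (auto simp: e'_def T_def)
  \<comment> \<open>The n + 1 Krylov vectors live in dimension n; the coefficients of a linear
    relation among them give the annihilating polynomial.\<close>
  obtain c where c: "\<exists>j\<in>{..n}. c j \<noteq> 0" "\<forall>i<n. (\<Sum>j\<in>{..n}. c j * (T ^^ j) e' i) = 0"
    using homogeneous_system_nontrivial[of "{..n}" n "\<lambda>j. (T ^^ j) e'"] by auto
  define p where "p = Poly (map c [0..<Suc n])"
  have cp: "coeff p j = (if j \<le> n then c j else 0)" for j
    by (auto simp: p_def nth_default_def simp del: upt_Suc)
  have "p \<noteq> 0" using c(1) cp by (metis atMost_iff coeff_0)
  moreover have "peval p e' = (\<lambda>i. 0)"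
  proof
    fix i
    have "degree p \<le> n" by (intro degree_le) (simp add: cp)
    from peval_upto[OF this] have "peval p e' i = (\<Sum>k\<le>n. c k * (T ^^ k) e' i)"
      by (simp add: cp)
    then show "peval p e' i = 0" using c(2) supp by (cases "i < n") auto
  qed
  ultimately obtain v l where v: "v \<noteq> (\<lambda>i. 0)" "T v = (\<lambda>i. l * v i)" "\<not> Re (Q v v) > 0"
      "\<forall>i\<ge>n. v i = 0"
    using form_nonneg_if_eigenvectors_positive[of "\<lambda>x. \<forall>i\<ge>n. x i = 0" p e'] neg'
    by (force simp: T_def e'_def)
  show ?thesis
  proof (rule that[of v l])
    show "\<exists>i<n. v i \<noteq> 0" using v(1,4) by (metis not_less)
    show "d i * (\<Sum>j<n. M i j * v j) = l * v i" if "i < n" for i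
      using fun_cong[OF v(2), of i] that by (simp add: T_def L_def)
    show "Re (\<Sum>i<n. (\<Sum>j<n. M i j * v j) * cnj (v i)) \<le> 0"
      using v(3) by (simp add: Q_def L_def)
  qed
qed

section \<open>Integration by parts\<close>

abbreviation I11_measure :: "real measure" ("\<mu>") where
  "\<mu> \<equiv> lebesgue_on I11"

lemma lebesgue_sigma_finite_pair:
  "pair_sigma_finite (lebesgue_on {a..b::real}) (lebesgue_on {a..b})"
proof -
  interpret finite_measure "lebesgue_on {a..b}"
    by (rule finite_measure_lebesgue_on) auto
  show ?thesis by unfold_locales
qed

lemma integrable_cmult_continuous:
  fixes h q :: "real \<Rightarrow> complex"
  assumes h: "integrable (lebesgue_on {a..b}) h" and q: "continuous_on {a..b} q"
  shows "integrable (lebesgue_on {a..b}) (\<lambda>t. h t * q t)"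
proof -
  have "compact (q ` {a..b})" by (intro compact_continuous_image q) auto
  then obtain B where B: "\<And>t. t \<in> {a..b} \<Longrightarrow> cmod (q t) \<le> B"
    by (metis bounded_iff compact_imp_bounded imageI)
  have mq: "q \<in> borel_measurable (lebesgue_on {a..b})"
    by (rule continuous_imp_measurable_on_sets_lebesgue[OF q]) auto
  show ?thesis
  proof (rule measurable_bounded_by_integrable_imp_lebesgue_integrable)
    show "(\<lambda>t. h t * q t) \<in> borel_measurable (lebesgue_on {a..b})" using h mq by auto
    show "integrable (lebesgue_on {a..b}) (\<lambda>t. cmod (h t) * B)"
      using h by (intro integrable_mult_left integrable_norm)
    show "cmod (h t * q t) \<le> cmod (h t) * B" if "t \<in> {a..b}" for t
      using B[OF that] by (simp add: norm_mult mult_left_mono)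
  qed auto
qed

lemma integrable_lebesgue_continuous:
  fixes q :: "real \<Rightarrow> 'a::euclidean_space"
  assumes "continuous_on {a..b} q"
  shows "integrable (lebesgue_on {a..b}) q"
  using assms absolutely_integrable_continuous_real absolutely_integrable_imp_integrable by force

text \<open>Fubini on the triangle s \<le> t.\<close>
lemma integration_by_parts_indefinite:
  fixes h q q' :: "real \<Rightarrow> complex"
  assumes h: "integrable (lebesgue_on {a..b}) h" and ab: "a \<le> b"
    and q: "\<And>t. t \<in> {a..b} \<Longrightarrow> (q has_vector_derivative q' t) (at t within {a..b})"
    and q': "continuous_on {a..b} q'"
  shows "((\<lambda>t. h t * q t + integral {a..t} h * q' t) has_integral (integral {a..b} h * q b)) {a..b}"
proof -
  let ?N = "lebesgue_on {a..b}"
  interpret pair_sigma_finite ?N ?N by (rule lebesgue_sigma_finite_pair)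
  have mq: "q' \<in> borel_measurable ?N"
    by (rule continuous_imp_measurable_on_sets_lebesgue[OF q']) auto
  have mh[measurable]: "h \<in> borel_measurable ?N" using h by auto
  note mq[measurable]
  have iq: "integrable ?N q'" by (rule integrable_lebesgue_continuous[OF q'])
  have cq: "continuous_on {a..b} q"
    using q by (metis continuous_on_eq_continuous_within has_vector_derivative_continuous)
  have int1: "integrable (?N \<Otimes>\<^sub>M ?N) (\<lambda>(s,t). h s * q' t)"
  proof (rule Fubini_integrable)
    show "integrable ?N (\<lambda>s. LINT t|?N. cmod (case (s, t) of (s, t) \<Rightarrow> h s * q' t))"
      using h by (simp add: norm_mult)
    show "AE s in ?N. integrable ?N (\<lambda>t. case (s, t) of (s, t) \<Rightarrow> h s * q' t)"
      using iq by auto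
  qed measurable
  have id[measurable]: "(\<lambda>x. x) \<in> borel_measurable ?N"
    using id_borel_measurable_lebesgue_on[of "{a..b}"] by (simp add: id_def)
  have int2: "integrable (?N \<Otimes>\<^sub>M ?N) (\<lambda>(s,t). if s \<le> t then h s * q' t else 0)"
    by (rule Bochner_Integration.integrable_bound[OF int1]) auto
  have inner1: "(LINT s|?N. (if s \<le> t then h s * q' t else 0)) = integral {a..t} h * q' t"
    if "t \<in> {a..b}" for t
  proof -
    have ih: "integrable (lebesgue_on {a..t}) h"
      using integrable_subinterval[OF h] that by auto
    have "(LINT s|?N. (if s \<le> t then h s * q' t else 0))
        = (LINT s|?N. (if s \<in> {a..t} then h s * q' t else 0))"
      by (intro Bochner_Integration.integral_cong) auto
    also have "\<dots> = (LINT s|lebesgue_on {a..t}. h s * q' t)"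
      using that by (intro Lebesgue_Measure.integral_restrict) auto
    also have "\<dots> = integral {a..t} h * q' t"
      by (simp add: lebesgue_integral_eq_integral[OF ih])
    finally show ?thesis .
  qed
  have inner2: "(LINT t|?N. (if s \<le> t then h s * q' t else 0)) = h s * (q b - q s)"
    if "s \<in> {a..b}" for s
  proof -
    have "(LINT t|?N. (if s \<le> t then h s * q' t else 0))
        = (LINT t|?N. (if t \<in> {s..b} then h s * q' t else 0))"
      by (intro Bochner_Integration.integral_cong) auto
    also have "\<dots> = (LINT t|lebesgue_on {s..b}. h s * q' t)"
      using that by (intro Lebesgue_Measure.integral_restrict) auto
    also have "\<dots> = h s * integral {s..b} q'"
      using that by (subst integral_mult_right_zero, subst lebesgue_integral_eq_integral)
       (auto intro!: integrable_lebesgue_continuous continuous_on_subset[OF q'])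
    also have "integral {s..b} q' = q b - q s"
      using that by (intro integral_unique fundamental_theorem_of_calculus)
        (auto intro: has_vector_derivative_within_subset[OF q])
    finally show ?thesis .
  qed
  have P: "continuous_on {a..b} (\<lambda>t. integral {a..t} h)"
    by (intro indefinite_integral_continuous_1 integrable_on_lebesgue_on[OF h]) auto
  have ihq: "integrable ?N (\<lambda>t. h t * q t)" by (rule integrable_cmult_continuous[OF h cq])
  have iPq: "integrable ?N (\<lambda>t. integral {a..t} h * q' t)"
    by (intro integrable_lebesgue_continuous continuous_intros P q')
  have "(LINT t|?N. integral {a..t} h * q' t)
      = (LINT t|?N. LINT s|?N. (if s \<le> t then h s * q' t else 0))"
    by (intro Bochner_Integration.integral_cong) (auto simp: inner1)
  also have "\<dots> = (LINT s|?N. LINT t|?N. (if s \<le> t then h s * q' t else 0))"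
    using int2 by (intro Fubini_integral)
  also have "\<dots> = (LINT s|?N. h s * (q b - q s))"
    by (intro Bochner_Integration.integral_cong) (auto simp: inner2)
  also have "\<dots> = (LINT s|?N. h s * q b) - (LINT s|?N. h s * q s)"
    using h ihq by (simp add: right_diff_distrib)
  also have "(LINT s|?N. h s * q b) = integral {a..b} h * q b"
    using lebesgue_integral_eq_integral[OF h] by simp
  finally have "(LINT t|?N. h t * q t + integral {a..t} h * q' t) = integral {a..b} h * q b"
    using ihq iPq by simp
  moreover have "integrable ?N (\<lambda>t. h t * q t + integral {a..t} h * q' t)"
    using ihq iPq by simp
  ultimately show ?thesis
    using has_integral_integral_lebesgue_on[of "{a..b}" "\<lambda>t. h t * q t + integral {a..t} h * q' t"]
    by simp
qed

section \<open>Square-integrable functions\<close>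

lemma I11_sets [simp]: "I11 \<in> sets lebesgue" "I11 \<in> lmeasurable"
  by (auto simp: I11_def)

lemma integrable_I11_bound:
  fixes f :: "real \<Rightarrow> 'a::euclidean_space"
  assumes "f \<in> borel_measurable \<mu>" "integrable \<mu> g"
    "\<And>y. y \<in> I11 \<Longrightarrow> norm (f y) \<le> g y"
  shows "integrable \<mu> f"
  using measurable_bounded_by_integrable_imp_lebesgue_integrable[OF assms] by simp

lemma integrable_I11_const [simp]: "integrable \<mu> (\<lambda>y. c :: 'a::euclidean_space)"
proof -
  interpret finite_measure "\<mu>"
    by (rule finite_measure_lebesgue_on) auto
  show ?thesis by simp
qed

lemma L2_measurable: "f \<in> L2 \<Longrightarrow> f \<in> borel_measurable \<mu>"
  by (simp add: L2_def)

lemma L2_square_integrable: "f \<in> L2 \<Longrightarrow> integrable \<mu> (\<lambda>y. (cmod (f y))\<^sup>2)"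
  by (simp add: L2_def)

lemma L2_bound:
  assumes "f \<in> borel_measurable \<mu>" "integrable \<mu> g"
    "\<And>y. y \<in> I11 \<Longrightarrow> (cmod (f y))\<^sup>2 \<le> g y"
  shows "f \<in> L2"
  unfolding L2_def using assms
  by (auto intro!: integrable_I11_bound[where g = g])

lemma L2_integrable:
  assumes "f \<in> L2"
  shows "integrable \<mu> f"
proof (rule integrable_I11_bound)
  show "integrable \<mu> (\<lambda>y. 1 + (cmod (f y))\<^sup>2)"
    using L2_square_integrable[OF assms] by simp
  show "cmod (f y) \<le> 1 + (cmod (f y))\<^sup>2" for y
    using sum_squares_bound[of "cmod (f y)" 1] norm_ge_zero[of "f y"] by (simp del: norm_ge_zero)
qed (use L2_measurable[OF assms] in auto)

lemma L2_lin:
  assumes f: "f \<in> L2" and g: "g \<in> L2"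
  shows "(\<lambda>y. a * f y + b * g y) \<in> L2"
proof (rule L2_bound)
  show "(\<lambda>y. a * f y + b * g y) \<in> borel_measurable \<mu>"
    using L2_measurable[OF f] L2_measurable[OF g] by auto
  show "integrable \<mu>
      (\<lambda>y. 2 * (cmod a)\<^sup>2 * (cmod (f y))\<^sup>2 + 2 * (cmod b)\<^sup>2 * (cmod (g y))\<^sup>2)"
    using L2_square_integrable[OF f] L2_square_integrable[OF g] by auto
  show "(cmod (a * f y + b * g y))\<^sup>2
      \<le> 2 * (cmod a)\<^sup>2 * (cmod (f y))\<^sup>2 + 2 * (cmod b)\<^sup>2 * (cmod (g y))\<^sup>2" for y
  proof -
    have "(cmod (a * f y + b * g y))\<^sup>2 \<le> (cmod (a * f y) + cmod (b * g y))\<^sup>2"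
      by (intro power_mono norm_triangle_ineq) auto
    also have "\<dots> \<le> 2 * (cmod (a * f y))\<^sup>2 + 2 * (cmod (b * g y))\<^sup>2"
      using sum_power2_ge_zero[of "cmod (a * f y) - cmod (b * g y)" 0]
      by (simp add: power2_eq_square algebra_simps)
    finally show ?thesis by (simp add: norm_mult power_mult_distrib)
  qed
qed

lemma L2_diff: "f \<in> L2 \<Longrightarrow> g \<in> L2 \<Longrightarrow> (\<lambda>y. f y - g y) \<in> L2"
  using L2_lin[of f g 1 "-1"] by simp

lemma L2_scale: "f \<in> L2 \<Longrightarrow> (\<lambda>y. a * f y) \<in> L2"
  using L2_lin[of f f a 0] by simp

lemma continuous_bound_I11:
  fixes q :: "real \<Rightarrow> 'a::real_normed_vector"
  assumes "continuous_on I11 q"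
  obtains B where "B > 0" "\<And>t. t \<in> I11 \<Longrightarrow> norm (q t) \<le> B"
proof -
  have "compact (q ` I11)" by (intro compact_continuous_image assms) (auto simp: I11_def)
  then obtain B where "\<And>t. t \<in> I11 \<Longrightarrow> norm (q t) \<le> B"
    by (metis bounded_iff compact_imp_bounded imageI)
  then show ?thesis using that[of "max B 1"] by force
qed

lemma continuous_measurable_I11:
  fixes q :: "real \<Rightarrow> 'a::euclidean_space"
  assumes "continuous_on I11 q"
  shows "q \<in> borel_measurable \<mu>"
  by (rule continuous_imp_measurable_on_sets_lebesgue[OF assms]) auto

lemma L2_mult_continuous:
  assumes "continuous_on I11 q" and f: "f \<in> L2"
  shows "(\<lambda>y. q y * f y) \<in> L2"
proof -
  obtain B where B: "B > 0" "\<And>t. t \<in> I11 \<Longrightarrow> norm (q t) \<le> B"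
    using continuous_bound_I11[OF assms(1)] by blast
  show ?thesis
  proof (rule L2_bound)
    show "(\<lambda>y. q y * f y) \<in> borel_measurable \<mu>"
      using L2_measurable[OF f] continuous_measurable_I11[OF assms(1)] by auto
    show "integrable \<mu> (\<lambda>y. B\<^sup>2 * (cmod (f y))\<^sup>2)"
      using L2_square_integrable[OF f] by auto
    show "(cmod (q y * f y))\<^sup>2 \<le> B\<^sup>2 * (cmod (f y))\<^sup>2" if "y \<in> I11" for y
      using B(2)[OF that] by (simp add: norm_mult power_mult_distrib mult_right_mono power_mono)
  qed
qed

lemma L2_const: "(\<lambda>y. c) \<in> L2"
  by (rule L2_bound[of _ "\<lambda>y. (cmod c)\<^sup>2"]) auto

lemma continuous_L2:
  assumes "continuous_on I11 q"
  shows "q \<in> L2"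
  using L2_mult_continuous[OF assms L2_const[of 1]] by simp

lemma L2_cnj: "f \<in> L2 \<Longrightarrow> (\<lambda>y. cnj (f y)) \<in> L2"
  unfolding L2_def
  by (auto intro: measurable_compose[OF _ borel_measurable_continuous_onI[OF continuous_on_cnj[OF continuous_on_id]]])

lemma ip_integrable:
  assumes f: "f \<in> L2" and g: "g \<in> L2"
  shows "integrable \<mu> (\<lambda>y. f y * cnj (g y))"
proof (rule integrable_I11_bound)
  show "(\<lambda>y. f y * cnj (g y)) \<in> borel_measurable \<mu>"
    using L2_measurable[OF f] L2_measurable[OF L2_cnj[OF g]] by auto
  show "integrable \<mu> (\<lambda>y. (cmod (f y))\<^sup>2 + (cmod (g y))\<^sup>2)"
    using L2_square_integrable[OF f] L2_square_integrable[OF g] by auto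
  show "cmod (f y * cnj (g y)) \<le> (cmod (f y))\<^sup>2 + (cmod (g y))\<^sup>2" for y
  proof -
    have "0 \<le> cmod (f y) * cmod (g y)" by simp
    then show ?thesis using sum_squares_bound[of "cmod (f y)" "cmod (g y)"]
      unfolding norm_mult complex_mod_cnj by linarith
  qed
qed

lemma ip_lin:
  assumes "f \<in> L2" "g \<in> L2" "h \<in> L2"
  shows "ip (\<lambda>y. a * f y + b * g y) h = a * ip f h + b * ip g h"
proof -
  have "ip (\<lambda>y. a * f y + b * g y) h
      = (LINT y|\<mu>. a * (f y * cnj (h y)) + b * (g y * cnj (h y)))"
    unfolding ip_def by (intro Bochner_Integration.integral_cong) (auto simp: algebra_simps)
  also have "\<dots> = a * ip f h + b * ip g h"
    unfolding ip_def using ip_integrable assms by simp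
  finally show ?thesis .
qed

lemma ip_scale: "ip (\<lambda>y. a * f y) h = a * ip f h"
  unfolding ip_def by (simp add: mult.assoc)

lemma ip_herm: "ip g f = cnj (ip f g)"
proof -
  have "cnj (ip f g) = (LINT y|\<mu>. cnj (f y * cnj (g y)))"
    unfolding ip_def by (rule Bochner_Integration.integral_cnj[symmetric])
  then show ?thesis by (simp add: ip_def mult.commute)
qed

lemma ip_aeq_left: "aeq f f' \<Longrightarrow> f \<in> L2 \<Longrightarrow> f' \<in> L2 \<Longrightarrow> g \<in> L2 \<Longrightarrow> ip f g = ip f' g"
  unfolding ip_def aeq_def
  by (rule integral_cong_AE) (auto dest: ip_integrable)

lemma ip_self: "f \<in> L2 \<Longrightarrow> ip f f = of_real (LINT y|\<mu>. (cmod (f y))\<^sup>2)"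
  unfolding ip_def complex_norm_square[symmetric] by (subst integral_complex_of_real[symmetric]) simp

lemma ip_self_nonneg: "Re (ip f f) \<ge> 0" "Im (ip f f) = 0"
proof -
  have "ip f f = of_real (LINT y|\<mu>. (cmod (f y))\<^sup>2)"
    unfolding ip_def complex_norm_square[symmetric] by (subst integral_complex_of_real[symmetric]) simp
  then show "Re (ip f f) \<ge> 0" "Im (ip f f) = 0" by auto
qed

lemma ip_self_eq_0:
  assumes "f \<in> L2" "Re (ip f f) \<le> 0"
  shows "aeq f (\<lambda>_. 0)"
proof -
  have "(LINT y|\<mu>. (cmod (f y))\<^sup>2) = 0"
    using assms ip_self_nonneg[of f] by (auto simp: ip_self intro!: antisym)
  then have "AE y in \<mu>. (cmod (f y))\<^sup>2 = 0"
    using integral_nonneg_eq_0_iff_AE[OF L2_square_integrable[OF assms(1)]] by auto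
  then show ?thesis by (auto simp: aeq_def)
qed

section \<open>The Dirichlet problem\<close>

text \<open>Integrated form of the boundary value problem, with u'' written as \<alpha>^2 u - f.
  This replaces the almost-everywhere clause of \<open>dirichlet_solves\<close> and makes the notion
  visibly linear in (f, u, u'). Values off \<open>I11\<close> are left free.\<close>

definition dirichlet_pair ::
  "real \<Rightarrow> (real \<Rightarrow> complex) \<Rightarrow> (real \<Rightarrow> complex) \<Rightarrow> (real \<Rightarrow> complex) \<Rightarrow> bool" where
  "dirichlet_pair \<alpha> f u u' \<longleftrightarrow> u (-1) = 0 \<and> u 1 = 0 \<and> continuous_on I11 u' \<and>
     (\<forall>y\<in>I11. (u has_vector_derivative u' y) (at y within I11)) \<and>
     (\<forall>y\<in>I11. u' y = u' (-1) + integral {-1..y} (\<lambda>t. complex_of_real (\<alpha>\<^sup>2) * u t - f t))"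

lemma AE_I11_negligible:
  assumes "AE y in \<mu>. P y"
  obtains N where "negligible N" "\<And>y. y \<in> I11 \<Longrightarrow> y \<notin> N \<Longrightarrow> P y"
proof -
  have "AE y in lebesgue. y \<in> I11 \<longrightarrow> P y"
    using assms by (subst (asm) AE_restrict_space_iff) auto
  then obtain N where "N \<in> null_sets lebesgue" "\<forall>y. y \<notin> N \<longrightarrow> y \<in> I11 \<longrightarrow> P y"
    by (auto elim!: AE_E3)
  then show ?thesis using that[of N] by (auto simp: negligible_iff_null_sets)
qed

lemma C1_continuous:
  "(\<forall>y\<in>I11. (u has_vector_derivative u' y) (at y within I11)) \<Longrightarrow> continuous_on I11 u"
  by (metis continuous_on_eq_continuous_within has_vector_derivative_continuous)

lemma dirichlet_pair_continuous: "dirichlet_pair \<alpha> f u u' \<Longrightarrow> continuous_on I11 u"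
  unfolding dirichlet_pair_def by (auto intro: C1_continuous)

lemma dirichlet_pair_of_solves:
  assumes "dirichlet_solves \<alpha> f u"
  obtains u' where "dirichlet_pair \<alpha> f u u'"
proof -
  obtain u' u'' where u: "u (-1) = 0" "u 1 = 0"
      "\<And>y. y\<in>I11 \<Longrightarrow> (u has_vector_derivative u' y) (at y within I11)"
      "u'' integrable_on I11"
      "\<And>y. y\<in>I11 \<Longrightarrow> u' y = u' (-1) + integral {-1..y} u''"
      "AE y in \<mu>. - u'' y + complex_of_real (\<alpha>\<^sup>2) * u y = f y"
    using assms unfolding dirichlet_solves_def by blast
  obtain N where N: "negligible N"
    "\<And>y. y \<in> I11 \<Longrightarrow> y \<notin> N \<Longrightarrow> - u'' y + complex_of_real (\<alpha>\<^sup>2) * u y = f y"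
    using AE_I11_negligible[OF u(6)] by blast
  have "integral {-1..y} u'' = integral {-1..y} (\<lambda>t. complex_of_real (\<alpha>\<^sup>2) * u t - f t)"
    if "y \<in> I11" for y
  proof (rule integral_spike[OF N(1)])
    fix t assume t: "t \<in> {-1..y} - N"
    then have "t \<in> I11" using that by (auto simp: I11_def)
    with N(2)[of t] t show "complex_of_real (\<alpha>\<^sup>2) * u t - f t = u'' t" by (auto simp: algebra_simps)
  qed
  moreover have "continuous_on I11 u'"
  proof -
    have "continuous_on I11 (\<lambda>y. u' (-1) + integral {-1..y} u'')"
      using u(4) unfolding I11_def by (intro continuous_intros indefinite_integral_continuous_1)
    then show ?thesis by (rule continuous_on_eq) (simp add: u(5)[symmetric])
  qed
  ultimately have "dirichlet_pair \<alpha> f u u'"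
    unfolding dirichlet_pair_def using u by simp
  then show ?thesis using that by blast
qed

lemma solves_of_dirichlet_pair:
  assumes "dirichlet_pair \<alpha> f u u'" "integrable \<mu> f" "\<And>y. y \<notin> I11 \<Longrightarrow> u y = 0"
  shows "dirichlet_solves \<alpha> f u"
proof -
  have "continuous_on I11 (\<lambda>t. complex_of_real (\<alpha>\<^sup>2) * u t)"
    using dirichlet_pair_continuous[OF assms(1)] by (intro continuous_intros)
  then have "integrable \<mu> (\<lambda>t. complex_of_real (\<alpha>\<^sup>2) * u t)"
    unfolding I11_def by (rule integrable_lebesgue_continuous)
  then have "integrable \<mu> (\<lambda>t. complex_of_real (\<alpha>\<^sup>2) * u t - f t)"
    using assms(2) by (rule Bochner_Integration.integrable_diff)
  then have "(\<lambda>t. complex_of_real (\<alpha>\<^sup>2) * u t - f t) integrable_on I11"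
    by (rule integrable_on_lebesgue_on) simp
  then show ?thesis
    using assms(1,3) unfolding dirichlet_solves_def dirichlet_pair_def
    by (intro conjI exI[of _ u'] exI[of _ "\<lambda>t. complex_of_real (\<alpha>\<^sup>2) * u t - f t"]) auto
qed

lemma ip_integral:
  assumes "f \<in> L2" "g \<in> L2"
  shows "((\<lambda>y. f y * cnj (g y)) has_integral ip f g) I11"
  unfolding ip_def by (intro has_integral_integral_lebesgue_on ip_integrable assms) simp

text \<open>u' is merely an indefinite integral of an L2 function, so the product rule cannot be
  used at every point. Partial integration rests on the Fubini formula instead, applied to h = u''
  and the conjugate of v.\<close>

lemma dirichlet_weak_form:
  assumes u: "dirichlet_pair \<alpha> f u u'" and f: "f \<in> L2"
    and v: "\<forall>y\<in>I11. (v has_vector_derivative v' y) (at y within I11)" "continuous_on I11 v'"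
      "v (-1) = 0" "v 1 = 0"
  shows "ip f v = ip u' v' + complex_of_real (\<alpha>\<^sup>2) * ip u v"
proof -
  define h where "h = (\<lambda>t. complex_of_real (\<alpha>\<^sup>2) * u t - f t)"
  have uL2: "u \<in> L2" "u' \<in> L2" "v \<in> L2" "v' \<in> L2"
    using u v dirichlet_pair_continuous[OF u] C1_continuous[OF v(1)]
    by (auto intro!: continuous_L2 simp: dirichlet_pair_def)
  have h2: "h \<in> L2" unfolding h_def by (intro L2_diff L2_scale f uL2)
  have u': "u' y = u' (-1) + integral {-1..y} h" if "y \<in> I11" for y
    using u that by (simp add: dirichlet_pair_def h_def)
  have "((\<lambda>t. h t * cnj (v t) + integral {-1..t} h * cnj (v' t)) has_integral
      (integral {-1..1} h * cnj (v 1))) {-1..1}"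
  proof (rule integration_by_parts_indefinite)
    show "integrable (lebesgue_on {-1..1}) h" using L2_integrable[OF h2] by (simp add: I11_def)
    show "((\<lambda>t. cnj (v t)) has_vector_derivative cnj (v' t)) (at t within {- 1..1})"
      if "t \<in> {-1..1}" for t
      using v(1) that
      by (auto simp: I11_def intro!: bounded_linear.has_vector_derivative[OF bounded_linear_cnj])
    show "continuous_on {- 1..1} (\<lambda>t. cnj (v' t))"
      using v(2) by (auto simp: I11_def intro!: continuous_intros)
  qed simp
  then have 1: "((\<lambda>t. h t * cnj (v t) + (u' t - u' (-1)) * cnj (v' t)) has_integral 0) I11"
    unfolding I11_def
  proof (subst has_integral_cong)
    fix t :: real assume "t \<in> {-1..1}"
    then have "u' t - u' (-1) = integral {-1..t} h" using u'[of t] by (simp add: I11_def)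
    then show "h t * cnj (v t) + (u' t - u' (-1)) * cnj (v' t)
        = h t * cnj (v t) + integral {-1..t} h * cnj (v' t)" by simp
  qed (use v(4) in simp)
  \<comment> \<open>The Fubini formula produces u' - u'(-1) in place of u'. The constant drops out
    because v' integrates to v(1) - v(-1) = 0.\<close>
  have 2: "((\<lambda>t. u' (-1) * cnj (v' t)) has_integral 0) I11"
  proof -
    have "(v' has_integral (v 1 - v (-1))) {-1..1}"
      using v by (intro fundamental_theorem_of_calculus) (auto simp: I11_def)
    then have "((\<lambda>t. cnj (v' t)) has_integral 0) I11"
      using has_integral_cnj[of v' 0 I11] v by (simp add: I11_def comp_def)
    then show ?thesis using has_integral_mult_right[of "\<lambda>t. cnj (v' t)" 0 I11 "u' (-1)"] by simp
  qed
  have "((\<lambda>t. h t * cnj (v t) + u' t * cnj (v' t)) has_integral (ip h v + ip u' v')) I11"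
    by (intro has_integral_add ip_integral h2 uL2)
  moreover have "((\<lambda>t. h t * cnj (v t) + u' t * cnj (v' t)) has_integral 0) I11"
    using has_integral_add[OF 1 2] by (simp add: algebra_simps)
  ultimately have "ip h v + ip u' v' = 0" by (rule has_integral_unique)
  moreover have "ip h v = complex_of_real (\<alpha>\<^sup>2) * ip u v - ip f v"
    using ip_lin[OF uL2(1) f uL2(3), of "complex_of_real (\<alpha>\<^sup>2)" "-1"] by (simp add: h_def)
  ultimately show ?thesis by (simp add: algebra_simps)
qed

lemma dirichlet_pair_lin:
  assumes u: "dirichlet_pair \<alpha> f u u'" and w: "dirichlet_pair \<alpha> g w w'" and f: "f \<in> L2" "g \<in> L2"
  shows "dirichlet_pair \<alpha> (\<lambda>y. a * f y + b * g y) (\<lambda>y. a * u y + b * w y) (\<lambda>y. a * u' y + b * w' y)"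
proof -
  define hu where "hu = (\<lambda>t. complex_of_real (\<alpha>\<^sup>2) * u t - f t)"
  define hw where "hw = (\<lambda>t. complex_of_real (\<alpha>\<^sup>2) * w t - g t)"
  have L: "u \<in> L2" "w \<in> L2"
    using u w dirichlet_pair_continuous by (auto intro!: continuous_L2)
  have int: "h integrable_on {-1..y}" if "h \<in> L2" "y \<in> I11" for h y
  proof -
    have "h integrable_on I11" using L2_integrable[OF that(1)] by (rule integrable_on_lebesgue_on) simp
    then show ?thesis using that(2) by (auto simp: I11_def intro: integrable_subinterval_real)
  qed
  have hL: "hu \<in> L2" "hw \<in> L2" unfolding hu_def hw_def by (intro L2_diff L2_scale L f)+
  have "integral {-1..y} (\<lambda>t. complex_of_real (\<alpha>\<^sup>2) * (a * u t + b * w t) - (a * f t + b * g t))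
      = a * integral {-1..y} hu + b * integral {-1..y} hw" if "y \<in> I11" for y
  proof -
    have "integral {-1..y} (\<lambda>t. complex_of_real (\<alpha>\<^sup>2) * (a * u t + b * w t) - (a * f t + b * g t))
        = integral {-1..y} (\<lambda>t. a * hu t + b * hw t)"
      by (intro Henstock_Kurzweil_Integration.integral_cong) (simp add: hu_def hw_def algebra_simps)
    also have "\<dots> = a * integral {-1..y} hu + b * integral {-1..y} hw"
      using int[OF hL(1) that] int[OF hL(2) that]
      by (subst Henstock_Kurzweil_Integration.integral_add) (auto intro: integrable_on_mult_right)
    finally show ?thesis .
  qed
  note int_lin = this
  have uw: "u' y = u' (-1) + integral {-1..y} hu" "w' y = w' (-1) + integral {-1..y} hw" if "y \<in> I11" for y
    using u w that by (auto simp: dirichlet_pair_def hu_def hw_def)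
  show ?thesis
    unfolding dirichlet_pair_def
  proof (intro conjI ballI)
    show "a * u' y + b * w' y = a * u' (- 1) + b * w' (- 1) +
         integral {- 1..y} (\<lambda>t. complex_of_real (\<alpha>\<^sup>2) * (a * u t + b * w t) - (a * f t + b * g t))"
      if "y \<in> I11" for y
      unfolding int_lin[OF that] unfolding uw[OF that] by (simp add: algebra_simps)
    show "((\<lambda>y. a * u y + b * w y) has_vector_derivative a * u' y + b * w' y) (at y within I11)"
      if "y \<in> I11" for y
      using u w that unfolding dirichlet_pair_def
      by (intro has_vector_derivative_add has_vector_derivative_mult_right) auto
    have "continuous_on I11 u'" "continuous_on I11 w'"
      using u w unfolding dirichlet_pair_def by blast+
    then show "continuous_on I11 (\<lambda>y. a * u' y + b * w' y)" by (intro continuous_intros)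
    show "a * u (-1) + b * w (-1) = 0" "a * u 1 + b * w 1 = 0"
      using u w unfolding dirichlet_pair_def by simp_all
  qed
qed

lemma ip_self_continuous_eq_0:
  assumes "continuous_on I11 u" "Re (ip u u) \<le> 0" "y \<in> I11"
  shows "u y = 0"
proof -
  have L: "u \<in> L2" by (rule continuous_L2[OF assms(1)])
  have "(LINT y|\<mu>. (cmod (u y))\<^sup>2) = integral I11 (\<lambda>y. (cmod (u y))\<^sup>2)"
    using L2_square_integrable[OF L] by (rule lebesgue_integral_eq_integral) simp
  moreover have "(LINT y|\<mu>. (cmod (u y))\<^sup>2) = 0"
    using assms(2) ip_self_nonneg[of u] by (auto simp: ip_self[OF L] intro!: antisym)
  ultimately have "integral {-1..1} (\<lambda>y. (cmod (u y))\<^sup>2) = 0" by (simp add: I11_def)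
  then have "\<forall>y\<in>{-1..1}. (cmod (u y))\<^sup>2 = 0"
    using assms(1) by (subst (asm) integral_eq_0_iff) (auto simp: I11_def intro!: continuous_intros)
  then show ?thesis using assms(3) by (auto simp: I11_def)
qed

lemma dirichlet_energy:
  assumes "dirichlet_pair \<alpha> f u u'" "f \<in> L2"
  shows "ip f u = ip u' u' + complex_of_real (\<alpha>\<^sup>2) * ip u u"
  using assms by (intro dirichlet_weak_form) (auto simp: dirichlet_pair_def)

text \<open>The difference of two solutions has right-hand side 0 and therefore zero energy;
  \<alpha> > 0 makes the energy control its L2 norm.\<close>

lemma dirichlet_unique:
  assumes a: "\<alpha> > 0" and "dirichlet_pair \<alpha> f u u'" "dirichlet_pair \<alpha> f w w'" "f \<in> L2" "y \<in> I11"
  shows "u y = w y"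
proof -
  define d where "d = (\<lambda>y. 1 * u y + (-1) * w y)"
  have d: "dirichlet_pair \<alpha> (\<lambda>y. 1 * f y + (-1) * f y) d (\<lambda>y. 1 * u' y + (-1) * w' y)"
    unfolding d_def using assms by (intro dirichlet_pair_lin)
  then have "ip (\<lambda>y. 1 * f y + (-1) * f y) d =
      ip (\<lambda>y. 1 * u' y + (-1) * w' y) (\<lambda>y. 1 * u' y + (-1) * w' y) + complex_of_real (\<alpha>\<^sup>2) * ip d d"
    using assms(4) by (intro dirichlet_energy[OF d] L2_lin)
  moreover have "ip (\<lambda>y. 1 * f y + (-1) * f y) d = 0" by (simp add: ip_def)
  ultimately have "Re (ip (\<lambda>y. 1 * u' y + (-1) * w' y) (\<lambda>y. 1 * u' y + (-1) * w' y) + complex_of_real (\<alpha>\<^sup>2) * ip d d) = 0"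
    by simp
  then have "\<alpha>\<^sup>2 * Re (ip d d) \<le> 0"
    using ip_self_nonneg[of "\<lambda>y. 1 * u' y + (-1) * w' y"] by (simp del: of_real_power)
  then have "Re (ip d d) \<le> 0" using a by (simp add: mult_le_0_iff)
  then have "d y = 0"
    using ip_self_continuous_eq_0[OF dirichlet_pair_continuous[OF d]] assms by blast
  then show ?thesis by (simp add: d_def)
qed

text \<open>Green's function of -u'' + \<alpha>^2 u: the solutions sinh(\<alpha>(1+y)) and
  sinh(\<alpha>(1-y)) vanish at -1 and at 1 respectively, and \<alpha> sinh(2\<alpha>) is their
  Wronskian.\<close>

definition green :: "real \<Rightarrow> real \<Rightarrow> real \<Rightarrow> real" where
  "green \<alpha> y t = sinh (\<alpha> * (1 + min y t)) * sinh (\<alpha> * (1 - max y t)) / (\<alpha> * sinh (2 * \<alpha>))"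

lemma green_sym: "green \<alpha> y t = green \<alpha> t y"
  by (simp add: green_def min.commute max.commute)

lemma green_continuous: "continuous_on UNIV (\<lambda>p. green \<alpha> (fst p) (snd p))"
proof (cases "\<alpha> * sinh (2 * \<alpha>) = 0")
  \<comment> \<open>This is \<alpha> = 0, where division by zero makes \<open>green\<close>
    constantly 0.\<close>
  case True
  then show ?thesis by (simp add: green_def)
next
  case False
  then show ?thesis unfolding green_def by (intro continuous_intros) auto
qed

text \<open>The kernel has a kink at t = y. Cutting the integral there leaves hyperbolic functions
  of y times indefinite integrals, to which partial integration applies.\<close>

lemma green_integral_split:
  fixes \<alpha> :: real and f :: "real \<Rightarrow> complex"
  assumes f: "f \<in> L2" and y: "y \<in> I11"
  defines "A \<equiv> \<lambda>y. integral {-1..y} (\<lambda>t. complex_of_real (sinh (\<alpha> * (1 + t))) * f t)"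
    and "C \<equiv> \<lambda>y. integral {-1..y} (\<lambda>t. complex_of_real (sinh (\<alpha> * (1 - t))) * f t)"
  shows "(LINT t|\<mu>. complex_of_real (green \<alpha> y t) * f t)
    = (complex_of_real (sinh (\<alpha> * (1 - y))) * A y
        + complex_of_real (sinh (\<alpha> * (1 + y))) * (C 1 - C y)) / complex_of_real (\<alpha> * sinh (2 * \<alpha>))"
proof -
  let ?S = "complex_of_real (\<alpha> * sinh (2 * \<alpha>))"
  have cont: "continuous_on I11 (\<lambda>t. complex_of_real (green \<alpha> y t))"
    using continuous_on_compose2[OF green_continuous, of I11 "\<lambda>t. (y, t)" \<alpha>]
    by (force intro!: continuous_intros)
  have int: "integrable \<mu> (\<lambda>t. complex_of_real (green \<alpha> y t) * f t)"
    by (rule L2_integrable[OF L2_mult_continuous[OF cont f]])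
  have "(LINT t|\<mu>. complex_of_real (green \<alpha> y t) * f t) = integral {-1..1} (\<lambda>t. complex_of_real (green \<alpha> y t) * f t)"
    using lebesgue_integral_eq_integral[OF int] by (simp add: I11_def)
  also have "\<dots> = integral {-1..y} (\<lambda>t. complex_of_real (green \<alpha> y t) * f t) + integral {y..1} (\<lambda>t. complex_of_real (green \<alpha> y t) * f t)"
    using y integrable_on_lebesgue_on[OF int]
    by (intro Henstock_Kurzweil_Integration.integral_combine[symmetric]) (auto simp: I11_def)
  also have "integral {-1..y} (\<lambda>t. complex_of_real (green \<alpha> y t) * f t)
     = integral {-1..y} (\<lambda>t. (complex_of_real (sinh (\<alpha> * (1 - y))) / ?S) * (complex_of_real (sinh (\<alpha> * (1 + t))) * f t))"
    by (intro Henstock_Kurzweil_Integration.integral_cong) (auto simp: green_def min_def max_def)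
  also have "\<dots> = complex_of_real (sinh (\<alpha> * (1 - y))) / ?S * A y"
    by (simp add: A_def)
  also have "integral {y..1} (\<lambda>t. complex_of_real (green \<alpha> y t) * f t)
     = integral {y..1} (\<lambda>t. (complex_of_real (sinh (\<alpha> * (1 + y))) / ?S) * (complex_of_real (sinh (\<alpha> * (1 - t))) * f t))"
    by (intro Henstock_Kurzweil_Integration.integral_cong) (auto simp: green_def min_def max_def)
  also have "\<dots> = complex_of_real (sinh (\<alpha> * (1 + y))) / ?S *
      integral {y..1} (\<lambda>t. complex_of_real (sinh (\<alpha> * (1 - t))) * f t)"
    by simp
  also have "integral {y..1} (\<lambda>t. complex_of_real (sinh (\<alpha> * (1 - t))) * f t) = C 1 - C y"
  proof -
    have "integrable \<mu> (\<lambda>t. complex_of_real (sinh (\<alpha> * (1 - t))) * f t)"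
      by (intro L2_integrable L2_mult_continuous f continuous_intros)
    then have "(\<lambda>t. complex_of_real (sinh (\<alpha> * (1 - t))) * f t) integrable_on {-1..1}"
      using integrable_on_lebesgue_on by (fastforce simp: I11_def)
    then show ?thesis
      using y Henstock_Kurzweil_Integration.integral_combine[of "-1" y 1 "\<lambda>t. complex_of_real (sinh (\<alpha> * (1 - t))) * f t"]
      by (auto simp: C_def I11_def algebra_simps)
  qed
  finally show ?thesis by (simp add: add_divide_distrib)
qed

text \<open>The indefinite integrals A and C have derivatives only almost everywhere, so u is not
  differentiated by the product rule. Instead \<open>p\<close> and \<alpha>^2 u - f are integrated
  by the partial integration formula, and the derivative of u is read off from the continuity of
  \<open>p\<close>.\<close>

lemma green_dirichlet_pair:
  fixes f :: "real \<Rightarrow> complex"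
  assumes a: "\<alpha> > 0" and f: "f \<in> L2"
  obtains u' where "dirichlet_pair \<alpha> f (\<lambda>y. if y \<in> I11 then (LINT t|\<mu>. complex_of_real (green \<alpha> y t) * f t) else 0) u'"
proof -
  define q1 where "q1 = (\<lambda>t. complex_of_real (cosh (\<alpha> * (1 - t))))"
  define q2 where "q2 = (\<lambda>t. complex_of_real (cosh (\<alpha> * (1 + t))))"
  define q3 where "q3 = (\<lambda>t. complex_of_real (sinh (\<alpha> * (1 - t))))"
  define q4 where "q4 = (\<lambda>t. complex_of_real (sinh (\<alpha> * (1 + t))))"
  define c where "c = complex_of_real \<alpha>"
  define S where "S = complex_of_real (sinh (2 * \<alpha>))"
  have c0: "c \<noteq> 0" and S0: "S \<noteq> 0" using a by (auto simp: c_def S_def)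
  have d: "(q1 has_vector_derivative (- c * q3 t)) (at t within X)"
      "(q2 has_vector_derivative (c * q4 t)) (at t within X)"
      "(q3 has_vector_derivative (- c * q1 t)) (at t within X)"
      "(q4 has_vector_derivative (c * q2 t)) (at t within X)" for t X
    unfolding q1_def q2_def q3_def q4_def c_def of_real_mult[symmetric] of_real_minus[symmetric]
    by (auto intro!: has_vector_derivative_of_real derivative_eq_intros
        simp flip: has_real_derivative_iff_has_vector_derivative)
  have cont: "continuous_on X q1" "continuous_on X q2" "continuous_on X q3" "continuous_on X q4" for X
    unfolding q1_def q2_def q3_def q4_def by (intro continuous_intros)+
  define hA where "hA = (\<lambda>t. q4 t * f t)"
  define hC where "hC = (\<lambda>t. q3 t * f t)"
  define A where "A = (\<lambda>y. integral {-1..y} hA)"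
  define C where "C = (\<lambda>y. integral {-1..y} hC)"
  have int: "integrable (lebesgue_on {-1..y}) hA" "integrable (lebesgue_on {-1..y}) hC" if "y \<in> I11" for y
  proof -
    have "integrable \<mu> hA" "integrable \<mu> hC"
      unfolding hA_def hC_def by (intro L2_integrable L2_mult_continuous f cont)+
    then show "integrable (lebesgue_on {-1..y}) hA" "integrable (lebesgue_on {-1..y}) hC"
      using that integrable_subinterval[of "-1" 1 _ "-1" y] by (auto simp: I11_def)
  qed
  have contAC: "continuous_on I11 A" "continuous_on I11 C"
    unfolding A_def C_def I11_def using int[of 1]
    by (auto simp: I11_def intro!: indefinite_integral_continuous_1 integrable_on_lebesgue_on)
  define u where "u = (\<lambda>y. if y \<in> I11 then (LINT t|\<mu>. complex_of_real (green \<alpha> y t) * f t) else 0)"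
  have u: "u y = (q3 y * A y + q4 y * (C 1 - C y)) / (c * S)" if "y \<in> I11" for y
    using green_integral_split[OF f that, of \<alpha>] that
    by (simp add: u_def A_def C_def q3_def q4_def hA_def hC_def c_def S_def)
  \<comment> \<open>The formal derivative of u. The terms with the derivatives of A and C are absent
    because they cancel: \<open>q3 * hA = q4 * hC\<close>.\<close>
  define p where "p = (\<lambda>y. (- q1 y * A y + q2 y * (C 1 - C y)) / S)"
  have contp: "continuous_on I11 p"
    unfolding p_def using S0 by (intro continuous_intros contAC cont) auto
  have addf: "complex_of_real (sinh (\<alpha> * (1 + t))) * complex_of_real (cosh (\<alpha> * (1 - t)))
     + complex_of_real (sinh (\<alpha> * (1 - t))) * complex_of_real (cosh (\<alpha> * (1 + t))) = S" for t
  proof -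
    have "sinh (\<alpha> * (1 + t) + \<alpha> * (1 - t)) = sinh (2 * \<alpha>)" by (simp add: algebra_simps)
    then show ?thesis unfolding S_def sinh_add by (simp flip: of_real_mult of_real_add add: mult.commute)
  qed
  \<comment> \<open>The Wronskian is constant; divided by \<open>S\<close> it gives f the
    coefficient 1 in the equation for the derivative of \<open>p\<close>.\<close>
  have add: "q4 t * q1 t + q3 t * q2 t = S" for t
    using addf unfolding q1_def q2_def q3_def q4_def by simp
  have ibp: "((\<lambda>t. h t * q t + integral {-1..t} h * q' t) has_integral (integral {-1..y} h * q y)) {-1..y}"
    if "y \<in> I11" "integrable (lebesgue_on {-1..y}) h"
      "\<And>t. (q has_vector_derivative q' t) (at t within {-1..y})" "continuous_on {-1..y} q'"
      for y and h q q' :: "real \<Rightarrow> complex"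
    using that by (intro integration_by_parts_indefinite) (auto simp: I11_def)
  have ftc: "(q' has_integral (q y - q (-1))) {-1..y}" 
    if "y \<in> I11" "\<And>t. (q has_vector_derivative q' t) (at t within {-1..y})" for y and q q' :: "real \<Rightarrow> complex"
    by (rule fundamental_theorem_of_calculus) (use that in \<open>simp_all add: I11_def\<close>)
  have u_int: "(p has_integral u y) {-1..y}" if y: "y \<in> I11" for y
  proof -
    have "((\<lambda>t. ((hA t * q3 t + A t * (- c * q1 t)) + C 1 * (c * q2 t) - (hC t * q4 t + C t * (c * q2 t))) / (c * S))
        has_integral ((A y * q3 y + C 1 * (q4 y - q4 (-1)) - C y * q4 y) / (c * S))) {-1..y}"
      unfolding A_def C_def using y
      by (intro has_integral_divide has_integral_add has_integral_diff has_integral_mult_right ibp ftc int d continuous_intros cont)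
    then have "((\<lambda>t. ((hA t * q3 t + A t * (- c * q1 t)) + C 1 * (c * q2 t) - (hC t * q4 t + C t * (c * q2 t))) / (c * S))
        has_integral (u y)) {-1..y}"
      by (simp add: u[OF y] q4_def algebra_simps)
    then show ?thesis
    proof (rule has_integral_eq[rotated])
      fix t
      have "hA t * q3 t = hC t * q4 t" by (simp add: hA_def hC_def)
      then show "((hA t * q3 t + A t * (- c * q1 t)) + C 1 * (c * q2 t) - (hC t * q4 t + C t * (c * q2 t))) / (c * S) = p t"
        using c0 S0 by (simp add: p_def field_simps)
    qed
  qed
  have p_int: "((\<lambda>t. complex_of_real (\<alpha>\<^sup>2) * u t - f t) has_integral (p y - p (-1))) {-1..y}" if y: "y \<in> I11" for y
  proof -
    have "((\<lambda>t. (- (hA t * q1 t + A t * (- c * q3 t)) + C 1 * (c * q4 t) - (hC t * q2 t + C t * (c * q4 t))) / S)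
        has_integral ((- (A y * q1 y) + C 1 * (q2 y - q2 (-1)) - C y * q2 y) / S)) {-1..y}"
      unfolding A_def C_def using y
      by (intro has_integral_divide has_integral_add has_integral_diff has_integral_neg has_integral_mult_right ibp ftc int d continuous_intros cont)
    moreover have "(- (A y * q1 y) + C 1 * (q2 y - q2 (-1)) - C y * q2 y) / S = p y - p (-1)"
      by (simp add: p_def A_def C_def q2_def diff_divide_distrib[symmetric] algebra_simps)
    ultimately have "((\<lambda>t. (- (hA t * q1 t + A t * (- c * q3 t)) + C 1 * (c * q4 t) - (hC t * q2 t + C t * (c * q4 t))) / S)
        has_integral (p y - p (-1))) {-1..y}" by simp
    then show ?thesis
    proof (rule has_integral_eq[rotated])
      fix t assume "t \<in> {-1..y}"
      then have t: "t \<in> I11" using y by (auto simp: I11_def)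
      have "hA t * q1 t + hC t * q2 t = (q4 t * q1 t + q3 t * q2 t) * f t"
        by (simp add: hA_def hC_def algebra_simps)
      then have 1: "hC t * q2 t = S * f t - hA t * q1 t" unfolding add by (metis add_diff_cancel_left')
      have "complex_of_real (\<alpha>\<^sup>2) * u t = c * (q3 t * A t + q4 t * (C 1 - C t)) / S"
        using c0 by (simp add: u[OF t] c_def power2_eq_square)
      then show "(- (hA t * q1 t + A t * (- c * q3 t)) + C 1 * (c * q4 t) - (hC t * q2 t + C t * (c * q4 t))) / S
          = complex_of_real (\<alpha>\<^sup>2) * u t - f t"
        unfolding 1 using S0 by (simp add: field_simps)
    qed
  qed
  have "dirichlet_pair \<alpha> f u p"
    unfolding dirichlet_pair_def
  proof (intro conjI ballI)
    show "u (-1) = 0" "u 1 = 0" by (simp_all add: u I11_def A_def C_def q3_def q4_def)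
    show "continuous_on I11 p" by (rule contp)
    show "p y = p (- 1) + integral {- 1..y} (\<lambda>t. complex_of_real (\<alpha>\<^sup>2) * u t - f t)" if "y \<in> I11" for y
      using integral_unique[OF p_int[OF that]] by simp
    show "(u has_vector_derivative p y) (at y within I11)" if "y \<in> I11" for y
    proof -
      have "((\<lambda>y. integral {-1..y} p) has_vector_derivative p y) (at y within I11)"
        using contp that unfolding I11_def by (intro integral_has_vector_derivative)
      then show ?thesis
        by (rule has_vector_derivative_transform[rotated 2]) (use that integral_unique[OF u_int] in auto)
    qed
  qed
  then show ?thesis using that unfolding u_def by blast
qed

text \<open>The Green integral supplies a solution, the energy identity forbids a second one on
  \<open>I11\<close>, and the normalisation off \<open>I11\<close> turns this into equality of
  functions, as the definite description demands.\<close>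

lemma dirichlet_inv_green:
  fixes f :: "real \<Rightarrow> complex"
  assumes "\<alpha> > 0" "f \<in> L2"
  shows "dirichlet_inv \<alpha> f = (\<lambda>y. if y \<in> I11 then (LINT t|\<mu>. complex_of_real (green \<alpha> y t) * f t) else 0)"
    (is "_ = ?u")
  unfolding dirichlet_inv_def
proof (rule the_equality)
  obtain u' where u': "dirichlet_pair \<alpha> f ?u u'" using green_dirichlet_pair[OF assms] by blast
  show "dirichlet_solves \<alpha> f ?u"
    using u' assms by (intro solves_of_dirichlet_pair L2_integrable) auto
  fix w assume w: "dirichlet_solves \<alpha> f w"
  then obtain w' where w': "dirichlet_pair \<alpha> f w w'" using dirichlet_pair_of_solves by blast
  show "w = ?u"
  proof
    fix y
    show "w y = ?u y"
      using dirichlet_unique[OF assms(1) w' u' assms(2), of y] w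
      by (cases "y \<in> I11") (auto simp: dirichlet_solves_def)
  qed
qed

lemma dirichlet_inv_pair:
  assumes "\<alpha> > 0" "f \<in> L2"
  obtains u' where "dirichlet_pair \<alpha> f (dirichlet_inv \<alpha> f) u'"
  using green_dirichlet_pair[OF assms] dirichlet_inv_green[OF assms] by metis

section \<open>Wirtinger's inequality\<close>

text \<open>Riccati trick: for t = w tan (w (y - m)) with m the midpoint, the integrand r'^2 - w^2 r^2
  is (r' + t r)^2 up to the exact derivative of t r^2; as w (b - a) < pi, t is smooth on [a, b].\<close>
lemma wirtinger_aux:
  fixes r r' :: "real \<Rightarrow> real"
  assumes ab: "a < b" and r: "\<And>y. y \<in> {a..b} \<Longrightarrow> (r has_real_derivative r' y) (at y within {a..b})"
    and cont: "continuous_on {a..b} r'" and bc: "r a = 0" "r b = 0"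
    and w: "0 < w" "w * (b - a) < pi"
  shows "w\<^sup>2 * integral {a..b} (\<lambda>y. (r y)\<^sup>2) \<le> integral {a..b} (\<lambda>y. (r' y)\<^sup>2)"
proof -
  define m where "m = (a + b) / 2"
  define t where "t = (\<lambda>y. w * tan (w * (y - m)))"
  have cos: "cos (w * (y - m)) > 0" if "y \<in> {a..b}" for y
  proof (rule cos_gt_zero_pi)
    have "w * (y - m) \<le> w * ((b - a) / 2)" "w * (- (b - a) / 2) \<le> w * (y - m)"
      using that w by (auto intro!: mult_left_mono simp: m_def field_simps)
    then show "- (pi / 2) < w * (y - m)" "w * (y - m) < pi / 2" using w by (auto simp: field_simps)
  qed
  have cr: "continuous_on {a..b} r"
    by (rule DERIV_continuous_on[OF r])
  have ct: "continuous_on {a..b} t"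
  proof -
    have "cos (w * (y - m)) \<noteq> 0" if "y \<in> {a..b}" for y using cos[OF that] by simp
    then show ?thesis unfolding t_def by (intro continuous_intros) auto
  qed
  have dt: "(t has_real_derivative (w\<^sup>2 + (t y)\<^sup>2)) (at y within {a..b})" if "y \<in> {a..b}" for y
  proof -
    have "inverse ((cos (w * (y - m)))\<^sup>2) = 1 + (tan (w * (y - m)))\<^sup>2"
      using tan_sec[of "w * (y - m)"] cos[OF that] by (simp add: power_inverse)
    then show ?thesis
      unfolding t_def using cos[OF that]
      by (auto intro!: derivative_eq_intros simp: power2_eq_square algebra_simps)
  qed
  have "((\<lambda>y. (w\<^sup>2 + (t y)\<^sup>2) * (r y)\<^sup>2 + (2 * r y * r' y) * t y) has_integral
      (t b * (r b)\<^sup>2 - t a * (r a)\<^sup>2)) {a..b}"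
  proof (rule fundamental_theorem_of_calculus)
    show "((\<lambda>y. t y * (r y)\<^sup>2) has_vector_derivative
        ((w\<^sup>2 + (t y)\<^sup>2) * (r y)\<^sup>2 + (2 * r y * r' y) * t y)) (at y within {a..b})" if "y \<in> {a..b}" for y
      using dt[OF that] r[OF that]
      by (auto intro!: derivative_eq_intros simp flip: has_real_derivative_iff_has_vector_derivative)
  qed (use ab in simp)
  then have 1: "((\<lambda>y. (w\<^sup>2 + (t y)\<^sup>2) * (r y)\<^sup>2 + (2 * r y * r' y) * t y) has_integral 0) {a..b}"
    by (simp add: bc)
  have 2: "((\<lambda>y. (r' y)\<^sup>2 - w\<^sup>2 * (r y)\<^sup>2) has_integral
      (integral {a..b} (\<lambda>y. (r' y)\<^sup>2) - w\<^sup>2 * integral {a..b} (\<lambda>y. (r y)\<^sup>2))) {a..b}"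
    by (intro has_integral_diff has_integral_mult_right integrable_integral integrable_continuous_real
        continuous_intros cont cr)
  have sq: "((r' y)\<^sup>2 - w\<^sup>2 * (r y)\<^sup>2) + ((w\<^sup>2 + (t y)\<^sup>2) * (r y)\<^sup>2 + (2 * r y * r' y) * t y)
      = (r' y + t y * r y)\<^sup>2" for y
    by (simp add: power2_eq_square algebra_simps)
  have "((\<lambda>y. (r' y + t y * r y)\<^sup>2) has_integral
      (integral {a..b} (\<lambda>y. (r' y)\<^sup>2) - w\<^sup>2 * integral {a..b} (\<lambda>y. (r y)\<^sup>2) + 0)) {a..b}"
    using has_integral_add[OF 2 1] by (simp only: sq)
  from has_integral_nonneg[OF this] show ?thesis by simp
qed

text \<open>At the critical w = pi/(b - a) the tangent blows up at both endpoints, so the inequality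
  is taken for smaller w and passed to the limit.\<close>

lemma wirtinger_real:
  fixes r r' :: "real \<Rightarrow> real"
  assumes ab: "a < b" and r: "\<And>y. y \<in> {a..b} \<Longrightarrow> (r has_real_derivative r' y) (at y within {a..b})"
    and cont: "continuous_on {a..b} r'" and bc: "r a = 0" "r b = 0"
  shows "(pi / (b - a))\<^sup>2 * integral {a..b} (\<lambda>y. (r y)\<^sup>2) \<le> integral {a..b} (\<lambda>y. (r' y)\<^sup>2)"
proof (rule tendsto_upperbound)
  show "((\<lambda>w. w\<^sup>2 * integral {a..b} (\<lambda>y. (r y)\<^sup>2)) \<longlongrightarrow> (pi / (b - a))\<^sup>2 * integral {a..b} (\<lambda>y. (r y)\<^sup>2))
      (at_left (pi / (b - a)))"
    by (intro tendsto_intros)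
  show "\<forall>\<^sub>F w in at_left (pi / (b - a)).
      w\<^sup>2 * integral {a..b} (\<lambda>y. (r y)\<^sup>2) \<le> integral {a..b} (\<lambda>y. (r' y)\<^sup>2)"
  proof (rule eventually_at_leftI[of 0])
    show "w\<^sup>2 * integral {a..b} (\<lambda>y. (r y)\<^sup>2) \<le> integral {a..b} (\<lambda>y. (r' y)\<^sup>2)"
      if "w \<in> {0<..<pi / (b - a)}" for w
      using that ab by (intro wirtinger_aux[OF ab r cont bc]) (auto simp: field_simps)
  qed (use ab in simp)
qed simp

lemma wirtinger:
  fixes u u' :: "real \<Rightarrow> complex"
  assumes ab: "a < b" and u: "\<And>y. y \<in> {a..b} \<Longrightarrow> (u has_vector_derivative u' y) (at y within {a..b})"
    and cont: "continuous_on {a..b} u'" and bc: "u a = 0" "u b = 0"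
  shows "(pi / (b - a))\<^sup>2 * integral {a..b} (\<lambda>y. (cmod (u y))\<^sup>2) \<le> integral {a..b} (\<lambda>y. (cmod (u' y))\<^sup>2)"
proof -
  have cu: "continuous_on {a..b} u"
    using u by (metis continuous_on_eq_continuous_within has_vector_derivative_continuous)
  have split: "integral {a..b} (\<lambda>y. (cmod (v y))\<^sup>2)
      = integral {a..b} (\<lambda>y. (Re (v y))\<^sup>2) + integral {a..b} (\<lambda>y. (Im (v y))\<^sup>2)"
    if "continuous_on {a..b} v" for v
    unfolding cmod_power2 using that
    by (intro Henstock_Kurzweil_Integration.integral_add integrable_continuous_real continuous_intros)
  have "(pi / (b - a))\<^sup>2 * integral {a..b} (\<lambda>y. (Re (u y))\<^sup>2) \<le> integral {a..b} (\<lambda>y. (Re (u' y))\<^sup>2)"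
    using u bc by (intro wirtinger_real[OF ab] continuous_intros cont)
      (auto simp: has_vector_derivative_complex_iff)
  moreover have "(pi / (b - a))\<^sup>2 * integral {a..b} (\<lambda>y. (Im (u y))\<^sup>2) \<le> integral {a..b} (\<lambda>y. (Im (u' y))\<^sup>2)"
    using u bc by (intro wirtinger_real[OF ab] continuous_intros cont)
      (auto simp: has_vector_derivative_complex_iff)
  ultimately show ?thesis by (simp add: split[OF cu] split[OF cont] distrib_left)
qed

section \<open>The quadratic form\<close>

lemma dirichlet_pairD:
  assumes "dirichlet_pair \<alpha> f u u'"
  shows "u (-1) = 0" "u 1 = 0" "continuous_on I11 u'"
    "y \<in> I11 \<Longrightarrow> (u has_vector_derivative u' y) (at y within I11)"
  using assms unfolding dirichlet_pair_def by blast+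

lemma Re_ip_self_continuous:
  assumes "continuous_on I11 u"
  shows "Re (ip u u) = integral {-1..1} (\<lambda>y. (cmod (u y))\<^sup>2)"
  using ip_self[OF continuous_L2[OF assms]]
    lebesgue_integral_eq_integral[OF L2_square_integrable[OF continuous_L2[OF assms]]]
  by (simp add: I11_def)

section \<open>Linearity and symmetry of the Dirichlet inverse and of L\<close>

lemma dirichlet_inv_continuous:
  assumes "\<alpha> > 0" "f \<in> L2"
  shows "continuous_on I11 (dirichlet_inv \<alpha> f)" "dirichlet_inv \<alpha> f \<in> L2"
  using dirichlet_inv_pair[OF assms] dirichlet_pair_continuous continuous_L2 by metis+

lemma dirichlet_inv_lin:
  assumes "\<alpha> > 0" "f \<in> L2" "g \<in> L2"
  shows "dirichlet_inv \<alpha> (\<lambda>y. a * f y + b * g y) = (\<lambda>y. a * dirichlet_inv \<alpha> f y + b * dirichlet_inv \<alpha> g y)"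
proof -
  have gc: "continuous_on I11 (\<lambda>t. complex_of_real (green \<alpha> y t))" for y
    using continuous_on_compose2[OF green_continuous, of I11 "\<lambda>t. (y, t)" \<alpha>]
    by (force intro!: continuous_intros)
  have int: "integrable \<mu> (\<lambda>t. complex_of_real (green \<alpha> y t) * h t)" if "h \<in> L2" for h y
    by (rule L2_integrable[OF L2_mult_continuous[OF gc that]])
  have "(LINT t|\<mu>. complex_of_real (green \<alpha> y t) * (a * f t + b * g t))
      = (LINT t|\<mu>. a * (complex_of_real (green \<alpha> y t) * f t) + b * (complex_of_real (green \<alpha> y t) * g t))" for y
    by (simp add: algebra_simps)
  also have "\<dots> y = a * (LINT t|\<mu>. complex_of_real (green \<alpha> y t) * f t)
      + b * (LINT t|\<mu>. complex_of_real (green \<alpha> y t) * g t)" for y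
    using int[OF assms(2)] int[OF assms(3)] by simp
  finally show ?thesis
    unfolding dirichlet_inv_green[OF assms(1) assms(2)] dirichlet_inv_green[OF assms(1) assms(3)]
      dirichlet_inv_green[OF assms(1) L2_lin[OF assms(2,3)]]
    by (auto simp: fun_eq_iff)
qed

lemma dirichlet_inv_cong:
  assumes "aeq f g"
  shows "dirichlet_inv \<alpha> f = dirichlet_inv \<alpha> g"
proof -
  have "(AE y in \<mu>. - v y + complex_of_real (\<alpha>\<^sup>2) * u y = f y)
      \<longleftrightarrow> (AE y in \<mu>. - v y + complex_of_real (\<alpha>\<^sup>2) * u y = g y)" for u v
    using assms unfolding aeq_def by (intro eventually_cong) auto
  then have "dirichlet_solves \<alpha> f = dirichlet_solves \<alpha> g"
    unfolding dirichlet_solves_def fun_eq_iff by simp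
  then show ?thesis by (simp add: dirichlet_inv_def)
qed

lemma dirichlet_inv_cnj:
  assumes "\<alpha> > 0" "f \<in> L2"
  shows "dirichlet_inv \<alpha> (\<lambda>y. cnj (f y)) = (\<lambda>y. cnj (dirichlet_inv \<alpha> f y))"
proof -
  have "(LINT t|\<mu>. complex_of_real (green \<alpha> y t) * cnj (f t))
      = (LINT t|\<mu>. cnj (complex_of_real (green \<alpha> y t) * f t))" for y by simp
  also have "\<dots> y = cnj (LINT t|\<mu>. complex_of_real (green \<alpha> y t) * f t)" for y
    by (rule Bochner_Integration.integral_cnj)
  finally show ?thesis
    unfolding dirichlet_inv_green[OF assms] dirichlet_inv_green[OF assms(1) L2_cnj[OF assms(2)]]
    by (auto simp: fun_eq_iff)
qed

lemma dirichlet_inv_symmetric: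
  assumes "\<alpha> > 0" "f \<in> L2" "g \<in> L2"
  shows "ip (dirichlet_inv \<alpha> f) g = ip f (dirichlet_inv \<alpha> g)"
proof -
  obtain u' where u: "dirichlet_pair \<alpha> f (dirichlet_inv \<alpha> f) u'"
    using dirichlet_inv_pair[OF assms(1,2)] by blast
  obtain v' where v: "dirichlet_pair \<alpha> g (dirichlet_inv \<alpha> g) v'"
    using dirichlet_inv_pair[OF assms(1,3)] by blast
  have 1: "ip f (dirichlet_inv \<alpha> g) = ip u' v' + complex_of_real (\<alpha>\<^sup>2) * ip (dirichlet_inv \<alpha> f) (dirichlet_inv \<alpha> g)"
    using v by (intro dirichlet_weak_form[OF u assms(2)]) (auto simp only: dirichlet_pair_def)
  have 2: "ip g (dirichlet_inv \<alpha> f) = ip v' u' + complex_of_real (\<alpha>\<^sup>2) * ip (dirichlet_inv \<alpha> g) (dirichlet_inv \<alpha> f)"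
    using u by (intro dirichlet_weak_form[OF v assms(3)]) (auto simp only: dirichlet_pair_def)
  have "ip (dirichlet_inv \<alpha> f) g = cnj (ip g (dirichlet_inv \<alpha> f))" by (rule ip_herm)
  also have "\<dots> = cnj (ip v' u') + complex_of_real (\<alpha>\<^sup>2) * cnj (ip (dirichlet_inv \<alpha> g) (dirichlet_inv \<alpha> f))"
    by (simp add: 2)
  also have "\<dots> = ip f (dirichlet_inv \<alpha> g)"
    unfolding 1 by (simp add: ip_herm[of u' v'] ip_herm[of "dirichlet_inv \<alpha> f" "dirichlet_inv \<alpha> g"])
  finally show ?thesis .
qed

lemma L_op_lin:
  assumes "\<alpha> > 0" "f \<in> L2" "g \<in> L2"
  shows "L_op \<alpha> (\<lambda>y. a * f y + b * g y) = (\<lambda>y. a * L_op \<alpha> f y + b * L_op \<alpha> g y)"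
  unfolding L_op_def dirichlet_inv_lin[OF assms] by (auto simp: fun_eq_iff field_simps)

lemma L_op_alt: "L_op \<alpha> f = (\<lambda>y. complex_of_real (1 / pi\<^sup>2) * f y + (-1) * dirichlet_inv \<alpha> f y)"
  by (simp add: L_op_def fun_eq_iff)

lemma L_op_L2: "\<alpha> > 0 \<Longrightarrow> f \<in> L2 \<Longrightarrow> L_op \<alpha> f \<in> L2"
  unfolding L_op_alt by (intro L2_lin dirichlet_inv_continuous)

lemma ip_L_op:
  assumes "\<alpha> > 0" "f \<in> L2" "g \<in> L2"
  shows "ip (L_op \<alpha> f) g = complex_of_real (1 / pi\<^sup>2) * ip f g - ip (dirichlet_inv \<alpha> f) g"
  unfolding L_op_alt using assms by (subst ip_lin) (auto intro: dirichlet_inv_continuous)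

lemma L_op_symmetric:
  assumes "\<alpha> > 0" "f \<in> L2" "g \<in> L2"
  shows "ip (L_op \<alpha> f) g = ip f (L_op \<alpha> g)"
proof -
  have "ip f (L_op \<alpha> g) = cnj (ip (L_op \<alpha> g) f)" by (rule ip_herm)
  also have "\<dots> = complex_of_real (1 / pi\<^sup>2) * ip f g - cnj (ip (dirichlet_inv \<alpha> g) f)"
    using assms by (simp add: ip_L_op ip_herm[of f g])
  also have "cnj (ip (dirichlet_inv \<alpha> g) f) = ip (dirichlet_inv \<alpha> f) g"
    using assms dirichlet_inv_symmetric by (simp add: ip_herm[of f])
  finally show ?thesis using assms by (simp add: ip_L_op)
qed

lemma L_op_cong: "aeq f g \<Longrightarrow> aeq (L_op \<alpha> f) (L_op \<alpha> g)"
  using dirichlet_inv_cong[of f g \<alpha>] unfolding aeq_def L_op_def by auto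

text \<open>Put w = G f and s = k + \<alpha>^2. The energy identity gives s \<langle>w, w\<rangle>
  \<le> \<langle>f, w\<rangle>, and expanding \<langle>f - s w, f - s w\<rangle> \<ge> 0 then yields
  s \<langle>f, w\<rangle> \<le> \<langle>f, f\<rangle>. This converts a Wirtinger constant k into a
  bound for the form without spectral decomposition.\<close>

lemma form_lower_bound:
  assumes a: "\<alpha> > 0" and f: "f \<in> L2" and u: "dirichlet_pair \<alpha> f (dirichlet_inv \<alpha> f) u'"
    and k: "k \<ge> 0" "k * Re (ip (dirichlet_inv \<alpha> f) (dirichlet_inv \<alpha> f)) \<le> Re (ip u' u')"
  shows "(1 / pi\<^sup>2 - 1 / (k + \<alpha>\<^sup>2)) * Re (ip f f) \<le> Re (ip (L_op \<alpha> f) f)"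
proof -
  define w where "w = dirichlet_inv \<alpha> f"
  define s where "s = k + \<alpha>\<^sup>2"
  have s: "s > 0" using a k by (simp add: s_def add_nonneg_pos)
  have w: "w \<in> L2" unfolding w_def by (rule dirichlet_inv_continuous[OF a f])
  have "ip f w = ip u' u' + complex_of_real (\<alpha>\<^sup>2) * ip w w"
    unfolding w_def by (rule dirichlet_energy[OF u f])
  then have "Re (ip f w) = Re (ip u' u') + \<alpha>\<^sup>2 * Re (ip w w)" by (simp del: of_real_power)
  then have 1: "s * Re (ip w w) \<le> Re (ip f w)"
    using k(2) by (simp add: s_def w_def algebra_simps)
  define d where "d = (\<lambda>y. 1 * f y + complex_of_real (- s) * w y)"
  have dL: "d \<in> L2" unfolding d_def by (intro L2_lin f w)
  have 2: "Re (ip d g) = Re (ip f g) - s * Re (ip w g)" if "g \<in> L2" for g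
    unfolding d_def ip_lin[OF f w that] by simp
  have sym: "Re (ip g h) = Re (ip h g)" for g h
    using ip_herm[of g h] by simp
  have "Re (ip d d) = Re (ip d f) - s * Re (ip d w)"
    using 2[OF dL] sym[of f d] sym[of w d] by simp
  then have "0 \<le> Re (ip f f) - s * Re (ip f w) - s * (Re (ip f w) - s * Re (ip w w))"
    using ip_self_nonneg(1)[of d] 2[OF f] 2[OF w] sym[of w f] by simp
  moreover have "s * (s * Re (ip w w)) \<le> s * Re (ip f w)" using 1 s by simp
  ultimately have "s * Re (ip f w) \<le> Re (ip f f)" by (simp add: algebra_simps)
  then have "Re (ip f w) \<le> Re (ip f f) / s" using s by (simp add: field_simps)
  moreover have "Re (ip (L_op \<alpha> f) f) = Re (ip f f) / pi\<^sup>2 - Re (ip f w)"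
    using ip_L_op[OF a f f] sym[of w f] by (simp add: w_def)
  ultimately show ?thesis by (simp add: s_def algebra_simps)
qed

lemma dirichlet_wirtinger:
  assumes u: "dirichlet_pair \<alpha> f u u'"
  shows "(pi / 2)\<^sup>2 * Re (ip u u) \<le> Re (ip u' u')"
proof -
  have c: "continuous_on I11 u'" "continuous_on I11 u"
    using u dirichlet_pair_continuous[OF u] by (auto simp only: dirichlet_pair_def)
  have "(pi / (1 - (-1)))\<^sup>2 * integral {-1..1} (\<lambda>y. (cmod (u y))\<^sup>2) \<le> integral {-1..1} (\<lambda>y. (cmod (u' y))\<^sup>2)"
    using dirichlet_pairD[OF u] unfolding I11_def by (intro wirtinger) auto
  then show ?thesis by (simp add: Re_ip_self_continuous c)
qed

text \<open>A zero at the midpoint leaves two Dirichlet problems on intervals of length 1, which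
  raises the constant from the first eigenvalue (pi/2)^2 to the second one, pi^2.\<close>

lemma dirichlet_wirtinger_node:
  assumes u: "dirichlet_pair \<alpha> f u u'" and "u 0 = 0"
  shows "pi\<^sup>2 * Re (ip u u) \<le> Re (ip u' u')"
proof -
  have c: "continuous_on I11 u'" "continuous_on I11 u"
    using u dirichlet_pair_continuous[OF u] by (auto simp only: dirichlet_pair_def)
  have d: "(u has_vector_derivative u' y) (at y within {a..b})" if "y \<in> {a..b}" "{a..b} \<subseteq> {-1..1}" for y a b
    using dirichlet_pairD(4)[OF u, of y] that unfolding I11_def
    by (meson has_vector_derivative_within_subset subsetD)
  have "(pi / (0 - (-1)))\<^sup>2 * integral {-1..0} (\<lambda>y. (cmod (u y))\<^sup>2) \<le> integral {-1..0} (\<lambda>y. (cmod (u' y))\<^sup>2)"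
    using dirichlet_pairD(1,2)[OF u] assms(2) c(1) unfolding I11_def
    by (intro wirtinger d) (auto elim: continuous_on_subset)
  moreover have "(pi / (1 - 0))\<^sup>2 * integral {0..1} (\<lambda>y. (cmod (u y))\<^sup>2) \<le> integral {0..1} (\<lambda>y. (cmod (u' y))\<^sup>2)"
    using dirichlet_pairD(1,2)[OF u] assms(2) c(1) unfolding I11_def
    by (intro wirtinger d) (auto elim: continuous_on_subset)
  moreover have "integral {-1..1} (\<lambda>y. (cmod (v y))\<^sup>2)
      = integral {-1..0} (\<lambda>y. (cmod (v y))\<^sup>2) + integral {0..1} (\<lambda>y. (cmod (v y))\<^sup>2)" if "continuous_on I11 v" for v
    using that unfolding I11_def
    by (intro Henstock_Kurzweil_Integration.integral_combine[symmetric] integrable_continuous_real continuous_intros) auto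
  ultimately show ?thesis by (simp add: Re_ip_self_continuous c distrib_left)
qed

text \<open>Since (sqrt 3 pi/2)^2 = pi^2 - (pi/2)^2, the factor 1/pi^2 - 1/((pi/2)^2 + \<alpha>^2)
  from Wirtinger's inequality is non-negative exactly from this wave number on.\<close>

lemma L_op_nonneg:
  assumes a: "\<alpha> \<ge> sqrt 3 * pi / 2" and f: "f \<in> L2"
  shows "Re (ip (L_op \<alpha> f) f) \<ge> 0"
proof -
  have "sqrt 3 * pi / 2 > 0" by simp
  then have a0: "\<alpha> > 0" using a by linarith
  obtain u' where u: "dirichlet_pair \<alpha> f (dirichlet_inv \<alpha> f) u'"
    using dirichlet_inv_pair[OF a0 f] by blast
  have "(sqrt 3 * pi / 2)\<^sup>2 \<le> \<alpha>\<^sup>2" using a by (intro power_mono) auto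
  then have "pi\<^sup>2 \<le> (pi / 2)\<^sup>2 + \<alpha>\<^sup>2" by (simp add: power_mult_distrib power_divide)
  then have "1 / ((pi / 2)\<^sup>2 + \<alpha>\<^sup>2) \<le> 1 / pi\<^sup>2" by (intro divide_left_mono) (auto intro!: mult_pos_pos add_nonneg_pos a0)
  then have "0 \<le> (1 / pi\<^sup>2 - 1 / ((pi / 2)\<^sup>2 + \<alpha>\<^sup>2)) * Re (ip f f)"
    using ip_self_nonneg[of f] by simp
  also have "\<dots> \<le> Re (ip (L_op \<alpha> f) f)"
    by (rule form_lower_bound[OF a0 f u _ dirichlet_wirtinger[OF u]]) simp
  finally show ?thesis .
qed

text \<open>The condition that the stream function vanish at 0 cuts out a subspace of codimension one,
  on which Wirtinger's inequality applies to each half of the interval.\<close>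
lemma L_op_pos_on_node_subspace:
  assumes a: "\<alpha> > 0" and f: "f \<in> L2" and "dirichlet_inv \<alpha> f 0 = 0" "Re (ip (L_op \<alpha> f) f) \<le> 0"
  shows "aeq f (\<lambda>_. 0)"
proof -
  obtain u' where u: "dirichlet_pair \<alpha> f (dirichlet_inv \<alpha> f) u'"
    using dirichlet_inv_pair[OF a f] by blast
  have "(1 / pi\<^sup>2 - 1 / (pi\<^sup>2 + \<alpha>\<^sup>2)) * Re (ip f f) \<le> Re (ip (L_op \<alpha> f) f)"
    by (rule form_lower_bound[OF a f u _ dirichlet_wirtinger_node[OF u assms(3)]]) simp
  then have "(1 / pi\<^sup>2 - 1 / (pi\<^sup>2 + \<alpha>\<^sup>2)) * Re (ip f f) \<le> 0" using assms(4) by simp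
  moreover have "1 / pi\<^sup>2 - 1 / (pi\<^sup>2 + \<alpha>\<^sup>2) > 0"
    using a by (simp add: field_simps add_pos_pos)
  ultimately have "Re (ip f f) \<le> 0" by (simp add: mult_le_0_iff)
  then show ?thesis by (rule ip_self_eq_0[OF f])
qed

section \<open>Linear stability\<close>

text \<open>This is \<beta> - U'', the gradient of absolute vorticity, in closed form; see
  \<open>vort_eq\<close>.\<close>

definition vort :: "real \<Rightarrow> real \<Rightarrow> real" where
  "vort \<beta> y = \<beta> + pi\<^sup>2 / 2 * cos (pi * y)"

lemma deriv2_sinus_U: "deriv (deriv sinus_U) y = - (pi\<^sup>2 / 2 * cos (pi * y))"
proof -
  have "deriv sinus_U = (\<lambda>y. - (pi / 2 * sin (pi * y)))"
    unfolding sinus_U_def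
    by (intro ext DERIV_imp_deriv) (auto intro!: derivative_eq_intros)
  then show ?thesis
    by (simp, intro DERIV_imp_deriv) (auto intro!: derivative_eq_intros simp: power2_eq_square)
qed

lemma vort_eq: "\<beta> - deriv (deriv sinus_U) y = vort \<beta> y"
  by (simp add: deriv2_sinus_U vort_def)

text \<open>The special feature of the Sinus flow: \<beta> - U'' is proportional to U minus the
  constant 1/2 - \<beta>/pi^2. The proportionality factor pi^2 is what the energy has to dominate in
  the stability argument.\<close>

lemma vort_sinus_U: "vort \<beta> y = pi\<^sup>2 * (sinus_U y - (1 / 2 - \<beta> / pi\<^sup>2))"
  by (simp add: vort_def sinus_U_def field_simps)

lemma vort_continuous: "continuous_on S (vort \<beta>)"
  unfolding vort_def by (intro continuous_intros)

lemma sinus_U_continuous: "continuous_on S sinus_U"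
  unfolding sinus_U_def by (intro continuous_intros) auto

text \<open>The real part of the integrand is Re w times |u|^2, continuous and non-negative, and its
  integral is not positive. The weight is complex because in the application it carries a multiple
  of the imaginary part of the energy identity.\<close>

lemma positive_weight_ip_nonpos:
  assumes w: "continuous_on I11 w" "\<And>y. y \<in> I11 \<Longrightarrow> Re (w y) > 0" and u: "continuous_on I11 u"
    and "Re (ip (\<lambda>y. w y * u y) u) \<le> 0" "y \<in> I11"
  shows "u y = 0"
proof -
  define g where "g = (\<lambda>y. Re (w y) * (cmod (u y))\<^sup>2)"
  have cg: "continuous_on {-1..1} g"
    using w u unfolding g_def I11_def by (intro continuous_intros)
  have g0: "g y \<ge> 0" if "y \<in> {-1..1}" for y
    using w(2)[of y] that by (simp add: g_def I11_def)
  have "((\<lambda>y. (w y * u y) * cnj (u y)) has_integral ip (\<lambda>y. w y * u y) u) I11"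
    using w u by (intro ip_integral continuous_L2 continuous_intros)
  then have "((\<lambda>y. Re ((w y * u y) * cnj (u y))) has_integral Re (ip (\<lambda>y. w y * u y) u)) I11"
    by (rule has_integral_Re)
  moreover have "Re ((w y * u y) * cnj (u y)) = g y" for y
    by (simp add: g_def cmod_power2) (simp add: power2_eq_square algebra_simps)
  ultimately have "integral {-1..1} g \<le> 0"
    using assms(4) by (simp add: has_integral_iff I11_def)
  moreover have "integral {-1..1} g \<ge> 0"
    by (intro integral_nonneg integrable_continuous_real cg g0)
  ultimately have "integral {-1..1} g = 0" by simp
  then have "\<forall>y\<in>{-1..1}. g y = 0"
    using g0 by (subst (asm) integral_eq_0_iff[OF cg]) auto
  then have "g y = 0" using assms(5) by (simp add: I11_def)
  then show ?thesis using assms(5) w(2)[of y] by (simp add: g_def)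
qed

text \<open>A classical solution has derivatives only inside the interval. Integrating the
  continuous right-hand side twice gives a C^1 function up to the endpoints; it agrees with \<phi>
  because both are continuous with equal derivative inside and equal value at -1.\<close>

lemma classical_dirichlet_pair:
  assumes f: "continuous_on I11 f" and phi: "continuous_on I11 \<phi>" "\<phi> (-1) = 0" "\<phi> 1 = 0"
    and d: "\<And>y. y \<in> {-1<..<1} \<Longrightarrow> (\<phi> has_vector_derivative \<phi>' y) (at y)"
      "\<And>y. y \<in> {-1<..<1} \<Longrightarrow> (\<phi>' has_vector_derivative (complex_of_real (k\<^sup>2) * \<phi> y - f y)) (at y)"
  obtains p where "dirichlet_pair k f \<phi> p"
proof -
  define g where "g = (\<lambda>y. complex_of_real (k\<^sup>2) * \<phi> y - f y)"
  have cg: "continuous_on {-1..1} g" using f phi unfolding g_def I11_def by (intro continuous_intros)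
  define P where "P = (\<lambda>y. integral {-1..y} g)"
  have dP: "(P has_vector_derivative g y) (at y within {-1..1})" if "y \<in> {-1..1}" for y
    unfolding P_def by (rule integral_has_vector_derivative[OF cg that])
  have inner: "at y within {-1..1} = at y" if "y \<in> {-1<..<1}" for y :: real
    using that by (intro at_within_interior) auto
  have "\<exists>c. \<forall>y\<in>{-1<..<1}. \<phi>' y - P y = c"
  proof (rule has_vector_derivative_zero_constant)
    show "((\<lambda>y. \<phi>' y - P y) has_vector_derivative 0) (at y within {-1<..<1})" if "y \<in> {-1<..<1}" for y
    proof -
      have "((\<lambda>y. \<phi>' y - P y) has_vector_derivative (g y - g y)) (at y)"
        using d(2)[OF that] dP[of y] that inner[OF that]
        by (intro has_vector_derivative_diff) (auto simp: g_def)
      then show ?thesis by (auto intro: has_vector_derivative_at_within)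
    qed
  qed auto
  then obtain c where c: "\<And>y. y \<in> {-1<..<1} \<Longrightarrow> \<phi>' y = c + P y" by (force simp: algebra_simps)
  define p where "p = (\<lambda>y. c + P y)"
  have cp: "continuous_on {-1..1} p"
    unfolding p_def using dP
    by (intro continuous_intros) (metis continuous_on_eq_continuous_within has_vector_derivative_continuous)
  define R where "R = (\<lambda>y. integral {-1..y} p)"
  have dR: "(R has_vector_derivative p y) (at y within {-1..1})" if "y \<in> {-1..1}" for y
    unfolding R_def by (rule integral_has_vector_derivative[OF cp that])
  have cR: "continuous_on {-1..1} R"
    using dR by (metis continuous_on_eq_continuous_within has_vector_derivative_continuous)
  have eq: "\<phi> y = R y" if y: "y \<in> {-1..1}" for y
  proof -
    have "\<phi> y - R y = \<phi> (-1) - R (-1)"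
    proof (rule has_derivative_zero_unique_strong_convex[of "{-1..1}" "{-1,1}" "\<lambda>y. \<phi> y - R y"])
      show "continuous_on {-1..1} (\<lambda>y. \<phi> y - R y)"
        using phi(1) cR by (auto simp: I11_def intro!: continuous_intros)
      show "((\<lambda>y. \<phi> y - R y) has_derivative (\<lambda>h. 0)) (at x within {- 1..1})" if "x \<in> {- 1..1} - {- 1, 1}" for x
      proof -
        have x: "x \<in> {-1<..<1}" using that by auto
        have "((\<lambda>y. \<phi> y - R y) has_vector_derivative (p x - p x)) (at x)"
          using d(1)[OF x] dR[of x] that inner[OF x] c[OF x]
          by (intro has_vector_derivative_diff) (auto simp: p_def)
        then have "((\<lambda>y. \<phi> y - R y) has_derivative (\<lambda>h. 0)) (at x)"
          by (simp add: has_vector_derivative_def)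
        then show ?thesis by (rule has_derivative_at_withinI)
      qed
    qed (use y in auto)
    then show ?thesis using phi(2) by (simp add: R_def)
  qed
  have "dirichlet_pair k f \<phi> p"
    unfolding dirichlet_pair_def
  proof (intro conjI ballI)
    show "continuous_on I11 p" using cp by (simp add: I11_def)
    show "(\<phi> has_vector_derivative p y) (at y within I11)" if "y \<in> I11" for y
      using that dR[of y] eq unfolding I11_def
      by (intro has_vector_derivative_transform[of y _ \<phi> R]) auto
    show "p y = p (- 1) + integral {- 1..y} (\<lambda>t. complex_of_real (k\<^sup>2) * \<phi> t - f t)" if "y \<in> I11" for y
      by (simp add: p_def P_def g_def)
  qed (use phi in auto)
  then show ?thesis using that by blast
qed

text \<open>Write f = q \<phi> with q = (\<beta> - U'')/(U - c). The energy identity shows that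
  \<langle>f, \<phi>\<rangle> is real and, by Wirtinger, at least pi^2 \<langle>\<phi>,
  \<phi>\<rangle>. Being real, it may be multiplied by 1 + i s without changing the real part, so
  \<langle>w \<phi>, \<phi>\<rangle> has non-positive real part for w = pi^2 - (1 + i s) q. A
  suitable s makes Re w positive, which forces \<phi> = 0.\<close>

lemma linearly_stable_large_wavenumber:
  assumes a: "\<alpha> \<ge> sqrt 3 * pi / 2"
  shows "linearly_stable \<alpha> \<beta>"
  unfolding linearly_stable_def
proof (intro notI, elim exE conjE)
  fix l :: nat and c :: complex and \<phi> \<phi>' \<phi>'' :: "real \<Rightarrow> complex"
  assume l: "1 \<le> l" and c: "0 < Im c" and phi: "continuous_on I11 \<phi>" "\<phi> (- 1) = 0" "\<phi> 1 = 0"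
    and ode: "\<forall>y\<in>{- 1<..<1}.
          (\<phi> has_vector_derivative \<phi>' y) (at y) \<and>
          (\<phi>' has_vector_derivative \<phi>'' y) (at y) \<and>
          - \<phi>'' y + complex_of_real ((real l * \<alpha>)\<^sup>2) * \<phi> y -
          complex_of_real (\<beta> - deriv (deriv sinus_U) y) /
          (complex_of_real (sinus_U y) - c) * \<phi> y = 0"
    and nz: "\<exists>y\<in>{- 1<..<1}. \<phi> y \<noteq> 0"
  define k where "k = real l * \<alpha>"
  define W where "W = (\<lambda>y. complex_of_real (sinus_U y) - c)"
  define q where "q = (\<lambda>y. complex_of_real (vort \<beta> y) / W y)"
  have a0: "\<alpha> > 0" using a by (smt (verit) divide_pos_pos mult_pos_pos pi_gt_zero real_sqrt_gt_0_iff)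
  have ka: "\<alpha> \<le> k" using l a0 by (simp add: k_def)
  have W0: "W y \<noteq> 0" for y using c by (auto simp: W_def complex_eq_iff)
  have cq: "continuous_on I11 q"
    unfolding q_def using W0 unfolding W_def
    by (intro continuous_intros continuous_on_of_real vort_continuous sinus_U_continuous) auto
  define f where "f = (\<lambda>y. q y * \<phi> y)"
  have cf: "continuous_on I11 f" unfolding f_def by (intro continuous_intros cq phi)
  obtain p where p: "dirichlet_pair k f \<phi> p"
  proof (rule classical_dirichlet_pair[OF cf phi])
    fix y :: real assume y: "y \<in> {-1<..<1}"
    show "(\<phi> has_vector_derivative \<phi>' y) (at y)" using ode y by blast
    have "\<phi>'' y = complex_of_real (k\<^sup>2) * \<phi> y - f y"
      using ode[rule_format, OF y] unfolding vort_eq k_def[symmetric] f_def q_def W_def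
      by (simp add: algebra_simps)
    then show "(\<phi>' has_vector_derivative complex_of_real (k\<^sup>2) * \<phi> y - f y) (at y)"
      using ode y by metis
  qed
  have L: "f \<in> L2" "\<phi> \<in> L2" using cf phi by (auto intro: continuous_L2)
  have E: "ip f \<phi> = ip p p + complex_of_real (k\<^sup>2) * ip \<phi> \<phi>"
    by (rule dirichlet_energy[OF p L(1)])
  have im: "Im (ip f \<phi>) = 0" unfolding E by (simp add: ip_self_nonneg del: of_real_power)
  have "(pi / 2)\<^sup>2 * Re (ip \<phi> \<phi>) + k\<^sup>2 * Re (ip \<phi> \<phi>) \<le> Re (ip f \<phi>)"
    unfolding E using dirichlet_wirtinger[OF p] by (simp del: of_real_power)
  moreover have "pi\<^sup>2 * Re (ip \<phi> \<phi>) \<le> ((pi / 2)\<^sup>2 + k\<^sup>2) * Re (ip \<phi> \<phi>)"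
  proof (rule mult_right_mono)
    have "(sqrt 3 * pi / 2)\<^sup>2 \<le> k\<^sup>2" using a ka by (intro power_mono) auto
    then show "pi\<^sup>2 \<le> (pi / 2)\<^sup>2 + k\<^sup>2" by (simp add: power_mult_distrib power_divide)
  qed (rule ip_self_nonneg)
  ultimately have re: "pi\<^sup>2 * Re (ip \<phi> \<phi>) \<le> Re (ip f \<phi>)" by (simp add: distrib_right)
  define ub where "ub = 1 / 2 - \<beta> / pi\<^sup>2"
  \<comment> \<open>Chosen so that U cancels from the numerator: Re w becomes pi^2 |c -
    \<open>ub\<close>|^2 / |U - c|^2. This is where Im c > 0 is used.\<close>
  define s where "s = (Re c - ub) / Im c"
  define w where "w = (\<lambda>y. complex_of_real (pi\<^sup>2) - Complex 1 s * q y)"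
  have "\<phi> y = 0" if "y \<in> I11" for y
  proof (rule positive_weight_ip_nonpos[OF _ _ phi(1) _ that])
    show "continuous_on I11 w" unfolding w_def by (intro continuous_intros cq)
    show "Re (w y) > 0" for y
    proof -
      define U where "U = sinus_U y"
      define N where "N = (U - Re c)\<^sup>2 + (Im c)\<^sup>2"
      have N: "N > 0" using c by (auto simp: N_def intro!: add_nonneg_pos)
      have "Re (q y) = pi\<^sup>2 * (U - ub) * (U - Re c) / N" "Im (q y) = pi\<^sup>2 * (U - ub) * Im c / N"
        unfolding q_def W_def vort_sinus_U U_def[symmetric] ub_def[symmetric] N_def
        by (simp_all add: Re_divide Im_divide)
      then have "Re (w y) = pi\<^sup>2 - pi\<^sup>2 * (U - ub) * (U - Re c) / N + s * (pi\<^sup>2 * (U - ub) * Im c / N)"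
        by (simp add: w_def del: of_real_power)
      also have "s * (pi\<^sup>2 * (U - ub) * Im c / N) = (Re c - ub) * (pi\<^sup>2 * (U - ub)) / N"
        using c by (simp add: s_def)
      also have "pi\<^sup>2 - pi\<^sup>2 * (U - ub) * (U - Re c) / N + (Re c - ub) * (pi\<^sup>2 * (U - ub)) / N
          = pi\<^sup>2 * (N - (U - ub) * (U - Re c) + (Re c - ub) * (U - ub)) / N"
        using N by (simp add: field_simps)
      also have "N - (U - ub) * (U - Re c) + (Re c - ub) * (U - ub) = (Im c)\<^sup>2 + (Re c - ub)\<^sup>2"
        by (simp add: N_def power2_eq_square algebra_simps)
      also have "pi\<^sup>2 * ((Im c)\<^sup>2 + (Re c - ub)\<^sup>2) / N > 0"
        using N c by (auto intro!: divide_pos_pos mult_pos_pos add_pos_nonneg)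
      finally show ?thesis .
    qed
    have "(\<lambda>y. w y * \<phi> y) = (\<lambda>y. complex_of_real (pi\<^sup>2) * \<phi> y + (- Complex 1 s) * f y)"
      by (simp add: w_def f_def algebra_simps)
    then have "ip (\<lambda>y. w y * \<phi> y) \<phi> = complex_of_real (pi\<^sup>2) * ip \<phi> \<phi> + (- Complex 1 s) * ip f \<phi>"
      by (simp only: ip_lin[OF L(2,1,2)])
    then show "Re (ip (\<lambda>y. w y * \<phi> y) \<phi>) \<le> 0"
      using re im by (simp del: of_real_power)
  qed
  then show False using nz by (auto simp: I11_def)
qed

section \<open>Algebraic properties of J L\<close>

lemma JL_op_alt: "JL_op \<alpha> \<beta> f = (\<lambda>y. (- \<i> * complex_of_real (\<alpha> * vort \<beta> y)) * L_op \<alpha> f y)"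
  by (simp add: JL_op_def J_op_def vort_eq)

lemma JL_op_L2:
  assumes "\<alpha> > 0" "f \<in> L2"
  shows "JL_op \<alpha> \<beta> f \<in> L2"
  unfolding JL_op_alt
  by (intro L2_mult_continuous L_op_L2 assms continuous_intros vort_continuous)

lemma JL_op_lin:
  assumes "\<alpha> > 0" "f \<in> L2" "g \<in> L2"
  shows "JL_op \<alpha> \<beta> (\<lambda>y. a * f y + b * g y) = (\<lambda>y. a * JL_op \<alpha> \<beta> f y + b * JL_op \<alpha> \<beta> g y)"
  unfolding JL_op_alt L_op_lin[OF assms] by (simp add: algebra_simps)

lemma JL_op_cong:
  assumes "aeq f g"
  shows "aeq (JL_op \<alpha> \<beta> f) (JL_op \<alpha> \<beta> g)"
  using L_op_cong[OF assms, of \<alpha>] unfolding aeq_def JL_op_alt by eventually_elim simp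

text \<open>L is symmetric, and J multiplies by a purely imaginary function, which produces the
  sign.\<close>

lemma JL_op_skew:
  assumes a: "\<alpha> > 0" and f: "f \<in> L2" and g: "g \<in> L2"
  shows "ip (L_op \<alpha> (JL_op \<alpha> \<beta> f)) g = - ip (L_op \<alpha> f) (JL_op \<alpha> \<beta> g)"
proof -
  have "ip (L_op \<alpha> (JL_op \<alpha> \<beta> f)) g = ip (JL_op \<alpha> \<beta> f) (L_op \<alpha> g)"
    by (intro L_op_symmetric JL_op_L2 assms)
  also have "\<dots> = - ip (L_op \<alpha> f) (JL_op \<alpha> \<beta> g)"
    unfolding ip_def JL_op_alt by (subst integral_minus[symmetric]) (simp add: algebra_simps)
  finally show ?thesis .
qed

lemma JL_op_cnj:
  assumes "\<alpha> > 0" "f \<in> L2"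
  shows "JL_op \<alpha> \<beta> (\<lambda>y. cnj (f y)) = (\<lambda>y. - cnj (JL_op \<alpha> \<beta> f y))"
  unfolding JL_op_alt L_op_alt dirichlet_inv_cnj[OF assms] by (simp add: algebra_simps)

lemma form_cnj:
  assumes "\<alpha> > 0" "f \<in> L2"
  shows "ip (L_op \<alpha> (\<lambda>y. cnj (f y))) (\<lambda>y. cnj (f y)) = cnj (ip (L_op \<alpha> f) f)"
proof -
  have "L_op \<alpha> (\<lambda>y. cnj (f y)) = (\<lambda>y. cnj (L_op \<alpha> f y))"
    unfolding L_op_alt dirichlet_inv_cnj[OF assms] by simp
  then have "ip (L_op \<alpha> (\<lambda>y. cnj (f y))) (\<lambda>y. cnj (f y)) = ip (\<lambda>y. cnj (L_op \<alpha> f y)) (\<lambda>y. cnj (f y))"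
    by simp
  also have "\<dots> = (LINT y|\<mu>. cnj (L_op \<alpha> f y * cnj (f y)))" by (simp add: ip_def)
  also have "\<dots> = cnj (ip (L_op \<alpha> f) f)" unfolding ip_def by (rule Bochner_Integration.integral_cnj)
  finally show ?thesis .
qed

section \<open>Generalised eigenspaces and the index\<close>

lemma aeq_lin:
  assumes "aeq f f'" "aeq g g'"
  shows "aeq (\<lambda>y. a * f y + b * g y) (\<lambda>y. a * f' y + b * g' y)"
  using assms unfolding aeq_def by eventually_elim simp

lemma aeq_scale_0:
  assumes "aeq (\<lambda>y. a * f y) (\<lambda>_. 0)" "a \<noteq> 0"
  shows "aeq f (\<lambda>_. 0)"
  using assms(1) unfolding aeq_def by eventually_elim (use assms(2) in simp)

definition form :: "real \<Rightarrow> (real \<Rightarrow> complex) \<Rightarrow> (real \<Rightarrow> complex) \<Rightarrow> complex" where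
  "form \<alpha> f g = ip (L_op \<alpha> f) g"

definition shifted :: "real \<Rightarrow> real \<Rightarrow> complex \<Rightarrow> (real \<Rightarrow> complex) \<Rightarrow> real \<Rightarrow> complex" where
  "shifted \<alpha> \<beta> z = (\<lambda>h y. JL_op \<alpha> \<beta> h y - z * h y)"

lemma gen_eigenspace_alt:
  "gen_eigenspace \<alpha> \<beta> z = {f \<in> L2. \<exists>k. aeq ((shifted \<alpha> \<beta> z ^^ k) f) (\<lambda>_. 0)}"
  by (simp add: gen_eigenspace_def shifted_def)

context
  fixes \<alpha> \<beta> :: real
  assumes \<alpha>: "\<alpha> > 0"
begin

abbreviation "\<E> \<equiv> gen_eigenspace \<alpha> \<beta>"
abbreviation "\<S> \<equiv> shifted \<alpha> \<beta>"

lemma form_lin: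
  assumes "f \<in> L2" "g \<in> L2" "h \<in> L2"
  shows "form \<alpha> (\<lambda>y. a * f y + b * g y) h = a * form \<alpha> f h + b * form \<alpha> g h"
  unfolding form_def L_op_lin[OF \<alpha> assms(1,2)] by (intro ip_lin L_op_L2 \<alpha> assms)

lemma form_herm:
  assumes "f \<in> L2" "g \<in> L2"
  shows "form \<alpha> g f = cnj (form \<alpha> f g)"
  unfolding form_def L_op_symmetric[OF \<alpha> assms(2,1)] by (rule ip_herm)

lemma form_cong_0:
  assumes "aeq f (\<lambda>_. 0)" "f \<in> L2" "g \<in> L2"
  shows "form \<alpha> f g = 0"
proof -
  have "form \<alpha> f g = form \<alpha> (\<lambda>_. 0) g"
    unfolding form_def by (intro ip_aeq_left L_op_cong L_op_L2 assms \<alpha> L2_const)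
  then show ?thesis using form_lin[OF assms(2) assms(2) assms(3), of 0 0] by simp
qed

lemma form_comb:
  assumes f: "f \<in> L2" and g: "g \<in> L2"
  shows "Re (form \<alpha> (\<lambda>y. a * f y + b * g y) (\<lambda>y. a * f y + b * g y))
    = (cmod a)\<^sup>2 * Re (form \<alpha> f f) + (cmod b)\<^sup>2 * Re (form \<alpha> g g) + 2 * Re (a * cnj b * form \<alpha> f g)"
proof -
  define h where "h = (\<lambda>y. a * f y + b * g y)"
  have h: "h \<in> L2" unfolding h_def by (intro L2_lin f g)
  have hf: "form \<alpha> k h = cnj (a * form \<alpha> f k + b * form \<alpha> g k)" if "k \<in> L2" for k
    using form_herm[OF h that] form_lin[OF f g that] by (simp add: h_def)
  have "form \<alpha> h h = a * form \<alpha> f h + b * form \<alpha> g h"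
    using form_lin[OF f g h] by (simp add: h_def)
  also have "\<dots> = a * cnj (a * form \<alpha> f f + b * form \<alpha> g f) + b * cnj (a * form \<alpha> f g + b * form \<alpha> g g)"
    by (simp add: hf f g)
  also have "form \<alpha> g f = cnj (form \<alpha> f g)" by (rule form_herm[OF f g])
  finally show ?thesis
    unfolding h_def[symmetric] cmod_power2
    by (simp add: power2_eq_square algebra_simps)
qed

section \<open>Orthogonality and independence of generalised eigenspaces\<close>

lemma shifted_alt: "\<S> z f = (\<lambda>y. 1 * JL_op \<alpha> \<beta> f y + (- z) * f y)"
  by (simp add: shifted_def)

lemma shifted_L2: "f \<in> L2 \<Longrightarrow> \<S> z f \<in> L2"
  unfolding shifted_alt by (intro L2_lin JL_op_L2 \<alpha>)

lemma shifted_pow_L2: "f \<in> L2 \<Longrightarrow> (\<S> z ^^ k) f \<in> L2"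
  by (induction k) (auto intro: shifted_L2)

lemma shifted_null:
  assumes "aeq f (\<lambda>_. 0)"
  shows "aeq (\<S> z f) (\<lambda>_. 0)"
proof -
  have "JL_op \<alpha> \<beta> (\<lambda>_. 0) = (\<lambda>_. 0)"
    using JL_op_lin[OF \<alpha> L2_const L2_const, of \<beta> 0 _ 0] by simp
  then have "aeq (JL_op \<alpha> \<beta> f) (\<lambda>_. 0)" using JL_op_cong[OF assms, of \<alpha> \<beta>] by simp
  from aeq_lin[OF this assms, of 1 "-z"] show ?thesis unfolding shifted_alt by simp
qed

lemma shifted_commute:
  assumes "f \<in> L2"
  shows "\<S> z (\<S> w f) = \<S> w (\<S> z f)"
  unfolding shifted_alt JL_op_lin[OF \<alpha> JL_op_L2[OF \<alpha> assms] assms] by (simp add: algebra_simps)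

lemma shifted_pow_commute:
  assumes "f \<in> L2"
  shows "(\<S> w ^^ l) (\<S> z f) = \<S> z ((\<S> w ^^ l) f)"
  by (induction l) (auto simp: shifted_commute shifted_pow_L2 assms)

text \<open>Let f' and g' be the images of f and g under J L - z and J L - w. They need one power
  less to vanish, so \<open>form \<alpha> f' g\<close> and \<open>form \<alpha> f g'\<close> are 0
  by induction on k + l. By skewness their sum is -(z + cnj w) times
  \<open>form \<alpha> f g\<close>.\<close>

lemma generalised_eigenvectors_orthogonal:
  assumes "z + cnj w \<noteq> 0" "f \<in> L2" "g \<in> L2"
    "aeq ((\<S> z ^^ k) f) (\<lambda>_. 0)" "aeq ((\<S> w ^^ l) g) (\<lambda>_. 0)"
  shows "form \<alpha> f g = 0"
  using assms(2-)
proof (induction "k + l" arbitrary: k l f g)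
  case 0
  then show ?case by (simp add: form_cong_0)
next
  case (Suc n)
  show ?case
  proof (cases "k = 0 \<or> l = 0")
    case True
    then show ?thesis
      using Suc.prems form_cong_0[of f g] form_cong_0[of g f] form_herm[of f g] by auto
  next
    case False
    then obtain k' l' where kl: "k = Suc k'" "l = Suc l'" by (meson not0_implies_Suc)
    define f' where "f' = \<S> z f"
    define g' where "g' = \<S> w g"
    have L: "f' \<in> L2" "g' \<in> L2" unfolding f'_def g'_def by (intro shifted_L2 Suc.prems)+
    have n: "aeq ((\<S> z ^^ k') f') (\<lambda>_. 0)" "aeq ((\<S> w ^^ l') g') (\<lambda>_. 0)"
      using Suc.prems(3,4) unfolding kl f'_def g'_def by (simp_all add: funpow_swap1)
    have 1: "form \<alpha> f' g = 0"
      using Suc.hyps(2) kl by (intro Suc.hyps(1)[of k' l]) (use n L Suc.prems in auto)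
    have 2: "form \<alpha> f g' = 0"
      using Suc.hyps(2) kl by (intro Suc.hyps(1)[of k l']) (use n L Suc.prems in auto)
    note fg = Suc.prems(1,2)
    have T: "JL_op \<alpha> \<beta> f \<in> L2" "JL_op \<alpha> \<beta> g \<in> L2" by (intro JL_op_L2 \<alpha> fg)+
    have 3: "form \<alpha> f' g = form \<alpha> (JL_op \<alpha> \<beta> f) g - z * form \<alpha> f g"
      unfolding f'_def shifted_alt using form_lin[OF T(1) fg(1) fg(2), of 1 "-z"] by simp
    have "form \<alpha> g' f = form \<alpha> (JL_op \<alpha> \<beta> g) f - w * form \<alpha> g f"
      unfolding g'_def shifted_alt using form_lin[OF T(2) fg(2) fg(1), of 1 "-w"] by simp
    then have 4: "form \<alpha> f g' = form \<alpha> f (JL_op \<alpha> \<beta> g) - cnj w * form \<alpha> f g"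
      using form_herm[OF L(2) fg(1)] form_herm[OF T(2) fg(1)] form_herm[OF fg(2,1)] by simp
    have "form \<alpha> (JL_op \<alpha> \<beta> f) g = - form \<alpha> f (JL_op \<alpha> \<beta> g)"
      unfolding form_def by (rule JL_op_skew[OF \<alpha> fg])
    then have "z * form \<alpha> f g = - (cnj w * form \<alpha> f g)" using 1 2 3 4 by simp
    then have "(z + cnj w) * form \<alpha> f g = 0" by (simp add: distrib_right)
    then show ?thesis using assms(1) by simp
  qed
qed

lemma gen_eigenspace_orthogonal:
  assumes "z + cnj w \<noteq> 0" "f \<in> \<E> z" "g \<in> \<E> w"
  shows "form \<alpha> f g = 0"
  using assms generalised_eigenvectors_orthogonal[OF assms(1)] unfolding gen_eigenspace_alt by blast

text \<open>By induction on k + l both (J L - z) f and (J L - w) f are null, since the two operators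
  commute. Their difference is (w - z) f.\<close>

lemma generalised_eigenvectors_disjoint:
  assumes "z \<noteq> w" "f \<in> L2"
    "aeq ((\<S> z ^^ k) f) (\<lambda>_. 0)" "aeq ((\<S> w ^^ l) f) (\<lambda>_. 0)"
  shows "aeq f (\<lambda>_. 0)"
  using assms(2-)
proof (induction "k + l" arbitrary: k l f)
  case 0
  then show ?case by simp
next
  case (Suc n)
  show ?case
  proof (cases "k = 0 \<or> l = 0")
    case True
    then show ?thesis using Suc.prems by auto
  next
    case False
    then obtain k' l' where kl: "k = Suc k'" "l = Suc l'" by (meson not0_implies_Suc)
    note f = Suc.prems(1)
    have "aeq (\<S> z f) (\<lambda>_. 0)"
    proof (rule Suc.hyps(1)[of k' l])
      show "aeq ((\<S> z ^^ k') (\<S> z f)) (\<lambda>_. 0)"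
        using Suc.prems(2) unfolding kl by (simp add: funpow_swap1)
      show "aeq ((\<S> w ^^ l) (\<S> z f)) (\<lambda>_. 0)"
        unfolding shifted_pow_commute[OF f] by (rule shifted_null[OF Suc.prems(3)])
    qed (use Suc.hyps(2) kl shifted_L2[OF f] in auto)
    moreover have "aeq (\<S> w f) (\<lambda>_. 0)"
    proof (rule Suc.hyps(1)[of k l'])
      show "aeq ((\<S> w ^^ l') (\<S> w f)) (\<lambda>_. 0)"
        using Suc.prems(3) unfolding kl by (simp add: funpow_swap1)
      show "aeq ((\<S> z ^^ k) (\<S> w f)) (\<lambda>_. 0)"
        unfolding shifted_pow_commute[OF f] by (rule shifted_null[OF Suc.prems(2)])
    qed (use Suc.hyps(2) kl shifted_L2[OF f] in auto)
    ultimately have "aeq (\<lambda>y. 1 * \<S> z f y + (-1) * \<S> w f y) (\<lambda>y. 1 * 0 + (-1) * 0)"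
      by (rule aeq_lin)
    then have "aeq (\<lambda>y. (w - z) * f y) (\<lambda>_. 0)" by (simp add: shifted_def algebra_simps)
    then show ?thesis by (rule aeq_scale_0) (use assms(1) in auto)
  qed
qed

text \<open>The relation makes \<open>g\<close> a multiple of \<open>f\<close> almost everywhere; it
  is pushed through the k-th power by linearity.\<close>

lemma gen_eigenspace_scale:
  assumes "f \<in> \<E> z" "g \<in> L2" "aeq (\<lambda>y. a * f y + b * g y) (\<lambda>_. 0)" "b \<noteq> 0"
  shows "g \<in> \<E> z"
proof -
  obtain k where f: "f \<in> L2" and k: "aeq ((\<S> z ^^ k) f) (\<lambda>_. 0)"
    using assms(1) unfolding gen_eigenspace_alt by blast
  have lin: "(\<S> z ^^ k) (\<lambda>y. a * f y + b * g y)
      = (\<lambda>y. a * (\<S> z ^^ k) f y + b * (\<S> z ^^ k) g y)"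
  proof (induction k)
    case (Suc k)
    then show ?case
      using JL_op_lin[OF \<alpha> shifted_pow_L2[OF f] shifted_pow_L2[OF assms(2)]]
      by (simp add: shifted_def algebra_simps)
  qed simp
  have "aeq ((\<S> z ^^ k) (\<lambda>y. a * f y + b * g y)) (\<lambda>_. 0)"
    by (induction k) (auto intro: assms(3) shifted_null)
  then have "aeq (\<lambda>y. 1 * (a * (\<S> z ^^ k) f y + b * (\<S> z ^^ k) g y)
      + (- a) * (\<S> z ^^ k) f y) (\<lambda>y. 1 * 0 + (-a) * 0)"
    unfolding lin using k by (intro aeq_lin)
  then have "aeq (\<lambda>y. b * (\<S> z ^^ k) g y) (\<lambda>_. 0)" by simp
  then have "aeq ((\<S> z ^^ k) g) (\<lambda>_. 0)" using assms(4) by (rule aeq_scale_0)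
  then show ?thesis using assms(2) unfolding gen_eigenspace_alt by blast
qed

text \<open>Two functions and one linear condition: some non-trivial combination has a stream
  function vanishing at 0. There the form is definite, so non-positivity makes the combination null.
  All upper bounds on the index reduce to this.\<close>

lemma nonpositive_plane_degenerate:
  assumes f: "f \<in> L2" and g: "g \<in> L2"
    and np: "\<And>a b. Re (form \<alpha> (\<lambda>y. a * f y + b * g y) (\<lambda>y. a * f y + b * g y)) \<le> 0"
  obtains a b where "a \<noteq> 0 \<or> b \<noteq> 0" "aeq (\<lambda>y. a * f y + b * g y) (\<lambda>_. 0)"
proof -
  obtain a b where ab: "a \<noteq> 0 \<or> b \<noteq> 0" "a * dirichlet_inv \<alpha> f 0 + b * dirichlet_inv \<alpha> g 0 = 0"
  proof (cases "dirichlet_inv \<alpha> f 0 = 0")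
    case True
    then show ?thesis using that[of 1 0] by simp
  next
    case False
    then show ?thesis using that[of "dirichlet_inv \<alpha> g 0" "- dirichlet_inv \<alpha> f 0"] by simp
  qed
  have "aeq (\<lambda>y. a * f y + b * g y) (\<lambda>_. 0)"
    using np[of a b] ab(2) dirichlet_inv_lin[OF \<alpha> f g, of a b]
    by (intro L_op_pos_on_node_subspace[OF \<alpha>] L2_lin f g) (auto simp: form_def)
  then show ?thesis using that ab(1) by blast
qed

section \<open>Contribution of one eigenvalue to the index\<close>

lemma sum_two:
  assumes "n \<ge> 2"
  shows "(\<Sum>j<n. (if j = 0 then a else if j = 1 then b else 0) * h j) = a * h 0 + b * (h (1::nat) :: complex)"
proof -
  have "(\<Sum>j<n. (if j = 0 then a else if j = 1 then b else 0) * h j)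
      = (\<Sum>j\<in>{0,1}. (if j = 0 then a else if j = 1 then b else 0) * h j)"
    using assms by (intro sum.mono_neutral_right) auto
  then show ?thesis by simp
qed

lemma lin_indep_two:
  assumes "lin_indep_L2 fs n" "n \<ge> 2" "aeq (\<lambda>y. a * fs 0 y + b * fs 1 y) (\<lambda>_. 0)"
  shows "a = 0 \<and> b = 0"
proof -
  define c where "c = (\<lambda>j::nat. if j = 0 then a else if j = 1 then b else 0)"
  have "aeq (\<lambda>y. \<Sum>j<n. c j * fs j y) (\<lambda>_. 0)"
    unfolding c_def sum_two[OF assms(2)] by (rule assms(3))
  then have "\<forall>j<n. c j = 0"
    using assms(1) unfolding lin_indep_L2_def by blast
  then have "c 0 = 0" "c 1 = 0" using assms(2) by auto
  then show ?thesis by (simp add: c_def)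
qed

lemma lin_indep_nonzero:
  assumes "lin_indep_L2 fs n" "n > 0"
  shows "\<not> aeq (fs 0) (\<lambda>_. 0)"
proof
  assume 0: "aeq (fs 0) (\<lambda>_. 0)"
  define c where "c = (\<lambda>j::nat. if j = 0 then 1 else 0 :: complex)"
  have "(\<Sum>j<n. c j * fs j y) = fs 0 y" for y
    using assms(2) by (subst sum.mono_neutral_right[of _ "{0}"]) (auto simp: c_def)
  then have "aeq (\<lambda>y. \<Sum>j<n. c j * fs j y) (\<lambda>_. 0)" using 0 by simp
  then have "\<forall>j<n. c j = 0"
    using assms(1) unfolding lin_indep_L2_def by blast
  then have "c 0 = 0" using assms(2) by blast
  then show False by (simp add: c_def)
qed

text \<open>The contribution of an eigenvalue to the left-hand side of the index formula.\<close>
definition index_at :: "complex \<Rightarrow> enat" where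
  "index_at z = (if Re z > 0 then dim_L2 (\<E> z) else nonpos_dim \<alpha> (\<E> z))"

lemma gen_eigenspace_isotropic:
  assumes "Re z > 0" "f \<in> \<E> z" "g \<in> \<E> z"
  shows "form \<alpha> f g = 0"
  using assms by (intro gen_eigenspace_orthogonal[of z z]) (auto simp: complex_eq_iff)

text \<open>Two independent members would span a plane on which the form is non-positive. For Re z >
  0 this holds because the eigenspace is isotropic, z + cnj z being non-zero; otherwise it is part
  of the definition of \<open>nonpos_dim\<close>.\<close>

lemma index_at_le_1: "index_at z \<le> 1"
proof -
  have key: "n \<le> 1" if fs: "\<forall>j<n. fs j \<in> \<E> z" "lin_indep_L2 fs n"
    and np: "\<And>a b. n \<ge> 2 \<Longrightarrow> Re (form \<alpha> (\<lambda>y. a * fs 0 y + b * fs 1 y) (\<lambda>y. a * fs 0 y + b * fs 1 y)) \<le> 0"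
    for n fs
  proof (rule ccontr)
    assume "\<not> n \<le> 1"
    then have n: "n \<ge> 2" by simp
    then have L: "fs 0 \<in> L2" "fs 1 \<in> L2" using fs(1) by (auto simp: gen_eigenspace_def)
    obtain a b where "a \<noteq> 0 \<or> b \<noteq> 0" "aeq (\<lambda>y. a * fs 0 y + b * fs 1 y) (\<lambda>_. 0)"
      using nonpositive_plane_degenerate[OF L np[OF n]] by blast
    then show False using lin_indep_two[OF fs(2) n] by blast
  qed
  show ?thesis
  proof (cases "Re z > 0")
    case True
    have "n \<le> 1" if fs: "\<forall>j<n. fs j \<in> \<E> z" "lin_indep_L2 fs n" for n fs
    proof (rule key[OF fs])
      fix a b assume "n \<ge> 2"
      then have G: "fs 0 \<in> \<E> z" "fs 1 \<in> \<E> z" using fs(1) by auto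
      then have L: "fs 0 \<in> L2" "fs 1 \<in> L2" by (auto simp: gen_eigenspace_def)
      show "Re (form \<alpha> (\<lambda>y. a * fs 0 y + b * fs 1 y) (\<lambda>y. a * fs 0 y + b * fs 1 y)) \<le> 0"
        unfolding form_comb[OF L] using gen_eigenspace_isotropic[OF True] G by simp
    qed
    then show ?thesis
      using True unfolding index_at_def dim_L2_def by (auto intro!: SUP_least simp: one_enat_def)
  next
    case False
    have "n \<le> 1" if fs: "\<forall>j<n. fs j \<in> \<E> z" "lin_indep_L2 fs n"
      and np: "\<forall>c. Re (ip (L_op \<alpha> (\<lambda>y. \<Sum>j<n. c j * fs j y)) (\<lambda>y. \<Sum>j<n. c j * fs j y)) \<le> 0" for n fs
    proof (rule key[OF fs])
      fix a b assume n: "n \<ge> 2"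
      show "Re (form \<alpha> (\<lambda>y. a * fs 0 y + b * fs 1 y) (\<lambda>y. a * fs 0 y + b * fs 1 y)) \<le> 0"
        using np[rule_format, of "\<lambda>j. if j = 0 then a else if j = 1 then b else 0"]
        unfolding form_def sum_two[OF n] .
    qed
    then show ?thesis
      using False unfolding index_at_def nonpos_dim_def by (auto intro!: SUP_least simp: one_enat_def)
  qed
qed

lemma SUP_enat_nonzero:
  assumes "(SUP n\<in>A. enat n) \<noteq> 0"
  obtains n where "n \<in> A" "n \<noteq> 0"
proof (rule ccontr)
  assume "\<not> thesis"
  then have "(SUP n\<in>A. enat n) \<le> 0"
    using that by (intro SUP_least) (auto simp: zero_enat_def)
  then show False using assms by simp
qed

lemma index_at_witness:
  assumes "index_at z \<noteq> 0"
  obtains f where "f \<in> \<E> z" "\<not> aeq f (\<lambda>_. 0)" "Re (form \<alpha> f f) \<le> 0"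
proof (cases "Re z > 0")
  case True
  then have "dim_L2 (\<E> z) \<noteq> 0" using assms by (simp add: index_at_def)
  then obtain n fs where "n \<noteq> 0" and fs: "\<forall>j<n. fs j \<in> \<E> z" "lin_indep_L2 fs n"
    unfolding dim_L2_def by (elim SUP_enat_nonzero) blast
  then show ?thesis
    using that[of "fs 0"] lin_indep_nonzero[OF fs(2)] gen_eigenspace_isotropic[OF True, of "fs 0" "fs 0"]
    by simp
next
  case False
  then have "nonpos_dim \<alpha> (\<E> z) \<noteq> 0" using assms by (simp add: index_at_def)
  then obtain n fs where n: "n \<noteq> 0" and fs: "\<forall>j<n. fs j \<in> \<E> z" "lin_indep_L2 fs n"
    and np: "\<forall>c. Re (ip (L_op \<alpha> (\<lambda>y. \<Sum>j<n. c j * fs j y)) (\<lambda>y. \<Sum>j<n. c j * fs j y)) \<le> 0"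
    unfolding nonpos_dim_def by (elim SUP_enat_nonzero) blast
  have "(\<Sum>j<n. (if j = 0 then 1 else 0) * fs j y) = fs 0 y" for y
    using n by (subst sum.mono_neutral_right[of _ "{0}"]) auto
  then have "Re (form \<alpha> (fs 0) (fs 0)) \<le> 0"
    using np[rule_format, of "\<lambda>j. if j = 0 then 1 else 0"] by (simp add: form_def)
  then show ?thesis using that[of "fs 0"] lin_indep_nonzero[OF fs(2)] n fs(1) by simp
qed

text \<open>In the closed right half-plane z + cnj w = 0 forces both to be imaginary and equal.
  Distinct contributors would thus give orthogonal witnesses f and g spanning a non-positive plane.
  Degeneracy makes g a multiple of f, hence a member of two generalised eigenspaces, hence
  null.\<close>

lemma index_at_unique:
  assumes "Re z \<ge> 0" "Re w \<ge> 0" "index_at z \<noteq> 0" "index_at w \<noteq> 0"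
  shows "z = w"
proof (rule ccontr)
  assume zw: "z \<noteq> w"
  obtain f where f: "f \<in> \<E> z" "\<not> aeq f (\<lambda>_. 0)" "Re (form \<alpha> f f) \<le> 0"
    using index_at_witness[OF assms(3)] by blast
  obtain g where g: "g \<in> \<E> w" "\<not> aeq g (\<lambda>_. 0)" "Re (form \<alpha> g g) \<le> 0"
    using index_at_witness[OF assms(4)] by blast
  have L: "f \<in> L2" "g \<in> L2" using f g by (auto simp: gen_eigenspace_def)
  have "z + cnj w \<noteq> 0" using zw assms(1,2) by (auto simp: complex_eq_iff)
  then have fg: "form \<alpha> f g = 0" using gen_eigenspace_orthogonal f g by blast
  obtain a b where ab: "a \<noteq> 0 \<or> b \<noteq> 0" "aeq (\<lambda>y. a * f y + b * g y) (\<lambda>_. 0)"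
  proof (rule nonpositive_plane_degenerate[OF L])
    fix a b
    show "Re (form \<alpha> (\<lambda>y. a * f y + b * g y) (\<lambda>y. a * f y + b * g y)) \<le> 0"
      unfolding form_comb[OF L] fg using f(3) g(3)
      by (simp add: add_nonpos_nonpos mult_nonneg_nonpos)
  qed
  have "b \<noteq> 0"
  proof
    assume "b = 0"
    then show False using ab f(2) aeq_scale_0[of a f] by simp
  qed
  then have "g \<in> \<E> z" using gen_eigenspace_scale[OF f(1) L(2) ab(2)] by blast
  then have "aeq g (\<lambda>_. 0)"
    using g(1) generalised_eigenvectors_disjoint[OF zw L(2)] unfolding gen_eigenspace_alt by blast
  then show False using g(2) by blast
qed

lemma index_at_eigenvector:
  assumes f: "f \<in> L2" "\<not> aeq f (\<lambda>_. 0)" and ev: "aeq (JL_op \<alpha> \<beta> f) (\<lambda>y. z * f y)" and np: "Re (form \<alpha> f f) \<le> 0"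
  shows "index_at z = 1"
proof -
  have "aeq ((\<S> z ^^ 1) f) (\<lambda>_. 0)"
    using ev unfolding aeq_def shifted_def by simp
  then have G: "f \<in> \<E> z" using f(1) unfolding gen_eigenspace_alt by blast
  have indep: "lin_indep_L2 (\<lambda>_. f) 1"
    unfolding lin_indep_L2_def using f(2) aeq_scale_0[of _ f] by auto
  have "Re (ip (L_op \<alpha> (\<lambda>y. c * f y)) (\<lambda>y. c * f y)) \<le> 0" for c
    using form_comb[OF f(1) f(1), of c 0] np by (simp add: form_def mult_nonneg_nonpos)
  then have "enat 1 \<le> index_at z"
    unfolding index_at_def dim_L2_def nonpos_dim_def using G indep
    by (auto intro!: SUP_upper exI[of _ "\<lambda>_. f"])
  then show ?thesis using index_at_le_1[of z] by (simp add: one_enat_def)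
qed

section \<open>Adding up the contributions\<close>

lemma esum_zero:
  assumes "\<And>z. P z \<Longrightarrow> m z = 0"
  shows "esum P m = 0"
proof -
  have "(\<Sum>z\<in>F. m z) = 0" if "F \<subseteq> {z. P z}" for F
    using that assms by (intro sum.neutral) auto
  then show ?thesis unfolding esum_def
    by (intro antisym SUP_least) auto
qed

lemma esum_single:
  assumes "P z0" "m z0 = 1" "\<And>z. P z \<Longrightarrow> z \<noteq> z0 \<Longrightarrow> m z = 0"
  shows "esum P m = 1"
proof (rule antisym)
  have "(\<Sum>z\<in>F. m z) \<le> 1" if F: "finite F" "F \<subseteq> {z. P z}" for F
  proof -
    have "(\<Sum>z\<in>F. m z) = (\<Sum>z\<in>F. if z = z0 then 1 else 0)"
      using F assms by (intro sum.cong) auto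
    also have "\<dots> \<le> 1" using F(1) by simp
    finally show ?thesis .
  qed
  then show "esum P m \<le> 1" unfolding esum_def by (intro SUP_least) auto
  have "(\<Sum>z\<in>{z0}. m z) \<le> esum P m"
    unfolding esum_def using assms(1) by (intro SUP_upper) auto
  then show "1 \<le> esum P m" using assms(2) by simp
qed

text \<open>The three counts run over disjoint parts of the closed right half-plane without 0, with
  summands given by \<open>index_at\<close>. Only \<open>z\<close> contributes, and it lies in
  exactly one of the parts.\<close>

lemma index_sum_eq_1:
  assumes f: "f \<in> L2" "\<not> aeq f (\<lambda>_. 0)" and ev: "aeq (JL_op \<alpha> \<beta> f) (\<lambda>y. z * f y)"
    and np: "Re (form \<alpha> f f) \<le> 0" and z: "Re z \<ge> 0" "z \<noteq> 0"
  shows "k_c \<alpha> \<beta> + k_r \<alpha> \<beta> + k_i_nonpos \<alpha> \<beta> = 1"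
proof -
  have iz: "index_at z = 1" by (rule index_at_eigenvector[OF f ev np])
  have ez: "is_eigenvalue \<alpha> \<beta> z" using f ev unfolding is_eigenvalue_def by blast
  have other: "index_at w = 0" if "Re w \<ge> 0" "w \<noteq> z" for w
    using index_at_unique[OF that(1) z(1)] iz that(2) by force
  have zero: "esum P m = 0" if "\<And>w. P w \<Longrightarrow> Re w \<ge> 0 \<and> w \<noteq> z \<and> m w = index_at w" for P m
    using that other by (intro esum_zero) metis
  have single: "esum P m = 1" if "P z" "\<And>w. P w \<Longrightarrow> Re w \<ge> 0 \<and> m w = index_at w" for P m
    using that other iz by (intro esum_single[of P z]) metis+
  consider "Re z > 0" "Im z \<noteq> 0" | "Re z > 0" "Im z = 0" | "Re z = 0" "Im z \<noteq> 0"
  proof -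
    have "Re z > 0 \<or> Re z = 0 \<and> Im z \<noteq> 0" using z by (auto simp: complex_eq_iff)
    then show ?thesis using that by blast
  qed
  then show ?thesis
  proof cases
    case 1
    have "k_c \<alpha> \<beta> = 1" unfolding k_c_def by (rule single) (use 1 ez in \<open>auto simp: index_at_def\<close>)
    moreover have "k_r \<alpha> \<beta> = 0" unfolding k_r_def by (rule zero) (use 1 in \<open>auto simp: index_at_def\<close>)
    moreover have "k_i_nonpos \<alpha> \<beta> = 0" unfolding k_i_nonpos_def by (rule zero) (use 1 in \<open>auto simp: index_at_def\<close>)
    ultimately show ?thesis by simp
  next
    case 2
    have "k_r \<alpha> \<beta> = 1" unfolding k_r_def by (rule single) (use 2 ez in \<open>auto simp: index_at_def\<close>)
    moreover have "k_c \<alpha> \<beta> = 0" unfolding k_c_def by (rule zero) (use 2 in \<open>auto simp: index_at_def\<close>)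
    moreover have "k_i_nonpos \<alpha> \<beta> = 0" unfolding k_i_nonpos_def by (rule zero) (use 2 in \<open>auto simp: index_at_def\<close>)
    ultimately show ?thesis by simp
  next
    case 3
    have "k_i_nonpos \<alpha> \<beta> = 1" unfolding k_i_nonpos_def by (rule single) (use 3 ez in \<open>auto simp: index_at_def\<close>)
    moreover have "k_c \<alpha> \<beta> = 0" unfolding k_c_def by (rule zero) (use 3 in \<open>auto simp: index_at_def\<close>)
    moreover have "k_r \<alpha> \<beta> = 0" unfolding k_r_def by (rule zero) (use 3 in \<open>auto simp: index_at_def\<close>)
    ultimately show ?thesis by simp
  qed
qed

end

section \<open>Sampling on a grid\<close>

text \<open>Number of the half-open cell of length 2/n that contains t. At t = 1 the value is n, one
  beyond the last cell, so this point is treated separately later.\<close>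

definition grid_index :: "nat \<Rightarrow> real \<Rightarrow> nat" where
  "grid_index n t = nat \<lfloor>(t + 1) * real n / 2\<rfloor>"

definition grid_point :: "nat \<Rightarrow> nat \<Rightarrow> real" where
  "grid_point n j = - 1 + 2 * real j / real n"

definition sample :: "nat \<Rightarrow> real \<Rightarrow> real" where
  "sample n t = grid_point n (grid_index n t)"

lemma grid_index_eq:
  assumes "n > 0" "grid_point n j \<le> t" "t < grid_point n (Suc j)"
  shows "grid_index n t = j"
proof -
  have "real j \<le> (t + 1) * real n / 2" "(t + 1) * real n / 2 < real j + 1"
    using assms by (auto simp: grid_point_def field_simps)
  then have "\<lfloor>(t + 1) * real n / 2\<rfloor> = int j" by (intro floor_unique) auto
  then show ?thesis by (simp add: grid_index_def)
qed

lemma sample_near: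
  assumes n: "n > 0" and t: "t \<in> I11"
  shows "sample n t \<le> t" "t - sample n t \<le> 2 / real n" "sample n t \<in> I11"
proof -
  define r where "r = (t + 1) * real n / 2"
  have r: "r \<ge> 0" using t n by (auto simp: r_def I11_def)
  have k: "real (grid_index n t) = of_int \<lfloor>r\<rfloor>"
    using r by (simp add: grid_index_def r_def)
  have t_eq: "t = - 1 + 2 * r / real n" using n by (simp add: r_def)
  have s_eq: "sample n t = - 1 + 2 * of_int \<lfloor>r\<rfloor> / real n"
    by (simp add: sample_def grid_point_def k)
  have fl: "of_int \<lfloor>r\<rfloor> \<le> r" "r - 1 \<le> of_int \<lfloor>r\<rfloor>" by linarith+
  show 1: "sample n t \<le> t" unfolding s_eq using n fl by (subst t_eq) (simp add: divide_right_mono)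
  have "t - sample n t = 2 * (r - of_int \<lfloor>r\<rfloor>) / real n"
    unfolding s_eq by (subst t_eq) (simp add: diff_divide_distrib right_diff_distrib)
  also have "\<dots> \<le> 2 / real n"
  proof (rule divide_right_mono)
    have "2 * (r - x) \<le> 2" if "r - 1 \<le> x" for x :: real using that by (simp add: algebra_simps)
    then show "2 * (r - of_int \<lfloor>r\<rfloor>) \<le> 2" using fl(2) by blast
  qed simp
  finally show "t - sample n t \<le> 2 / real n" .
  have "sample n t \<ge> - 1" by (simp add: sample_def grid_point_def)
  then show "sample n t \<in> I11" using 1 t by (auto simp: I11_def)
qed

lemma grid_index_less:
  assumes "n > 0" "t \<in> I11" "t \<noteq> 1"
  shows "grid_index n t < n"
proof -
  have "(t + 1) * real n / 2 < real n" using assms by (auto simp: I11_def field_simps)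
  then have "\<lfloor>(t + 1) * real n / 2\<rfloor> < int n" by (simp add: floor_less_iff)
  then show ?thesis unfolding grid_index_def using assms(1) by linarith
qed

lemma grid_measurable: "(\<lambda>t. F (grid_index n t) :: 'a::euclidean_space) \<in> borel_measurable \<mu>"
proof -
  have "(\<lambda>t. (t + 1) * real n / 2) \<in> borel_measurable \<mu>"
    by (intro continuous_measurable_I11 continuous_intros) auto
  then have "(\<lambda>t. \<lfloor>(t + 1) * real n / 2\<rfloor>) \<in> measurable \<mu> (count_space UNIV)"
    by (rule measurable_compose[OF _ measurable_real_floor])
  then show ?thesis
    unfolding grid_index_def by (rule measurable_compose) simp
qed

text \<open>Functions of \<open>grid_index\<close> are step functions, so a vector of length n
  becomes an L2 function whose integrals are exact finite sums with cell length 2/n.\<close>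

lemma grid_integral:
  fixes F :: "nat \<Rightarrow> 'a::euclidean_space"
  assumes n: "n > 0"
  shows "integrable \<mu> (\<lambda>t. F (grid_index n t))"
    "(LINT t|\<mu>. F (grid_index n t)) = (2 / real n) *\<^sub>R (\<Sum>j<n. F j)"
proof -
  have le: "grid_index n t \<le> n" if "t \<in> I11" for t
    using grid_index_less[OF n that] n by (cases "t = 1") (auto simp: grid_index_def)
  show int: "integrable \<mu> (\<lambda>t. F (grid_index n t))"
  proof (rule integrable_I11_bound)
    show "(\<lambda>t. F (grid_index n t)) \<in> borel_measurable \<mu>" by (rule grid_measurable)
    show "integrable \<mu> (\<lambda>_. \<Sum>j\<le>n. norm (F j))" by (rule integrable_I11_const)
    show "norm (F (grid_index n t)) \<le> (\<Sum>j\<le>n. norm (F j))" if "t \<in> I11" for t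
      by (rule member_le_sum[of "grid_index n t" "{..n}" "\<lambda>j. norm (F j)"]) (simp_all add: le[OF that])
  qed
  have "((\<lambda>t. F (grid_index n t)) has_integral ((2 / real n) *\<^sub>R (\<Sum>j<m. F j))) {-1..grid_point n m}"
    if "m \<le> n" for m
    using that
  proof (induction m)
    case 0
    then show ?case by (simp add: grid_point_def has_integral_refl)
  next
    case (Suc m)
    have len: "grid_point n (Suc m) - grid_point n m = 2 / real n" 
      by (simp add: grid_point_def add_divide_distrib)
    have le: "grid_point n m \<le> grid_point n (Suc m)" using len n by (smt (verit) divide_nonneg_nonneg of_nat_0_le_iff)
    have "((\<lambda>t. F m) has_integral ((2 / real n) *\<^sub>R F m)) {grid_point n m..grid_point n (Suc m)}"
      using has_integral_const_real[of "F m" "grid_point n m" "grid_point n (Suc m)"] le len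
      by simp
    \<comment> \<open>At the right end of the cell \<open>grid_index\<close> has already jumped to
      the next value; the integral ignores that point.\<close>
    then have "((\<lambda>t. F (grid_index n t)) has_integral ((2 / real n) *\<^sub>R F m)) {grid_point n m..grid_point n (Suc m)}"
      by (rule has_integral_spike_finite[of "{grid_point n (Suc m)}", rotated 2])
        (auto simp: grid_index_eq[OF n])
    from has_integral_combine[OF _ le Suc.IH this] show ?case
      using Suc.prems by (simp add: grid_point_def scaleR_add_right)
  qed
  from this[of n] have "((\<lambda>t. F (grid_index n t)) has_integral ((2 / real n) *\<^sub>R (\<Sum>j<n. F j))) I11"
    using n by (simp add: grid_point_def I11_def)
  then show "(LINT t|\<mu>. F (grid_index n t)) = (2 / real n) *\<^sub>R (\<Sum>j<n. F j)"
    using lebesgue_integral_eq_integral[OF int] by (simp add: integral_unique)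
qed

section \<open>Uniform estimates for the Green operator and its sampled version\<close>

lemma bounded_mult_integrable:
  fixes p f :: "real \<Rightarrow> complex"
  assumes p: "p \<in> borel_measurable \<mu>" "\<And>t. t \<in> I11 \<Longrightarrow> cmod (p t) \<le> c"
    and f: "integrable \<mu> f"
  shows "integrable \<mu> (\<lambda>t. p t * f t)"
    "cmod (LINT t|\<mu>. p t * f t) \<le> c * (LINT t|\<mu>. cmod (f t))"
proof -
  have f': "integrable \<mu> (\<lambda>t. c * cmod (f t))" using f by simp
  have le: "cmod (p t * f t) \<le> c * cmod (f t)" if "t \<in> I11" for t
    using p(2)[OF that] by (simp add: norm_mult mult_right_mono)
  show int: "integrable \<mu> (\<lambda>t. p t * f t)"
    by (rule integrable_I11_bound[OF _ f' le]) (use p f in auto)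
  have "cmod (LINT t|\<mu>. p t * f t) \<le> (LINT t|\<mu>. cmod (p t * f t))"
    by simp
  also have "\<dots> \<le> (LINT t|\<mu>. c * cmod (f t))"
    using int f' le by (intro integral_mono) auto
  finally show "cmod (LINT t|\<mu>. p t * f t) \<le> c * (LINT t|\<mu>. cmod (f t))"
    by simp
qed

lemma green_bound:
  obtains C where "C > 0" "\<And>y t. y \<in> I11 \<Longrightarrow> t \<in> I11 \<Longrightarrow> \<bar>green \<alpha> y t\<bar> \<le> C"
proof -
  have "compact ((\<lambda>p. green \<alpha> (fst p) (snd p)) ` (I11 \<times> I11))"
    by (intro compact_continuous_image continuous_on_subset[OF green_continuous] compact_Times)
      (auto simp: I11_def)
  then obtain C where C: "\<forall>z\<in>(\<lambda>p. green \<alpha> (fst p) (snd p)) ` (I11 \<times> I11). norm z \<le> C"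
    using compact_imp_bounded bounded_iff by blast
  have "\<bar>green \<alpha> y t\<bar> \<le> max C 1" if "y \<in> I11" "t \<in> I11" for y t
  proof -
    have "green \<alpha> y t \<in> (\<lambda>p. green \<alpha> (fst p) (snd p)) ` (I11 \<times> I11)"
      using that by (intro image_eqI[of _ _ "(y, t)"]) auto
    then show ?thesis using C by fastforce
  qed
  then show ?thesis using that[of "max C 1"] by simp
qed

lemma green_uniform:
  assumes "e > 0"
  obtains d where "d > 0" "\<And>y y' t t'. y \<in> I11 \<Longrightarrow> y' \<in> I11 \<Longrightarrow> t \<in> I11 \<Longrightarrow> t' \<in> I11 \<Longrightarrow>
    \<bar>y - y'\<bar> < d \<Longrightarrow> \<bar>t - t'\<bar> < d \<Longrightarrow> \<bar>green \<alpha> y t - green \<alpha> y' t'\<bar> < e"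
proof -
  have "uniformly_continuous_on (I11 \<times> I11) (\<lambda>p. green \<alpha> (fst p) (snd p))"
    by (intro compact_uniformly_continuous continuous_on_subset[OF green_continuous] compact_Times)
      (auto simp: I11_def)
  then obtain d where d: "d > 0" "\<And>p q. p \<in> I11 \<times> I11 \<Longrightarrow> q \<in> I11 \<times> I11 \<Longrightarrow> dist q p < d \<Longrightarrow>
      dist (green \<alpha> (fst q) (snd q)) (green \<alpha> (fst p) (snd p)) < e"
    using assms unfolding uniformly_continuous_on_def by meson
  show ?thesis
  proof (rule that[of "d / 2"])
    fix y y' t t' assume *: "y \<in> I11" "y' \<in> I11" "t \<in> I11" "t' \<in> I11" "\<bar>y - y'\<bar> < d / 2" "\<bar>t - t'\<bar> < d / 2"
    have "dist (y, t) (y', t') \<le> \<bar>y - y'\<bar> + \<bar>t - t'\<bar>"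
      by (simp add: dist_Pair_Pair dist_real_def sqrt_sum_squares_le_sum_abs)
    also have "\<dots> < d" using * by simp
    finally show "\<bar>green \<alpha> y t - green \<alpha> y' t'\<bar> < e"
      using d(2)[of "(y', t')" "(y, t)"] * by (auto simp: dist_real_def)
  qed (use d in simp)
qed

definition green_int :: "real \<Rightarrow> (real \<Rightarrow> complex) \<Rightarrow> real \<Rightarrow> complex" where
  "green_int \<alpha> f y = (LINT t|\<mu>. complex_of_real (green \<alpha> y t) * f t)"

text \<open>The kernel is sampled in t alone. As y stays continuous, matrix-vector products become
  continuous functions on the interval (Nystrom interpolation), to which Arzela-Ascoli
  applies.\<close>

definition green_sampled :: "real \<Rightarrow> nat \<Rightarrow> (real \<Rightarrow> complex) \<Rightarrow> real \<Rightarrow> complex" where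
  "green_sampled \<alpha> n f y = (LINT t|\<mu>. complex_of_real (green \<alpha> y (sample n t)) * f t)"

lemma green_int_eq_dirichlet_inv:
  assumes "\<alpha> > 0" "f \<in> L2" "y \<in> I11"
  shows "green_int \<alpha> f y = dirichlet_inv \<alpha> f y"
  using assms by (simp add: green_int_def dirichlet_inv_green)

lemma green_measurable: "(\<lambda>t. complex_of_real (green \<alpha> y t)) \<in> borel_measurable \<mu>"
proof (rule continuous_measurable_I11)
  show "continuous_on I11 (\<lambda>t. complex_of_real (green \<alpha> y t))"
    using continuous_on_compose2[OF green_continuous, of I11 "\<lambda>t. (y, t)" \<alpha>]
    by (force intro!: continuous_intros)
qed

lemma green_sample_measurable:
  "(\<lambda>t. complex_of_real (green \<alpha> y (sample n t))) \<in> borel_measurable \<mu>"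
  unfolding sample_def by (rule grid_measurable)

text \<open>Only the L1 norm of \<open>f\<close> enters the bounds, so an L1-bounded family has
  uniformly bounded and equicontinuous images.\<close>

lemma green_sampled_lipschitz:
  assumes f: "integrable \<mu> f" and n: "n > 0" and e: "\<And>t. t \<in> I11 \<Longrightarrow> \<bar>green \<alpha> y t - green \<alpha> y' t\<bar> \<le> e"
    and C: "\<And>y t. y \<in> I11 \<Longrightarrow> t \<in> I11 \<Longrightarrow> \<bar>green \<alpha> y t\<bar> \<le> C" and y: "y \<in> I11" "y' \<in> I11"
  shows "cmod (green_sampled \<alpha> n f y - green_sampled \<alpha> n f y') \<le> e * (LINT t|\<mu>. cmod (f t))"
    "cmod (green_sampled \<alpha> n f y) \<le> C * (LINT t|\<mu>. cmod (f t))"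
    "cmod (green_int \<alpha> f y - green_int \<alpha> f y') \<le> e * (LINT t|\<mu>. cmod (f t))"
    "cmod (green_int \<alpha> f y) \<le> C * (LINT t|\<mu>. cmod (f t))"
proof -
  have i: "integrable \<mu> (\<lambda>t. complex_of_real (green \<alpha> y (sample n t)) * f t)" if "y \<in> I11" for y
    using C sample_near(3)[OF n] that
    by (intro bounded_mult_integrable[OF green_sample_measurable _ f, of _ _ _ C]) auto
  have i': "integrable \<mu> (\<lambda>t. complex_of_real (green \<alpha> y t) * f t)" if "y \<in> I11" for y
    using C that by (intro bounded_mult_integrable[OF green_measurable _ f, of _ _ C]) auto
  have 1: "green_sampled \<alpha> n f y - green_sampled \<alpha> n f y'
      = (LINT t|\<mu>. (complex_of_real (green \<alpha> y (sample n t)) - complex_of_real (green \<alpha> y' (sample n t))) * f t)"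
    unfolding green_sampled_def using i[OF y(1)] i[OF y(2)]
    by (simp add: left_diff_distrib)
  show "cmod (green_sampled \<alpha> n f y - green_sampled \<alpha> n f y') \<le> e * (LINT t|\<mu>. cmod (f t))"
    unfolding 1 using e sample_near(3)[OF n]
    by (intro bounded_mult_integrable(2)[OF borel_measurable_diff[OF green_sample_measurable green_sample_measurable] _ f])
      (simp flip: of_real_diff)
  have 2: "green_int \<alpha> f y - green_int \<alpha> f y'
      = (LINT t|\<mu>. (complex_of_real (green \<alpha> y t) - complex_of_real (green \<alpha> y' t)) * f t)"
    unfolding green_int_def using i'[OF y(1)] i'[OF y(2)]
    by (simp add: left_diff_distrib)
  show "cmod (green_int \<alpha> f y - green_int \<alpha> f y') \<le> e * (LINT t|\<mu>. cmod (f t))"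
    unfolding 2 using e
    by (intro bounded_mult_integrable(2)[OF borel_measurable_diff[OF green_measurable green_measurable] _ f])
      (simp flip: of_real_diff)
  show "cmod (green_sampled \<alpha> n f y) \<le> C * (LINT t|\<mu>. cmod (f t))"
    unfolding green_sampled_def using C[OF y(1)] sample_near(3)[OF n]
    by (intro bounded_mult_integrable(2)[OF green_sample_measurable _ f]) simp
  show "cmod (green_int \<alpha> f y) \<le> C * (LINT t|\<mu>. cmod (f t))"
    unfolding green_int_def using C[OF y(1)]
    by (intro bounded_mult_integrable(2)[OF green_measurable _ f]) simp
qed

lemma sample_uniform:
  assumes N: "filterlim N at_top sequentially" and "d > 0"
  shows "\<forall>\<^sub>F n in sequentially. N n > 0 \<and> (\<forall>t\<in>I11. \<bar>sample (N n) t - t\<bar> < d)"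
proof -
  obtain k :: nat where k: "2 / d < real k" using reals_Archimedean2 by blast
  have "\<forall>\<^sub>F n in sequentially. N n \<ge> max k 1" using N unfolding filterlim_at_top by blast
  then show ?thesis
  proof eventually_elim
    case (elim n)
    then have Nn: "N n > 0" "2 / d < real (N n)" using k by auto
    then have "2 / real (N n) < d" using assms(2) by (simp add: field_simps)
    then show ?case using sample_near(1,2)[OF Nn(1)] Nn(1) by fastforce
  qed
qed

text \<open>The error splits into the sampling error of the kernel against \<open>f n\<close> and
  the exact kernel against \<open>f n - g\<close>. Uniform continuity of the kernel handles the
  first and L1 convergence the second, both uniformly in y.\<close>

lemma green_sampled_uniform_limit:
  assumes N: "filterlim N at_top sequentially"
    and f: "\<And>n. integrable \<mu> (f n)" "integrable \<mu> g"
    and conv: "(\<lambda>n. LINT t|\<mu>. cmod (f n t - g t)) \<longlonglongrightarrow> 0" and e: "e > 0"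
  shows "\<forall>\<^sub>F n in sequentially. \<forall>y\<in>I11. cmod (green_sampled \<alpha> (N n) (f n) y - green_int \<alpha> g y) \<le> e"
    "\<forall>\<^sub>F n in sequentially. (LINT t|\<mu>. cmod (f n t)) \<le> 1 + (LINT t|\<mu>. cmod (g t))"
proof -
  let ?M = "\<mu>"
  define B where "B = (LINT t|?M. cmod (g t))"
  have B: "B \<ge> 0" by (simp add: B_def)
  obtain C where C: "C > 0" "\<And>y t. y \<in> I11 \<Longrightarrow> t \<in> I11 \<Longrightarrow> \<bar>green \<alpha> y t\<bar> \<le> C"
    using green_bound by blast
  have fn: "(LINT t|?M. cmod (f n t)) \<le> (LINT t|?M. cmod (f n t - g t)) + B" for n
  proof -
    have "(LINT t|?M. cmod (f n t)) \<le> (LINT t|?M. cmod (f n t - g t) + cmod (g t))"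
    proof (rule integral_mono)
      show "cmod (f n t) \<le> cmod (f n t - g t) + cmod (g t)" for t
        using norm_triangle_sub[of "f n t" "g t"] by simp
    qed (use f in auto)
    then show ?thesis using f by (simp add: B_def)
  qed
  have "\<forall>\<^sub>F n in sequentially. (LINT t|?M. cmod (f n t - g t)) < 1"
    using order_tendstoD(2)[OF conv, of 1] by simp
  then show bd: "\<forall>\<^sub>F n in sequentially. (LINT t|?M. cmod (f n t)) \<le> 1 + (LINT t|?M. cmod (g t))"
    by eventually_elim (use fn in \<open>smt (verit) B_def\<close>)
  \<comment> \<open>The L1 norm of \<open>f n\<close> is eventually at most B + 1, so the sampling
    error costs e/2.\<close>
  define e1 where "e1 = e / (2 * (B + 1))"
  have e1: "e1 > 0" using e B by (simp add: e1_def)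
  obtain d where d: "d > 0" "\<And>y y' t t'. y \<in> I11 \<Longrightarrow> y' \<in> I11 \<Longrightarrow> t \<in> I11 \<Longrightarrow> t' \<in> I11 \<Longrightarrow>
    \<bar>y - y'\<bar> < d \<Longrightarrow> \<bar>t - t'\<bar> < d \<Longrightarrow> \<bar>green \<alpha> y t - green \<alpha> y' t'\<bar> < e1"
    using green_uniform[OF e1] by blast
  have "\<forall>\<^sub>F n in sequentially. (LINT t|?M. cmod (f n t - g t)) < e / (2 * C)"
    using order_tendstoD(2)[OF conv, of "e / (2 * C)"] e C by simp
  then show "\<forall>\<^sub>F n in sequentially. \<forall>y\<in>I11. cmod (green_sampled \<alpha> (N n) (f n) y - green_int \<alpha> g y) \<le> e"
    using sample_uniform[OF N d(1)] bd
  proof eventually_elim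
    case (elim n)
    then have N0: "N n > 0" by simp
    show ?case
    proof
      fix y assume y: "y \<in> I11"
      let ?p = "\<lambda>t. complex_of_real (green \<alpha> y (sample (N n) t)) - complex_of_real (green \<alpha> y t)"
      have p1: "?p \<in> borel_measurable ?M"
        by (intro borel_measurable_diff green_sample_measurable green_measurable)
      have p2: "cmod (?p t) \<le> e1" if "t \<in> I11" for t
        using d(2)[of y y "sample (N n) t" t] y sample_near(3)[OF N0 that] that elim(2) d(1)
        by (simp flip: of_real_diff add: less_imp_le)
      have fg: "integrable ?M (\<lambda>t. f n t - g t)" using f by simp
      have q2: "cmod (complex_of_real (green \<alpha> y t)) \<le> C" if "t \<in> I11" for t using C(2)[OF y that] by simp
      have s2: "cmod (complex_of_real (green \<alpha> y (sample (N n) t))) \<le> C" if "t \<in> I11" for t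
        using C(2)[OF y sample_near(3)[OF N0 that]] by simp
      note i1 = bounded_mult_integrable[OF p1 p2 f(1)[of n]]
      note i2 = bounded_mult_integrable[OF green_measurable q2 fg]
      note i3 = bounded_mult_integrable(1)[OF green_sample_measurable s2 f(1)[of n]]
      note i4 = bounded_mult_integrable(1)[OF green_measurable q2 f(2)]
      have "green_sampled \<alpha> (N n) (f n) y - green_int \<alpha> g y
          = (LINT t|?M. complex_of_real (green \<alpha> y (sample (N n) t)) * f n t - complex_of_real (green \<alpha> y t) * g t)"
        unfolding green_sampled_def green_int_def using i3 i4 by simp
      also have "\<dots> = (LINT t|?M. ?p t * f n t + complex_of_real (green \<alpha> y t) * (f n t - g t))"
        by (intro Bochner_Integration.integral_cong) (auto simp: algebra_simps)
      also have "\<dots> = (LINT t|?M. ?p t * f n t) + (LINT t|?M. complex_of_real (green \<alpha> y t) * (f n t - g t))"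
        using i1(1) i2(1) by (rule Bochner_Integration.integral_add)
      finally have eq: "green_sampled \<alpha> (N n) (f n) y - green_int \<alpha> g y
          = (LINT t|?M. ?p t * f n t) + (LINT t|?M. complex_of_real (green \<alpha> y t) * (f n t - g t))" .
      have "cmod (green_sampled \<alpha> (N n) (f n) y - green_int \<alpha> g y)
          \<le> e1 * (LINT t|?M. cmod (f n t)) + C * (LINT t|?M. cmod (f n t - g t))"
        unfolding eq by (rule order_trans[OF norm_triangle_ineq add_mono[OF i1(2) i2(2)]])
      also have "\<dots> \<le> e1 * (1 + B) + C * (e / (2 * C))"
        using elim(1,3) e1 C(1) unfolding B_def by (intro add_mono mult_left_mono) auto
      also have "\<dots> = e" using B C(1) by (simp add: e1_def field_simps)
      finally show "cmod (green_sampled \<alpha> (N n) (f n) y - green_int \<alpha> g y) \<le> e" .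
    qed
  qed
qed

lemma sampled_form_tendsto:
  assumes N: "filterlim N at_top sequentially"
    and \<alpha>: "\<alpha> > 0" and fn: "\<And>n. integrable \<mu> (f n)" and gL: "g \<in> L2"
    and conv: "(\<lambda>n. LINT t|\<mu>. cmod (f n t - g t)) \<longlonglongrightarrow> 0"
  shows "(\<lambda>n. LINT t|\<mu>. green_sampled \<alpha> (N n) (f n) (sample (N n) t) * cnj (f n t))
    \<longlonglongrightarrow> (LINT t|\<mu>. green_int \<alpha> g t * cnj (g t))"
proof (rule tendstoI)
  note f = fn L2_integrable[OF gL]
  fix e :: real assume e: "e > 0"
  let ?M = "\<mu>"
  let ?W = "\<lambda>n. green_sampled \<alpha> (N n) (f n)"
  define B where "B = (LINT t|?M. cmod (g t))"
  have B: "B \<ge> 0" by (simp add: B_def)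
  obtain C where C: "C > 0" "\<And>y t. y \<in> I11 \<Longrightarrow> t \<in> I11 \<Longrightarrow> \<bar>green \<alpha> y t\<bar> \<le> C"
    using green_bound by blast
  have N1: "(1::nat) > 0" by simp
  \<comment> \<open>Sampling and uniform convergence each cost e1, against an L1 norm of at most B +
    1: together e/4. The term with \<open>f n - g\<close> costs another e/4.\<close>
  define e1 where "e1 = e / (8 * (B + 1))"
  have e1: "e1 > 0" using e B by (simp add: e1_def)
  define e2 where "e2 = e1 / (B + 1)"
  have e2: "e2 > 0" using e1 B by (simp add: e2_def)
  obtain d where d: "d > 0" "\<And>y y' t t'. y \<in> I11 \<Longrightarrow> y' \<in> I11 \<Longrightarrow> t \<in> I11 \<Longrightarrow> t' \<in> I11 \<Longrightarrow>
    \<bar>y - y'\<bar> < d \<Longrightarrow> \<bar>t - t'\<bar> < d \<Longrightarrow> \<bar>green \<alpha> y t - green \<alpha> y' t'\<bar> < e2"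
    using green_uniform[OF e2] by blast
  \<comment> \<open>The added 1 keeps \<open>D\<close> positive even when \<open>g\<close> is
    null.\<close>
  define D where "D = C * B + 1"
  have D: "D > 0" using C(1) B by (simp add: D_def add_nonneg_pos)
  have Wc: "cmod (green_int \<alpha> g y - green_int \<alpha> g y') \<le> e1" if "y \<in> I11" "y' \<in> I11" "\<bar>y - y'\<bar> < d" for y y'
  proof -
    have "cmod (green_int \<alpha> g y - green_int \<alpha> g y') \<le> e2 * B"
      unfolding B_def using d that by (intro green_sampled_lipschitz(3)[OF f(2) N1 _ C(2)]) (auto simp: less_imp_le)
    also have "\<dots> \<le> e1" using e1 B by (simp add: e2_def field_simps)
    finally show ?thesis .
  qed
  have Wm: "green_int \<alpha> g \<in> borel_measurable ?M"
  proof (rule continuous_measurable_I11)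
    show "continuous_on I11 (green_int \<alpha> g)"
      using dirichlet_inv_continuous(1)[OF \<alpha> gL] green_int_eq_dirichlet_inv[OF \<alpha> gL]
      by (simp cong: continuous_on_cong)
  qed
  have Wb: "cmod (green_int \<alpha> g t) \<le> D" if "t \<in> I11" for t
  proof -
    have "cmod (green_int \<alpha> g t) \<le> C * B"
      unfolding B_def using that by (intro green_sampled_lipschitz(4)[OF f(2) N1 _ C(2), of t t 0]) auto
    then show ?thesis by (simp add: D_def)
  qed
  have "\<forall>\<^sub>F n in sequentially. (LINT t|?M. cmod (f n t - g t)) < e / (4 * D)"
    using order_tendstoD(2)[OF conv, of "e / (4 * D)"] e D by simp
  then show "\<forall>\<^sub>F n in sequentially. dist (LINT t|?M. ?W n (sample (N n) t) * cnj (f n t)) (LINT t|?M. green_int \<alpha> g t * cnj (g t)) < e"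
    using sample_uniform[OF N d(1)] green_sampled_uniform_limit(1)[OF N f conv e1, of \<alpha>]
      green_sampled_uniform_limit(2)[OF N f conv e1]
  proof eventually_elim
    case (elim n)
    then have N0: "N n > 0" by simp
    let ?p = "\<lambda>t. ?W n (sample (N n) t) - green_int \<alpha> g t"
    have cf: "integrable ?M (\<lambda>t. cnj (f n t))" "integrable ?M (\<lambda>t. cnj (g t))" "integrable ?M (\<lambda>t. cnj (f n t - g t))"
      using f by simp_all
    have Sm: "(\<lambda>t. ?W n (sample (N n) t)) \<in> borel_measurable ?M"
      unfolding sample_def by (rule grid_measurable)
    have p1: "?p \<in> borel_measurable ?M" by (intro borel_measurable_diff Sm Wm)
    have p2: "cmod (?p t) \<le> 2 * e1" if "t \<in> I11" for t
    proof -
      have s: "sample (N n) t \<in> I11" by (rule sample_near(3)[OF N0 that])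
      have "cmod (?W n (sample (N n) t) - green_int \<alpha> g (sample (N n) t)) \<le> e1" using elim(3) s by blast
      moreover have "cmod (green_int \<alpha> g (sample (N n) t) - green_int \<alpha> g t) \<le> e1"
        using Wc[OF s that] elim(2) that by blast
      ultimately show ?thesis
        using norm_triangle_ineq[of "?W n (sample (N n) t) - green_int \<alpha> g (sample (N n) t)" "green_int \<alpha> g (sample (N n) t) - green_int \<alpha> g t"]
        by simp
    qed
    note i1 = bounded_mult_integrable[OF p1 p2 cf(1)]
    note i2 = bounded_mult_integrable[OF Wm Wb cf(3)]
    have i3: "integrable ?M (\<lambda>t. ?W n (sample (N n) t) * cnj (f n t))"
    proof (rule bounded_mult_integrable(1)[OF Sm _ cf(1)])
      fix t assume t: "t \<in> I11"
      show "cmod (?W n (sample (N n) t)) \<le> 2 * e1 + D"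
        using p2[OF t] Wb[OF t] norm_triangle_ineq[of "?p t" "green_int \<alpha> g t"] by simp
    qed
    note i4 = bounded_mult_integrable(1)[OF Wm Wb cf(2)]
    have "(LINT t|?M. ?W n (sample (N n) t) * cnj (f n t)) - (LINT t|?M. green_int \<alpha> g t * cnj (g t))
        = (LINT t|?M. ?W n (sample (N n) t) * cnj (f n t) - green_int \<alpha> g t * cnj (g t))"
      using i3 i4 by simp
    also have "\<dots> = (LINT t|?M. ?p t * cnj (f n t) + green_int \<alpha> g t * cnj (f n t - g t))"
      by (intro Bochner_Integration.integral_cong) (auto simp: algebra_simps)
    also have "\<dots> = (LINT t|?M. ?p t * cnj (f n t)) + (LINT t|?M. green_int \<alpha> g t * cnj (f n t - g t))"
      using i1(1) i2(1) by (rule Bochner_Integration.integral_add)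
    finally have eq: "(LINT t|?M. ?W n (sample (N n) t) * cnj (f n t)) - (LINT t|?M. green_int \<alpha> g t * cnj (g t))
        = (LINT t|?M. ?p t * cnj (f n t)) + (LINT t|?M. green_int \<alpha> g t * cnj (f n t - g t))" .
    have "dist (LINT t|?M. ?W n (sample (N n) t) * cnj (f n t)) (LINT t|?M. green_int \<alpha> g t * cnj (g t))
        \<le> 2 * e1 * (LINT t|?M. cmod (cnj (f n t))) + D * (LINT t|?M. cmod (cnj (f n t - g t)))"
      unfolding dist_norm eq by (rule order_trans[OF norm_triangle_ineq add_mono[OF i1(2) i2(2)]])
    also have "\<dots> = 2 * e1 * (LINT t|?M. cmod (f n t)) + D * (LINT t|?M. cmod (f n t - g t))"
      by (simp only: complex_mod_cnj)
    also have "\<dots> \<le> 2 * e1 * (1 + B) + D * (e / (4 * D))"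
      using elim(1,4) e1 D unfolding B_def by (intro add_mono mult_left_mono) auto
    also have "\<dots> = e / 2" using B D by (simp add: e1_def field_simps)
    also have "\<dots> < e" using e by simp
    finally show ?case .
  qed
qed

text \<open>Fatou puts the limit into the unit ball. Convergence in L2 can fail, but the L2 bound
  gives uniform integrability: h \<le> min h R + h^2/R, where the truncated part converges by
  domination and the rest is at most 4/R.\<close>

lemma L2_bounded_AE_limit:
  fixes f :: "nat \<Rightarrow> real \<Rightarrow> complex"
  assumes f: "\<And>n. f n \<in> L2" "\<And>n. (LINT t|\<mu>. (cmod (f n t))\<^sup>2) \<le> 1"
    and g[measurable]: "g \<in> borel_measurable \<mu>"
    and lim: "AE t in \<mu>. (\<lambda>n. f n t) \<longlonglongrightarrow> g t"
  shows "g \<in> L2" "(LINT t|\<mu>. (cmod (g t))\<^sup>2) \<le> 1"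
    "(\<lambda>n. LINT t|\<mu>. cmod (f n t - g t)) \<longlonglongrightarrow> 0"
proof -
  let ?M = "\<mu>"
  have fm[measurable]: "f n \<in> borel_measurable ?M" for n by (rule L2_measurable[OF f(1)])
  have "(\<integral>\<^sup>+ t. ennreal ((cmod (g t))\<^sup>2) \<partial>?M) = (\<integral>\<^sup>+ t. liminf (\<lambda>n. ennreal ((cmod (f n t))\<^sup>2)) \<partial>?M)"
  proof (rule nn_integral_cong_AE, use lim in eventually_elim)
    case (elim t)
    then have "(\<lambda>n. ennreal ((cmod (f n t))\<^sup>2)) \<longlonglongrightarrow> ennreal ((cmod (g t))\<^sup>2)"
      by (intro tendsto_intros)
    then show ?case by (intro lim_imp_Liminf[symmetric]) auto
  qed
  also have "\<dots> \<le> liminf (\<lambda>n. \<integral>\<^sup>+ t. ennreal ((cmod (f n t))\<^sup>2) \<partial>?M)"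
    by (intro nn_integral_liminf) measurable
  also have "\<dots> \<le> liminf (\<lambda>n. 1)"
  proof (intro Liminf_mono always_eventually allI)
    fix n
    have "(\<integral>\<^sup>+ t. ennreal ((cmod (f n t))\<^sup>2) \<partial>?M) = ennreal (LINT t|?M. (cmod (f n t))\<^sup>2)"
      by (intro nn_integral_eq_integral L2_square_integrable f) auto
    then show "(\<integral>\<^sup>+ t. ennreal ((cmod (f n t))\<^sup>2) \<partial>?M) \<le> 1" using f(2)[of n] by simp
  qed
  also have "\<dots> = 1" by (simp add: Liminf_const)
  finally have le1: "(\<integral>\<^sup>+ t. ennreal ((cmod (g t))\<^sup>2) \<partial>?M) \<le> 1" .
  have ig: "integrable ?M (\<lambda>t. (cmod (g t))\<^sup>2)"
    by (rule integrableI_nonneg) (use le1 in \<open>auto simp: order_le_less_trans\<close>)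
  then show gL: "g \<in> L2" by (simp add: L2_def)
  have "ennreal (LINT t|?M. (cmod (g t))\<^sup>2) \<le> 1"
    using le1 nn_integral_eq_integral[OF ig] by simp
  then show g1: "(LINT t|?M. (cmod (g t))\<^sup>2) \<le> 1" by simp
  define h where "h n t = cmod (f n t - g t)" for n t
  have hL: "(\<lambda>t. f n t - g t) \<in> L2" for n by (intro L2_diff f gL)
  have hm[measurable]: "h n \<in> borel_measurable ?M" for n unfolding h_def by measurable
  have ih: "integrable ?M (h n)" for n
    unfolding h_def using L2_integrable[OF hL] by simp
  have ih2: "integrable ?M (\<lambda>t. (h n t)\<^sup>2)" for n
    unfolding h_def by (rule L2_square_integrable[OF hL])
  have h4: "(LINT t|?M. (h n t)\<^sup>2) \<le> 4" for n
  proof -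
    have "(LINT t|?M. (h n t)\<^sup>2) \<le> (LINT t|?M. 2 * (cmod (f n t))\<^sup>2 + 2 * (cmod (g t))\<^sup>2)"
    proof (rule integral_mono)
      show "integrable ?M (\<lambda>t. 2 * (cmod (f n t))\<^sup>2 + 2 * (cmod (g t))\<^sup>2)"
        using L2_square_integrable[OF f(1)] ig by simp
      show "(h n t)\<^sup>2 \<le> 2 * (cmod (f n t))\<^sup>2 + 2 * (cmod (g t))\<^sup>2" for t
      proof -
        have "(h n t)\<^sup>2 \<le> (cmod (f n t) + cmod (g t))\<^sup>2"
          unfolding h_def by (intro power_mono norm_triangle_ineq4) auto
        also have "\<dots> \<le> 2 * (cmod (f n t))\<^sup>2 + 2 * (cmod (g t))\<^sup>2"
          using sum_squares_bound[of "cmod (f n t)" "cmod (g t)"] by (simp add: power2_sum)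
        finally show ?thesis .
      qed
    qed (rule ih2)
    also have "\<dots> = 2 * (LINT t|?M. (cmod (f n t))\<^sup>2) + 2 * (LINT t|?M. (cmod (g t))\<^sup>2)"
      using L2_square_integrable[OF f(1)] ig by simp
    finally show ?thesis using f(2)[of n] g1 by simp
  qed
  show "(\<lambda>n. LINT t|?M. cmod (f n t - g t)) \<longlonglongrightarrow> 0"
  proof (rule tendstoI)
    fix e :: real assume e: "e > 0"
    \<comment> \<open>Makes the tail bound 4/R equal to e/2.\<close>
    define R where "R = 8 / e"
    have R: "R > 0" using e by (simp add: R_def)
    have im: "integrable ?M (\<lambda>t. min (h n t) R)" for n
    proof (rule integrable_I11_bound[where g = "\<lambda>_. R"])
      show "norm (min (h n y) R) \<le> R" for y using R by (auto simp: h_def min_def)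
    qed auto
    have "(\<lambda>n. LINT t|?M. min (h n t) R) \<longlonglongrightarrow> (LINT t|?M. 0)"
    proof (rule integral_dominated_convergence[where w = "\<lambda>_. R"])
      show "AE t in ?M. (\<lambda>n. min (h n t) R) \<longlonglongrightarrow> 0"
        using lim
      proof eventually_elim
        case (elim t)
        have "(\<lambda>n. min (h n t) R) \<longlonglongrightarrow> min (cmod (g t - g t)) R"
          unfolding h_def by (intro tendsto_intros elim)
        then show ?case using R by simp
      qed
      show "AE t in ?M. norm (min (h n t) R) \<le> R" for n using R by (auto simp: h_def min_def)
    qed auto
    then have "\<forall>\<^sub>F n in sequentially. (LINT t|?M. min (h n t) R) < e / 2"
      using e by (intro order_tendstoD(2)) auto
    then show "\<forall>\<^sub>F n in sequentially. dist (LINT t|?M. cmod (f n t - g t)) 0 < e"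
    proof eventually_elim
      case (elim n)
      have "(LINT t|?M. h n t) \<le> (LINT t|?M. min (h n t) R + (h n t)\<^sup>2 / R)"
      proof (rule integral_mono[OF ih])
        show "integrable ?M (\<lambda>t. min (h n t) R + (h n t)\<^sup>2 / R)" using im ih2 by simp
        show "h n t \<le> min (h n t) R + (h n t)\<^sup>2 / R" for t
        proof (cases "h n t \<le> R")
          case True
          then show ?thesis using R by simp
        next
          case False
          then have "h n t * R \<le> h n t * h n t" using R by (intro mult_left_mono) auto
          then have "h n t \<le> (h n t)\<^sup>2 / R" using R by (simp add: field_simps power2_eq_square)
          then show ?thesis using False R by simp
        qed
      qed
      also have "\<dots> = (LINT t|?M. min (h n t) R) + (LINT t|?M. (h n t)\<^sup>2) / R"
        using im ih2 by simp
      also have "(LINT t|?M. (h n t)\<^sup>2) / R \<le> 4 / R" using h4 R by (intro divide_right_mono) auto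
      also have "4 / R = e / 2" using e by (simp add: R_def)
      finally have "(LINT t|?M. h n t) < e" using elim by simp
      moreover have "(LINT t|?M. h n t) \<ge> 0" by (simp add: h_def)
      ultimately show ?case by (simp add: h_def)
    qed
  qed
qed

section \<open>A negative direction\<close>

text \<open>First Dirichlet eigenfunction on (-1,1), with eigenvalue (pi/2)^2.\<close>

definition cosine :: "real \<Rightarrow> complex" where
  "cosine y = complex_of_real (cos (pi / 2 * y))"

lemma cosine_continuous: "continuous_on S cosine"
  unfolding cosine_def by (intro continuous_intros)

text \<open>G acts on \<open>cosine\<close> as division by s = (pi/2)^2 + \<alpha>^2, so the form
  equals (1/pi^2 - 1/s) times the squared norm, and s < pi^2 below the threshold.\<close>

lemma cosine_form_negative:
  assumes a: "0 < \<alpha>" "\<alpha> < sqrt 3 * pi / 2"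
  shows "Re (form \<alpha> cosine cosine) < 0"
proof -
  define s where "s = (pi / 2)\<^sup>2 + \<alpha>\<^sup>2"
  have s0: "s > 0" using a by (simp add: s_def add_nonneg_pos)
  have "\<alpha>\<^sup>2 < (sqrt 3 * pi / 2)\<^sup>2" using a by (intro power_strict_mono) auto
  then have s1: "s < pi\<^sup>2" by (simp add: s_def power_mult_distrib power_divide)
  have L: "cosine \<in> L2" by (intro continuous_L2 cosine_continuous)
  define w where "w = (\<lambda>y. complex_of_real (cos (pi / 2 * y) / s))"
  define w' where "w' = (\<lambda>y. complex_of_real (- (pi / 2) * sin (pi / 2 * y) / s))"
  obtain p where p: "dirichlet_pair \<alpha> cosine w p"
  proof (rule classical_dirichlet_pair[of cosine w w' \<alpha>])
    show "continuous_on I11 w" unfolding w_def using s0 by (intro continuous_intros) auto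
    show "w (- 1) = 0" "w 1 = 0" by (simp_all add: w_def)
    show "(w has_vector_derivative w' y) (at y)" for y
      unfolding w_def w'_def
      by (rule has_vector_derivative_of_real) (use s0 in \<open>auto intro!: derivative_eq_intros simp flip: has_real_derivative_iff_has_vector_derivative\<close>)
    have "complex_of_real (\<alpha>\<^sup>2) * w y - cosine y = complex_of_real (- (pi / 2)\<^sup>2 * cos (pi / 2 * y) / s)" for y
      unfolding w_def cosine_def of_real_mult[symmetric] of_real_diff[symmetric] of_real_eq_iff
      using s0 by (simp add: s_def field_simps)
    moreover have "(w' has_vector_derivative complex_of_real (- (pi / 2)\<^sup>2 * cos (pi / 2 * y) / s)) (at y)" for y
      unfolding w'_def
      by (rule has_vector_derivative_of_real) (use s0 in \<open>auto intro!: derivative_eq_intros simp: power2_eq_square simp flip: has_real_derivative_iff_has_vector_derivative\<close>)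
    ultimately show "(w' has_vector_derivative complex_of_real (\<alpha>\<^sup>2) * w y - cosine y) (at y)" for y
      by simp
  qed (auto intro: cosine_continuous)
  obtain u' where u: "dirichlet_pair \<alpha> cosine (dirichlet_inv \<alpha> cosine) u'"
    using dirichlet_inv_pair[OF a(1) L] by blast
  have inv: "dirichlet_inv \<alpha> cosine y = complex_of_real (1 / s) * cosine y" if "y \<in> I11" for y
    using dirichlet_unique[OF a(1) u p L that] by (simp add: w_def cosine_def)
  have "ip (dirichlet_inv \<alpha> cosine) cosine = ip (\<lambda>y. complex_of_real (1 / s) * cosine y) cosine"
    unfolding ip_def by (intro Bochner_Integration.integral_cong) (auto simp: inv)
  then have eq: "form \<alpha> cosine cosine = complex_of_real (1 / pi\<^sup>2) * ip cosine cosine - complex_of_real (1 / s) * ip cosine cosine"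
    unfolding form_def ip_L_op[OF a(1) L L] ip_scale by simp
  have "Re (form \<alpha> cosine cosine) = (1 / pi\<^sup>2 - 1 / s) * Re (ip cosine cosine)"
    unfolding eq by (simp add: left_diff_distrib)
  moreover have "1 / pi\<^sup>2 - 1 / s < 0" using s0 s1 by (simp add: field_simps)
  moreover have "Re (ip cosine cosine) > 0"
  proof (rule ccontr)
    assume "\<not> ?thesis"
    then have "cosine 0 = 0"
      using ip_self_continuous_eq_0[OF cosine_continuous, of 0] by (auto simp: I11_def)
    then show False by (simp add: cosine_def)
  qed
  ultimately show ?thesis by (simp add: mult_neg_pos)
qed

text \<open>The cosine is injective on [0, pi], so a level set within the interval has at most the
  two points x and -x. Division by b - c is therefore legitimate almost everywhere for every complex
  c, even one in the range of b.\<close>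

lemma vort_level_null: "AE y in \<mu>. complex_of_real (vort \<beta> y) \<noteq> c"
proof -
  have "finite {y \<in> I11. complex_of_real (vort \<beta> y) = c}"
  proof (cases "\<exists>x\<in>I11. complex_of_real (vort \<beta> x) = c")
    case True
    then obtain x where x: "x \<in> I11" "complex_of_real (vort \<beta> x) = c" by blast
    have "y = x \<or> y = - x" if "y \<in> I11" "complex_of_real (vort \<beta> y) = c" for y
    proof -
      have "vort \<beta> y = vort \<beta> x" using x(2) that(2) of_real_eq_iff by metis
      then have "cos (pi * y) = cos (pi * x)" by (simp add: vort_def)
      then have "cos (pi * \<bar>y\<bar>) = cos (pi * \<bar>x\<bar>)" by (simp add: abs_if)
      moreover have "0 \<le> pi * \<bar>y\<bar>" "pi * \<bar>y\<bar> \<le> pi" "0 \<le> pi * \<bar>x\<bar>" "pi * \<bar>x\<bar> \<le> pi"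
        using x(1) that(1) by (auto simp: I11_def)
      ultimately have "pi * \<bar>y\<bar> = pi * \<bar>x\<bar>" using cos_inj_pi by blast
      then have "\<bar>y\<bar> = \<bar>x\<bar>" by simp
      then show ?thesis by (auto simp: abs_if split: if_splits)
    qed
    then have "{y \<in> I11. complex_of_real (vort \<beta> y) = c} \<subseteq> {x, - x}" by blast
    then show ?thesis by (rule finite_subset) simp
  next
    case False
    then have "{y \<in> I11. complex_of_real (vort \<beta> y) = c} = {}" by blast
    then show ?thesis by (simp only: finite.emptyI)
  qed
  then have "negligible {y \<in> I11. complex_of_real (vort \<beta> y) = c}" by (rule negligible_finite)
  then have "AE y in lebesgue. y \<notin> {y \<in> I11. complex_of_real (vort \<beta> y) = c}"
    by (intro AE_not_in) (simp add: negligible_iff_null_sets)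
  then have "AE y in lebesgue. y \<in> I11 \<longrightarrow> complex_of_real (vort \<beta> y) \<noteq> c"
    by eventually_elim auto
  then show ?thesis by (subst AE_restrict_space_iff) auto
qed

text \<open>b is non-zero almost everywhere, so L f is null and f lies in the radical of the form.
  Together with the negative direction \<open>cosine\<close> it spans a non-positive plane, which
  must be degenerate; the kernel of L is never computed.\<close>

lemma JL_op_kernel:
  assumes a: "0 < \<alpha>" "\<alpha> < sqrt 3 * pi / 2" and f: "f \<in> L2" and 0: "aeq (JL_op \<alpha> \<beta> f) (\<lambda>_. 0)"
  shows "aeq f (\<lambda>_. 0)"
proof (rule ccontr)
  assume f0: "\<not> aeq f (\<lambda>_. 0)"
  have "AE y in \<mu>. L_op \<alpha> f y = 0"
    using 0 vort_level_null[of \<beta> 0] unfolding aeq_def JL_op_alt by eventually_elim (use a in simp)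
  then have L0: "aeq (L_op \<alpha> f) (\<lambda>_. 0)" by (simp add: aeq_def)
  have fg: "form \<alpha> f g = 0" if "g \<in> L2" for g
    using ip_aeq_left[OF L0 L_op_L2[OF a(1) f] L2_const that] by (simp add: form_def ip_def)
  have c: "cosine \<in> L2" by (intro continuous_L2 cosine_continuous)
  \<comment> \<open>Pairing the null combination with \<open>cosine\<close> gives q = 0, because f
    contributes nothing and the form of \<open>cosine\<close> is strictly negative; what is left is
    that f is null.\<close>
  obtain p q where pq: "p \<noteq> 0 \<or> q \<noteq> 0" "aeq (\<lambda>y. p * f y + q * cosine y) (\<lambda>_. 0)"
  proof (rule nonpositive_plane_degenerate[OF a(1) f c])
    show "Re (form \<alpha> (\<lambda>y. p * f y + q * cosine y) (\<lambda>y. p * f y + q * cosine y)) \<le> 0" for p q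
      unfolding form_comb[OF a(1) f c] fg[OF c] fg[OF f]
      using cosine_form_negative[OF a] by (simp add: mult_nonneg_nonpos)
  qed
  have comb: "(\<lambda>y. p * f y + q * cosine y) \<in> L2" by (intro L2_lin f c)
  have "form \<alpha> (\<lambda>y. p * f y + q * cosine y) cosine = 0"
    by (rule form_cong_0[OF a(1) pq(2) comb c])
  then have "q * form \<alpha> cosine cosine = 0"
    using form_lin[OF a(1) f c c, of p q] fg[OF c] by simp
  then have "q = 0" using cosine_form_negative[OF a] by auto
  then show False using pq f0 aeq_scale_0[of p f] by simp
qed

section \<open>Existence of a non-positive eigenfunction\<close>

lemma sample_tendsto:
  assumes N: "filterlim N at_top sequentially" and t: "t \<in> I11"
  shows "(\<lambda>n. sample (N n) t) \<longlonglongrightarrow> t"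
proof (rule tendstoI)
  fix e :: real assume "e > 0"
  from sample_uniform[OF N this] show "\<forall>\<^sub>F n in sequentially. dist (sample (N n) t) t < e"
    by eventually_elim (use t in \<open>auto simp: dist_real_def\<close>)
qed

lemma green_sampled_step:
  fixes x :: "nat \<Rightarrow> complex"
  assumes n: "n > 0"
  shows "green_sampled \<alpha> n (\<lambda>t. x (grid_index n t)) y
    = complex_of_real (2 / real n) * (\<Sum>j<n. complex_of_real (green \<alpha> y (grid_point n j)) * x j)"
  unfolding green_sampled_def sample_def
  using grid_integral(2)[OF n, of "\<lambda>j. complex_of_real (green \<alpha> y (grid_point n j)) * x j"]
  by (simp add: scaleR_conv_of_real)

lemma step_L2:
  fixes x :: "nat \<Rightarrow> complex"
  assumes n: "n > 0"
  shows "(\<lambda>t. x (grid_index n t)) \<in> L2"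
  unfolding L2_def using grid_measurable grid_integral(1)[OF n, of "\<lambda>j. (cmod (x j))\<^sup>2"] by blast

text \<open>Nystrom matrix of L. Equal cells give the common weight 2/n, which preserves the
  symmetry of the kernel.\<close>

definition nystrom :: "real \<Rightarrow> nat \<Rightarrow> nat \<Rightarrow> nat \<Rightarrow> real" where
  "nystrom \<alpha> n i j = (if i = j then 1 / pi\<^sup>2 else 0) - 2 / real n * green \<alpha> (grid_point n i) (grid_point n j)"

lemma nystrom_apply:
  fixes x :: "nat \<Rightarrow> complex"
  assumes n: "n > 0" and i: "i < n"
  shows "(\<Sum>j<n. complex_of_real (nystrom \<alpha> n i j) * x j)
    = x i / complex_of_real (pi\<^sup>2) - green_sampled \<alpha> n (\<lambda>t. x (grid_index n t)) (grid_point n i)"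
proof -
  have "(\<Sum>j<n. complex_of_real (nystrom \<alpha> n i j) * x j)
      = (\<Sum>j<n. (if i = j then x j / complex_of_real (pi\<^sup>2) else 0)
          - complex_of_real (2 / real n) * (complex_of_real (green \<alpha> (grid_point n i) (grid_point n j)) * x j))"
    by (intro sum.cong) (auto simp: nystrom_def algebra_simps)
  also have "\<dots> = x i / complex_of_real (pi\<^sup>2)
      - complex_of_real (2 / real n) * (\<Sum>j<n. complex_of_real (green \<alpha> (grid_point n i) (grid_point n j)) * x j)"
    using i by (simp only: sum_subtractf sum_distrib_left[symmetric]) simp
  finally show ?thesis by (simp only: green_sampled_step[OF n])
qed

lemma nystrom_form:
  fixes x :: "nat \<Rightarrow> complex"
  assumes n: "n > 0"
  defines "f \<equiv> \<lambda>t. x (grid_index n t)"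
  shows "2 / real n * Re (\<Sum>i<n. (\<Sum>j<n. complex_of_real (nystrom \<alpha> n i j) * x j) * cnj (x i))
    = (LINT t|\<mu>. (cmod (f t))\<^sup>2) / pi\<^sup>2
      - Re (LINT t|\<mu>. green_sampled \<alpha> n f (sample n t) * cnj (f t))"
proof -
  have 1: "(LINT t|\<mu>. (cmod (f t))\<^sup>2) = 2 / real n * (\<Sum>i<n. (cmod (x i))\<^sup>2)"
    unfolding f_def using grid_integral(2)[OF n, of "\<lambda>j. (cmod (x j))\<^sup>2"] by simp
  have 2: "(LINT t|\<mu>. green_sampled \<alpha> n f (sample n t) * cnj (f t))
      = complex_of_real (2 / real n) * (\<Sum>i<n. green_sampled \<alpha> n f (grid_point n i) * cnj (x i))"
    unfolding sample_def using grid_integral(2)[OF n, of "\<lambda>j. green_sampled \<alpha> n f (grid_point n j) * cnj (x j)"]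
    by (simp add: f_def scaleR_conv_of_real)
  have "(\<Sum>i<n. (\<Sum>j<n. complex_of_real (nystrom \<alpha> n i j) * x j) * cnj (x i))
      = (\<Sum>i<n. complex_of_real ((cmod (x i))\<^sup>2 / pi\<^sup>2) - green_sampled \<alpha> n f (grid_point n i) * cnj (x i))"
  proof (intro sum.cong refl)
    fix i assume "i \<in> {..<n}"
    then have i: "i < n" by simp
    have "x i / complex_of_real (pi\<^sup>2) * cnj (x i) = complex_of_real ((cmod (x i))\<^sup>2 / pi\<^sup>2)"
      unfolding of_real_divide complex_norm_square by simp
    then show "(\<Sum>j<n. complex_of_real (nystrom \<alpha> n i j) * x j) * cnj (x i)
        = complex_of_real ((cmod (x i))\<^sup>2 / pi\<^sup>2) - green_sampled \<alpha> n f (grid_point n i) * cnj (x i)"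
      unfolding nystrom_apply[OF n i] f_def left_diff_distrib by simp
  qed
  also have "\<dots> = complex_of_real ((\<Sum>i<n. (cmod (x i))\<^sup>2) / pi\<^sup>2)
      - (\<Sum>i<n. green_sampled \<alpha> n f (grid_point n i) * cnj (x i))"
    by (simp only: sum_subtractf of_real_sum[symmetric] sum_divide_distrib)
  finally have 3: "(\<Sum>i<n. (\<Sum>j<n. complex_of_real (nystrom \<alpha> n i j) * x j) * cnj (x i))
      = complex_of_real ((\<Sum>i<n. (cmod (x i))\<^sup>2) / pi\<^sup>2)
      - (\<Sum>i<n. green_sampled \<alpha> n f (grid_point n i) * cnj (x i))" .
  show ?thesis unfolding 1 2 3 Re_complex_of_real minus_complex.sel times_complex.sel
    by (simp add: right_diff_distrib)
qed

text \<open>Up to the factor 2/n the matrix form at the grid values of \<open>cosine\<close> is the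
  form of a step function, and it converges to the strictly negative value for \<open>cosine\<close>
  itself.\<close>

lemma nystrom_negative:
  assumes a: "0 < \<alpha>" "\<alpha> < sqrt 3 * pi / 2"
  shows "\<forall>\<^sub>F n in sequentially. Re (\<Sum>i<n. (\<Sum>j<n. complex_of_real (nystrom \<alpha> n i j) * cosine (grid_point n j))
      * cnj (cosine (grid_point n i))) < 0"
proof -
  let ?M = "\<mu>"
  \<comment> \<open>Shifting by one keeps all grid sizes positive; the shift is undone at the
    end.\<close>
  define N where "N n = Suc n" for n
  have N: "filterlim N at_top sequentially" unfolding N_def by (rule filterlim_Suc)
  have N0: "N n > 0" for n by (simp add: N_def)
  define f where "f n t = cosine (sample (N n) t)" for n t
  have fL: "f n \<in> L2" for n
    unfolding f_def sample_def by (rule step_L2[OF N0])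
  have cL: "cosine \<in> L2" by (intro continuous_L2 cosine_continuous)
  have fm: "f n \<in> borel_measurable ?M" "cosine \<in> borel_measurable ?M" for n
    by (intro L2_measurable fL cL)+
  have b: "cmod (cosine y) \<le> 1" for y by (simp add: cosine_def)
  have pt: "(\<lambda>n. f n t) \<longlonglongrightarrow> cosine t" if "t \<in> I11" for t
  proof -
    have "isCont cosine t" using cosine_continuous[of UNIV] by (simp add: continuous_on_eq_continuous_at)
    then show ?thesis unfolding f_def by (rule isCont_tendsto_compose[OF _ sample_tendsto[OF N that]])
  qed
  have "(\<lambda>n. LINT t|?M. cmod (f n t - cosine t)) \<longlonglongrightarrow> (LINT t|?M. 0)"
  proof (rule integral_dominated_convergence[where w = "\<lambda>_. 2"])
    show "AE t in ?M. (\<lambda>n. cmod (f n t - cosine t)) \<longlonglongrightarrow> 0"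
    proof (rule AE_I2)
      fix t assume "t \<in> space ?M"
      then have "t \<in> I11" by simp
      from tendsto_norm[OF tendsto_diff[OF pt[OF this] tendsto_const[of "cosine t"]]]
      show "(\<lambda>n. cmod (f n t - cosine t)) \<longlonglongrightarrow> 0" by simp
    qed
    show "AE t in ?M. norm (cmod (f n t - cosine t)) \<le> 2" for n
    proof (rule AE_I2)
      fix t
      show "norm (cmod (f n t - cosine t)) \<le> 2"
        using norm_triangle_ineq4[of "f n t" "cosine t"] b[of t] b[of "sample (N n) t"] by (simp add: f_def)
    qed
  qed (use fm in auto)
  then have conv: "(\<lambda>n. LINT t|?M. cmod (f n t - cosine t)) \<longlonglongrightarrow> 0" by simp
  have norm2: "(\<lambda>n. LINT t|?M. (cmod (f n t))\<^sup>2) \<longlonglongrightarrow> (LINT t|?M. (cmod (cosine t))\<^sup>2)"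
  proof (rule integral_dominated_convergence[where w = "\<lambda>_. 1"])
    show "AE t in ?M. (\<lambda>n. (cmod (f n t))\<^sup>2) \<longlonglongrightarrow> (cmod (cosine t))\<^sup>2"
      by (rule AE_I2) (auto intro!: tendsto_intros pt)
    show "AE t in ?M. norm ((cmod (f n t))\<^sup>2) \<le> 1" for n
      by (rule AE_I2) (auto simp: f_def b power_le_one)
  qed (use fm in auto)
  have form: "(\<lambda>n. LINT t|?M. green_sampled \<alpha> (N n) (f n) (sample (N n) t) * cnj (f n t))
      \<longlonglongrightarrow> (LINT t|?M. green_int \<alpha> cosine t * cnj (cosine t))"
    by (rule sampled_form_tendsto[OF N a(1) L2_integrable[OF fL] cL conv])
  have "(LINT t|?M. green_int \<alpha> cosine t * cnj (cosine t)) = ip (dirichlet_inv \<alpha> cosine) cosine"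
    unfolding ip_def
    by (intro Bochner_Integration.integral_cong) (auto simp: green_int_eq_dirichlet_inv[OF a(1) cL])
  then have "(\<lambda>n. (LINT t|?M. (cmod (f n t))\<^sup>2) / pi\<^sup>2
       - Re (LINT t|?M. green_sampled \<alpha> (N n) (f n) (sample (N n) t) * cnj (f n t)))
      \<longlonglongrightarrow> (LINT t|?M. (cmod (cosine t))\<^sup>2) / pi\<^sup>2 - Re (ip (dirichlet_inv \<alpha> cosine) cosine)"
    using form norm2 by (intro tendsto_intros) auto
  also have "(LINT t|?M. (cmod (cosine t))\<^sup>2) / pi\<^sup>2 - Re (ip (dirichlet_inv \<alpha> cosine) cosine)
      = Re (form \<alpha> cosine cosine)"
    unfolding form_def ip_L_op[OF a(1) cL cL] by (simp add: ip_self[OF cL])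
  finally have "\<forall>\<^sub>F n in sequentially. (LINT t|?M. (cmod (f n t))\<^sup>2) / pi\<^sup>2
       - Re (LINT t|?M. green_sampled \<alpha> (N n) (f n) (sample (N n) t) * cnj (f n t)) < 0"
    using cosine_form_negative[OF a] by (rule order_tendstoD(2))
  then have "\<forall>\<^sub>F n in sequentially. Re (\<Sum>i<N n. (\<Sum>j<N n. complex_of_real (nystrom \<alpha> (N n) i j) * cosine (grid_point (N n) j))
      * cnj (cosine (grid_point (N n) i))) < 0"
  proof eventually_elim
    case (elim n)
    have "2 / real (N n) * Re (\<Sum>i<N n. (\<Sum>j<N n. complex_of_real (nystrom \<alpha> (N n) i j) * cosine (grid_point (N n) j))
      * cnj (cosine (grid_point (N n) i))) < 0"
      using elim unfolding nystrom_form[OF N0, where x = "\<lambda>j. cosine (grid_point (N n) j)"] f_def sample_def .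
    then show ?case using N0[of n] by (simp add: mult_less_0_iff zero_less_mult_iff divide_less_0_iff)
  qed
  then show ?thesis unfolding N_def by (subst eventually_sequentially_Suc[symmetric])
qed

text \<open>At unit norm, non-positivity of the form reads as a lower bound on the Green term alone,
  a quantity that is continuous in the limit although the norm is not. The point t = 1 is excluded
  because its \<open>grid_index\<close> is n, where the matrix has no row.\<close>

lemma discrete_eigenfunction:
  assumes a: "0 < \<alpha>" "\<alpha> < sqrt 3 * pi / 2"
  shows "\<forall>\<^sub>F n in sequentially. \<exists>f \<zeta>. f \<in> L2 \<and> (LINT t|\<mu>. (cmod (f t))\<^sup>2) = 1 \<and>
     (\<forall>t\<in>I11. t \<noteq> 1 \<longrightarrow> complex_of_real (vort \<beta> (sample n t)) *
         (f t / complex_of_real (pi\<^sup>2) - green_sampled \<alpha> n f (sample n t)) = \<zeta> * f t) \<and>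
     1 / pi\<^sup>2 \<le> Re (LINT t|\<mu>. green_sampled \<alpha> n f (sample n t) * cnj (f t))"
  using nystrom_negative[OF a] eventually_gt_at_top[of 0]
proof eventually_elim
  case (elim n)
  then have n: "n > 0" by simp
  have sym: "nystrom \<alpha> n i j = nystrom \<alpha> n j i" for i j
    by (simp add: nystrom_def green_sym)
  obtain x \<zeta> where x: "\<exists>i<n. x i \<noteq> 0"
    and ev: "\<And>i. i < n \<Longrightarrow> complex_of_real (vort \<beta> (grid_point n i)) * (\<Sum>j<n. complex_of_real (nystrom \<alpha> n i j) * x j) = \<zeta> * x i"
    and np: "Re (\<Sum>i<n. (\<Sum>j<n. complex_of_real (nystrom \<alpha> n i j) * x j) * cnj (x i)) \<le> 0"
    by (rule nonpositive_eigenvector_exists[where M = "nystrom \<alpha> n" and n = n and e = "\<lambda>j. cosine (grid_point n j)"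
        and d = "\<lambda>i. vort \<beta> (grid_point n i)", OF sym elim(1)]) blast
  \<comment> \<open>Squared L2 norm of the step function belonging to \<open>x\<close>, by which the
    eigenvector is normalised.\<close>
  define S where "S = 2 / real n * (\<Sum>i<n. (cmod (x i))\<^sup>2)"
  have S: "S > 0"
  proof -
    have "(\<Sum>i<n. (cmod (x i))\<^sup>2) > 0" using x by (intro sum_pos2[of _ "SOME i. i < n \<and> x i \<noteq> 0"])
       (auto dest!: someI_ex[of "\<lambda>i. i < n \<and> x i \<noteq> 0"])
    then show ?thesis using n by (simp add: S_def)
  qed
  define c where "c = complex_of_real (1 / sqrt S)"
  define v where "v i = c * x i" for i
  define f where "f t = v (grid_index n t)" for t
  have c2: "(cmod c)\<^sup>2 = 1 / S" using S by (simp add: c_def norm_divide power_divide)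
  have Av: "(\<Sum>j<n. complex_of_real (nystrom \<alpha> n i j) * v j) = c * (\<Sum>j<n. complex_of_real (nystrom \<alpha> n i j) * x j)" for i
    by (simp add: v_def sum_distrib_left mult.left_commute)
  have 1: "(LINT t|\<mu>. (cmod (f t))\<^sup>2) = 1"
  proof -
    have "(LINT t|\<mu>. (cmod (f t))\<^sup>2) = 2 / real n * (\<Sum>i<n. (cmod (v i))\<^sup>2)"
      unfolding f_def using grid_integral(2)[OF n, of "\<lambda>j. (cmod (v j))\<^sup>2"] by simp
    also have "\<dots> = (cmod c)\<^sup>2 * S"
      by (simp add: v_def norm_mult power_mult_distrib S_def sum_distrib_left[symmetric])
    finally show ?thesis using c2 S by simp
  qed
  have 2: "complex_of_real (vort \<beta> (sample n t)) *
         (f t / complex_of_real (pi\<^sup>2) - green_sampled \<alpha> n f (sample n t)) = \<zeta> * f t" if "t \<in> I11" "t \<noteq> 1" for t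
  proof -
    define i where "i = grid_index n t"
    have i: "i < n" unfolding i_def by (rule grid_index_less[OF n that])
    have "f t / complex_of_real (pi\<^sup>2) - green_sampled \<alpha> n f (sample n t)
        = (\<Sum>j<n. complex_of_real (nystrom \<alpha> n i j) * v j)"
      unfolding f_def sample_def i_def[symmetric] by (rule nystrom_apply[OF n i, symmetric])
    then have "complex_of_real (vort \<beta> (sample n t)) * (f t / complex_of_real (pi\<^sup>2) - green_sampled \<alpha> n f (sample n t))
        = c * (complex_of_real (vort \<beta> (grid_point n i)) * (\<Sum>j<n. complex_of_real (nystrom \<alpha> n i j) * x j))"
      by (simp add: Av sample_def i_def)
    also have "\<dots> = \<zeta> * f t" unfolding ev[OF i] by (simp add: f_def v_def i_def)
    finally show ?thesis .
  qed
  have "(\<Sum>i<n. (\<Sum>j<n. complex_of_real (nystrom \<alpha> n i j) * v j) * cnj (v i))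
      = (c * cnj c) * (\<Sum>i<n. (\<Sum>j<n. complex_of_real (nystrom \<alpha> n i j) * x j) * cnj (x i))"
    unfolding Av by (simp add: v_def sum_distrib_left mult_ac)
  also have "c * cnj c = complex_of_real (1 / S)" using c2 complex_norm_square[of c] by simp
  finally have "Re (\<Sum>i<n. (\<Sum>j<n. complex_of_real (nystrom \<alpha> n i j) * v j) * cnj (v i))
      = 1 / S * Re (\<Sum>i<n. (\<Sum>j<n. complex_of_real (nystrom \<alpha> n i j) * x j) * cnj (x i))" by simp
  also have "\<dots> \<le> 0" using np S by (intro mult_nonneg_nonpos) auto
  finally have "2 / real n * Re (\<Sum>i<n. (\<Sum>j<n. complex_of_real (nystrom \<alpha> n i j) * v j) * cnj (v i)) \<le> 0"
    using n by (intro mult_nonneg_nonpos) auto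
  then have 3: "1 / pi\<^sup>2 \<le> Re (LINT t|\<mu>. green_sampled \<alpha> n f (sample n t) * cnj (f t))"
    unfolding nystrom_form[OF n] using 1 by (simp add: f_def[abs_def])
  have "f \<in> L2" unfolding f_def by (rule step_L2[OF n])
  then show ?case using 1 2 3 by blast
qed

text \<open>From |f| \<le> 1 + |f|^2: the bound 3 is the interval length 2 plus the squared norm
  1.\<close>

lemma L2_unit_integral_bound:
  assumes "f \<in> L2" "(LINT t|\<mu>. (cmod (f t))\<^sup>2) = 1"
  shows "(LINT t|\<mu>. cmod (f t)) \<le> 3"
proof -
  have "(LINT t|\<mu>. cmod (f t)) \<le> (LINT t|\<mu>. 1 + (cmod (f t))\<^sup>2)"
  proof (rule integral_mono)
    show "integrable \<mu> (\<lambda>t. 1 + (cmod (f t))\<^sup>2)"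
      using L2_square_integrable[OF assms(1)] by simp
    show "cmod (f t) \<le> 1 + (cmod (f t))\<^sup>2" for t
      using sum_squares_bound[of "cmod (f t)" 1] norm_ge_zero[of "f t"] by (simp del: norm_ge_zero)
  qed (use L2_integrable[OF assms(1)] in simp)
  also have "\<dots> = (LINT t|\<mu>. 1) + 1"
    using L2_square_integrable[OF assms(1)] assms(2) by simp
  also have "(LINT t|\<mu>. 1) = (2::real)"
    using grid_integral(2)[of 1 "\<lambda>_. 1::real"] by simp
  finally show ?thesis by simp
qed

text \<open>The eigenfunctions themselves have no compactness: b - \<kappa> may vanish when \<kappa>
  lies in the range of b, and the quotient can then lose mass. Null level sets make the quotient
  meaningful almost everywhere, and Fatou keeps it in L2.\<close>

lemma nonpositive_eigenfunction:
  assumes a: "0 < \<alpha>" "\<alpha> < sqrt 3 * pi / 2"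
  obtains f z where "f \<in> L2" "\<not> aeq f (\<lambda>_. 0)" "aeq (JL_op \<alpha> \<beta> f) (\<lambda>y. z * f y)"
    "Re (form \<alpha> f f) \<le> 0"
proof -
  let ?M = "\<mu>"
  define Q where "Q n f \<zeta> \<longleftrightarrow> f \<in> L2 \<and> (LINT t|?M. (cmod (f t))\<^sup>2) = 1 \<and>
     (\<forall>t\<in>I11. t \<noteq> 1 \<longrightarrow> complex_of_real (vort \<beta> (sample n t)) *
         (f t / complex_of_real (pi\<^sup>2) - green_sampled \<alpha> n f (sample n t)) = \<zeta> * f t) \<and>
     1 / pi\<^sup>2 \<le> Re (LINT t|?M. green_sampled \<alpha> n f (sample n t) * cnj (f t))" for n f \<zeta>
  obtain n0 where n0: "\<And>n. n \<ge> n0 \<Longrightarrow> \<exists>f \<zeta>. Q n f \<zeta>"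
    using discrete_eigenfunction[OF a, of \<beta>] unfolding Q_def[symmetric] eventually_sequentially by blast
  \<comment> \<open>Grid sizes beyond \<open>n0\<close>, and positive.\<close>
  define m where "m n = n0 + n + 1" for n :: nat
  have m0: "m n > 0" for n by (simp add: m_def)
  have "\<forall>n. \<exists>f \<zeta>. Q (m n) f \<zeta>" using n0 by (simp add: m_def)
  then obtain F Z where Q: "\<And>n. Q (m n) (F n) (Z n)" by metis
  define W where "W n = green_sampled \<alpha> (m n) (F n)" for n
  have FL: "F n \<in> L2" and F1: "(LINT t|?M. (cmod (F n t))\<^sup>2) = 1"
    and ev: "\<And>t. t \<in> I11 \<Longrightarrow> t \<noteq> 1 \<Longrightarrow> complex_of_real (vort \<beta> (sample (m n) t)) *
         (F n t / complex_of_real (pi\<^sup>2) - W n (sample (m n) t)) = Z n * F n t"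
    and low: "1 / pi\<^sup>2 \<le> Re (LINT t|?M. W n (sample (m n) t) * cnj (F n t))" for n
    using Q[of n] unfolding Q_def W_def by blast+
  have F3: "(LINT t|?M. cmod (F n t)) \<le> 3" for n by (rule L2_unit_integral_bound[OF FL F1])
  note Fint = L2_integrable[OF FL]
  obtain C where C: "C > 0" "\<And>y t. y \<in> I11 \<Longrightarrow> t \<in> I11 \<Longrightarrow> \<bar>green \<alpha> y t\<bar> \<le> C"
    using green_bound by blast
  have Wb: "cmod (W n y) \<le> 3 * C" if "y \<in> I11" for n y
  proof -
    have "cmod (W n y) \<le> C * (LINT t|?M. cmod (F n t))"
      unfolding W_def by (rule green_sampled_lipschitz(2)[OF Fint m0 _ C(2) that that, of 0]) auto
    also have "\<dots> \<le> C * 3" using F3 C(1) by (intro mult_left_mono) auto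
    finally show ?thesis by simp
  qed
  \<comment> \<open>\<open>F\<close> is bounded in L1 and the kernel is uniformly continuous, so the
    functions \<open>W\<close> are uniformly bounded and equicontinuous.\<close>
  obtain w k where w: "continuous_on I11 w" and k: "strict_mono (k :: nat \<Rightarrow> nat)"
    and wk: "\<And>e. 0 < e \<Longrightarrow> \<exists>N. \<forall>n x. n \<ge> N \<and> x \<in> I11 \<longrightarrow> norm (W (k n) x - w x) < e"
  proof (rule Arzela_Ascoli[of I11 W "3 * C"])
    show "compact I11" by (simp add: I11_def)
    show "cmod (W n y) \<le> 3 * C" if "y \<in> I11" for n y by (rule Wb[OF that])
    fix y e :: real assume y: "y \<in> I11" and e: "0 < e"
    obtain d where d: "d > 0" "\<And>y y' t t'. y \<in> I11 \<Longrightarrow> y' \<in> I11 \<Longrightarrow> t \<in> I11 \<Longrightarrow> t' \<in> I11 \<Longrightarrow>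
      \<bar>y - y'\<bar> < d \<Longrightarrow> \<bar>t - t'\<bar> < d \<Longrightarrow> \<bar>green \<alpha> y t - green \<alpha> y' t'\<bar> < e / 4"
      using green_uniform[of "e / 4"] e by auto
    have "cmod (W n y - W n y') < e" if y': "y' \<in> I11" "\<bar>y - y'\<bar> < d" for n y'
    proof -
      have "cmod (W n y - W n y') \<le> e / 4 * (LINT t|?M. cmod (F n t))"
        unfolding W_def
      proof (rule green_sampled_lipschitz(1)[OF Fint m0 _ C(2) y y'(1)])
        show "\<bar>green \<alpha> y t - green \<alpha> y' t\<bar> \<le> e / 4" if "t \<in> I11" for t
          using d(2)[OF y y'(1) that that y'(2)] d(1) by simp
      qed
      also have "\<dots> \<le> e / 4 * 3" using F3 e by (intro mult_left_mono) auto
      also have "\<dots> < e" using e by simp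
      finally show ?thesis .
    qed
    then show "\<exists>d>0. \<forall>n y'. y' \<in> I11 \<and> norm (y - y') < d \<longrightarrow> cmod (W n y - W n y') < e"
      using d(1) by (intro exI[of _ d]) auto
  qed blast
  have ne1: "AE t in ?M. t \<noteq> 1"
  proof -
    have "AE t in lebesgue. t \<notin> {1::real}"
      by (intro AE_not_in) (simp add: negligible_iff_null_sets[symmetric])
    then have "AE t in lebesgue. t \<in> I11 \<longrightarrow> t \<noteq> (1::real)" by eventually_elim auto
    then show ?thesis by (subst AE_restrict_space_iff) auto
  qed
  obtain B where B: "B > 0" "\<And>t. t \<in> I11 \<Longrightarrow> norm (vort \<beta> t) \<le> B"
    using continuous_bound_I11[OF vort_continuous] by blast
  \<comment> \<open>Squaring and integrating the eigenvalue equation at unit norm bounds the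
    eigenvalue; 36 is 18 times the interval length 2.\<close>
  have Zb: "(cmod (Z n))\<^sup>2 \<le> 2 * B\<^sup>2 + 36 * (B * C)\<^sup>2" for n
  proof -
    have pw: "(cmod (Z n))\<^sup>2 * (cmod (F n t))\<^sup>2 \<le> 2 * B\<^sup>2 * (cmod (F n t))\<^sup>2 + 18 * (B * C)\<^sup>2"
      if t: "t \<in> I11" "t \<noteq> 1" for t
    proof -
      have s: "sample (m n) t \<in> I11" by (rule sample_near(3)[OF m0 t(1)])
      have "1 \<le> pi\<^sup>2" using pi_gt3 by (intro one_le_power) auto
      then have "cmod (F n t / complex_of_real (pi\<^sup>2)) \<le> cmod (F n t)"
        using mult_left_mono[of 1 "pi\<^sup>2" "cmod (F n t)"] by (simp add: norm_divide norm_power divide_le_eq)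
      then have "cmod (F n t / complex_of_real (pi\<^sup>2) - W n (sample (m n) t)) \<le> cmod (F n t) + 3 * C"
        using norm_triangle_ineq4[of "F n t / complex_of_real (pi\<^sup>2)" "W n (sample (m n) t)"] Wb[OF s, of n]
        by linarith
      then have "cmod (Z n * F n t) \<le> B * (cmod (F n t) + 3 * C)"
        using B(2)[OF s] B(1) unfolding ev[OF t, symmetric] norm_mult by (intro mult_mono) auto
      then have "(cmod (Z n * F n t))\<^sup>2 \<le> (B * (cmod (F n t) + 3 * C))\<^sup>2"
        by (intro power_mono) auto
      also have "\<dots> = B\<^sup>2 * (cmod (F n t) + 3 * C)\<^sup>2" by (rule power_mult_distrib)
      also have "\<dots> \<le> B\<^sup>2 * (2 * (cmod (F n t))\<^sup>2 + 18 * C\<^sup>2)"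
        using sum_squares_bound[of "cmod (F n t)" "3 * C"]
        by (intro mult_left_mono) (auto simp: power2_sum power_mult_distrib)
      finally show ?thesis by (simp add: norm_mult power_mult_distrib algebra_simps)
    qed
    have "(LINT t|?M. (cmod (Z n))\<^sup>2 * (cmod (F n t))\<^sup>2) \<le> (LINT t|?M. 2 * B\<^sup>2 * (cmod (F n t))\<^sup>2 + 18 * (B * C)\<^sup>2)"
    proof (rule integral_mono_AE)
      show "AE t in ?M. (cmod (Z n))\<^sup>2 * (cmod (F n t))\<^sup>2 \<le> 2 * B\<^sup>2 * (cmod (F n t))\<^sup>2 + 18 * (B * C)\<^sup>2"
        using ne1 AE_space by eventually_elim (use pw in simp)
    qed (use L2_square_integrable[OF FL[of n]] in auto)
    also have "\<dots> = 2 * B\<^sup>2 + 18 * (B * C)\<^sup>2 * 2"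
      using L2_square_integrable[OF FL[of n]] F1[of n] grid_integral(2)[of 1 "\<lambda>_. 18 * (B * C)\<^sup>2"] by simp
    finally show ?thesis using F1[of n] by simp
  qed
  have "bounded (range (Z \<circ> k))"
  proof (rule boundedI)
    fix x assume "x \<in> range (Z \<circ> k)"
    then obtain n where "x = Z (k n)" by auto
    then show "norm x \<le> sqrt (2 * B\<^sup>2 + 36 * (B * C)\<^sup>2)" using Zb[of "k n"] by (intro real_le_rsqrt) simp
  qed
  then obtain \<zeta> r where r: "strict_mono (r :: nat \<Rightarrow> nat)" and \<zeta>: "((Z \<circ> k) \<circ> r) \<longlonglongrightarrow> \<zeta>"
    using bounded_imp_convergent_subsequence by blast
  define s where "s n = k (r n)" for n
  have s: "strict_mono s" using k r unfolding s_def strict_mono_def by blast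
  define N where "N n = m (s n)" for n
  have N0: "N n > 0" for n by (simp add: N_def m0)
  have N: "filterlim N at_top sequentially"
  proof -
    have "n \<le> N n" for n using seq_suble[OF s, of n] by (simp add: N_def m_def)
    then show ?thesis unfolding filterlim_at_top eventually_sequentially by (meson order_trans)
  qed
  define f where "f n = F (s n)" for n
  have Ws: "W (s n) = green_sampled \<alpha> (N n) (f n)" for n by (simp add: W_def N_def f_def)
  have Zs: "(\<lambda>n. Z (s n)) \<longlonglongrightarrow> \<zeta>" using \<zeta> by (simp add: s_def comp_def)
  have Wu: "\<forall>\<^sub>F n in sequentially. \<forall>x\<in>I11. cmod (W (s n) x - w x) < e" if e: "e > 0" for e
  proof -
    obtain K where "\<forall>n x. n \<ge> K \<and> x \<in> I11 \<longrightarrow> norm (W (k n) x - w x) < e" using wk[OF e] by blast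
    moreover have "n \<le> r n" for n by (rule seq_suble[OF r])
    ultimately show ?thesis unfolding eventually_sequentially s_def by (meson order_trans)
  qed
  have Wt: "(\<lambda>n. W (s n) (sample (N n) t)) \<longlonglongrightarrow> w t" if t: "t \<in> I11" for t
  proof -
    have "(\<lambda>n. w (sample (N n) t)) \<longlonglongrightarrow> w t"
      using w t by (rule continuous_on_tendsto_compose[OF _ sample_tendsto[OF N t]])
        (use sample_near(3)[OF N0 t] in auto)
    moreover have "(\<lambda>n. W (s n) (sample (N n) t) - w (sample (N n) t)) \<longlonglongrightarrow> 0"
    proof (rule tendstoI)
      fix e :: real assume "e > 0"
      from Wu[OF this] show "\<forall>\<^sub>F n in sequentially. dist (W (s n) (sample (N n) t) - w (sample (N n) t)) 0 < e"
        by eventually_elim (use sample_near(3)[OF N0 t] in auto)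
    qed
    ultimately show ?thesis using tendsto_add by fastforce
  qed
  \<comment> \<open>Solving v (f/pi^2 - w) = \<zeta> f for f gives f (v - pi^2 \<zeta>) = pi^2 v w,
    whence \<kappa> and \<open>g\<close>.\<close>
  define \<kappa> where "\<kappa> = complex_of_real (pi\<^sup>2) * \<zeta>"
  define v where "v t = complex_of_real (vort \<beta> t)" for t
  define g where "g t = complex_of_real (pi\<^sup>2) * v t * w t / (v t - \<kappa>)" for t
  have vc: "continuous_on S v" for S unfolding v_def by (intro continuous_intros vort_continuous)
  have gm: "g \<in> borel_measurable ?M"
    unfolding g_def
    by (intro borel_measurable_divide borel_measurable_times borel_measurable_diff borel_measurable_const
        continuous_measurable_I11 vc w)
  \<comment> \<open>The discrete equation is solved for \<open>f n t\<close> in the same way; its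
    denominator \<open>D n\<close> tends to v - \<kappa>, which is non-zero off a null set, so it is
    eventually non-zero.\<close>
  have lim: "AE t in ?M. (\<lambda>n. f n t) \<longlonglongrightarrow> g t"
    using ne1 vort_level_null[of \<beta> \<kappa>] AE_space
  proof eventually_elim
    case (elim t)
    then have t: "t \<in> I11" "t \<noteq> 1" and vt: "v t - \<kappa> \<noteq> 0" by (auto simp: v_def)
    define D where "D n = v (sample (N n) t) - complex_of_real (pi\<^sup>2) * Z (s n)" for n
    have vl: "(\<lambda>n. v (sample (N n) t)) \<longlonglongrightarrow> v t"
      using vc[of I11] t(1) by (rule continuous_on_tendsto_compose[OF _ sample_tendsto[OF N t(1)]])
        (use sample_near(3)[OF N0 t(1)] in auto)
    have Dl: "D \<longlonglongrightarrow> v t - \<kappa>"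
      unfolding D_def \<kappa>_def by (intro tendsto_intros vl Zs)
    have lim': "(\<lambda>n. complex_of_real (pi\<^sup>2) * v (sample (N n) t) * W (s n) (sample (N n) t) / D n) \<longlonglongrightarrow> g t"
      unfolding g_def by (intro tendsto_intros vl Wt[OF t(1)] Dl vt)
    have "\<forall>\<^sub>F n in sequentially. D n \<noteq> 0"
      using tendsto_imp_eventually_ne[OF Dl vt] .
    then have "\<forall>\<^sub>F n in sequentially.
        complex_of_real (pi\<^sup>2) * v (sample (N n) t) * W (s n) (sample (N n) t) / D n = f n t"
    proof eventually_elim
      case (elim n)
      have "v (sample (N n) t) * (f n t / complex_of_real (pi\<^sup>2) - W (s n) (sample (N n) t)) = Z (s n) * f n t"
        using ev[OF t, of "s n"] by (simp add: v_def f_def N_def)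
      then have "complex_of_real (pi\<^sup>2) * (v (sample (N n) t) * (f n t / complex_of_real (pi\<^sup>2) - W (s n) (sample (N n) t)))
          = complex_of_real (pi\<^sup>2) * (Z (s n) * f n t)" by simp
      moreover have "complex_of_real (pi\<^sup>2) * (v (sample (N n) t) * (f n t / complex_of_real (pi\<^sup>2) - W (s n) (sample (N n) t)))
          = v (sample (N n) t) * f n t - complex_of_real (pi\<^sup>2) * v (sample (N n) t) * W (s n) (sample (N n) t)"
        by (simp add: field_simps)
      ultimately have "complex_of_real (pi\<^sup>2) * v (sample (N n) t) * W (s n) (sample (N n) t) = f n t * D n"
        by (simp add: D_def algebra_simps)
      then show ?case using elim by (simp add: field_simps)
    qed
    then show ?case by (rule Lim_transform_eventually[OF lim'])
  qed
  have fL: "f n \<in> L2" "(LINT t|?M. (cmod (f n t))\<^sup>2) \<le> 1" for n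
    using FL F1 by (simp_all add: f_def)
  note gl = L2_bounded_AE_limit[OF fL gm lim]
  note gL = gl(1)
  \<comment> \<open>Identifying the uniform limit with G g turns the defining formula of
    \<open>g\<close> into the eigenvalue equation.\<close>
  have wg: "w y = dirichlet_inv \<alpha> g y" if y: "y \<in> I11" for y
  proof -
    have "(\<lambda>n. W (s n) y) \<longlonglongrightarrow> w y"
    proof (rule tendstoI)
      fix e :: real assume "e > 0"
      from Wu[OF this] show "\<forall>\<^sub>F n in sequentially. dist (W (s n) y) (w y) < e"
        by eventually_elim (use y in \<open>auto simp: dist_norm\<close>)
    qed
    moreover have "(\<lambda>n. W (s n) y) \<longlonglongrightarrow> green_int \<alpha> g y"
    proof (rule tendstoI)
      fix e :: real assume e: "e > 0"
      then have "e / 2 > 0" by simp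
      from green_sampled_uniform_limit(1)[OF N L2_integrable[OF fL(1)] L2_integrable[OF gL] gl(3) this, of \<alpha>]
      show "\<forall>\<^sub>F n in sequentially. dist (W (s n) y) (green_int \<alpha> g y) < e"
        by eventually_elim (use y e in \<open>fastforce simp: dist_norm Ws\<close>)
    qed
    ultimately have "w y = green_int \<alpha> g y" by (rule LIMSEQ_unique)
    then show ?thesis by (simp only: green_int_eq_dirichlet_inv[OF a(1) gL y])
  qed
  have ipg: "(LINT t|?M. green_int \<alpha> g t * cnj (g t)) = ip (dirichlet_inv \<alpha> g) g"
    unfolding ip_def
    by (intro Bochner_Integration.integral_cong) (auto simp: green_int_eq_dirichlet_inv[OF a(1) gL])
  have low': "1 / pi\<^sup>2 \<le> Re (ip (dirichlet_inv \<alpha> g) g)"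
  proof (rule LIMSEQ_le_const)
    show "(\<lambda>n. Re (LINT t|?M. green_sampled \<alpha> (N n) (f n) (sample (N n) t) * cnj (f n t)))
        \<longlonglongrightarrow> Re (ip (dirichlet_inv \<alpha> g) g)"
      unfolding ipg[symmetric]
      by (intro tendsto_Re sampled_form_tendsto N a L2_integrable fL gL gl(3))
    show "\<exists>K. \<forall>n\<ge>K. 1 / pi\<^sup>2 \<le> Re (LINT t|?M. green_sampled \<alpha> (N n) (f n) (sample (N n) t) * cnj (f n t))"
      using low by (intro exI[of _ 0] allI impI) (simp add: W_def f_def N_def)
  qed
  show ?thesis
  proof (rule that[OF gL])
    \<comment> \<open>A null limit would have Green term 0, against the inherited bound
      1/pi^2.\<close>
    show "\<not> aeq g (\<lambda>_. 0)"
    proof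
      assume 0: "aeq g (\<lambda>_. 0)"
      have "ip (dirichlet_inv \<alpha> g) g = cnj (ip g (dirichlet_inv \<alpha> g))" by (rule ip_herm)
      also have "ip g (dirichlet_inv \<alpha> g) = ip (\<lambda>_. 0) (dirichlet_inv \<alpha> g)"
        by (intro ip_aeq_left 0 gL L2_const dirichlet_inv_continuous a)
      finally have "Re (ip (dirichlet_inv \<alpha> g) g) = 0" by (simp add: ip_def)
      then show False using low' by (simp add: field_simps)
    qed
    \<comment> \<open>The norm of the limit may have dropped below 1, which only lowers the first
      term.\<close>
    have "Re (form \<alpha> g g) = Re (ip g g) / pi\<^sup>2 - Re (ip (dirichlet_inv \<alpha> g) g)"
      unfolding form_def ip_L_op[OF a(1) gL gL] by simp
    also have "Re (ip g g) \<le> 1" using gl(2) by (simp add: ip_self[OF gL])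
    finally show "Re (form \<alpha> g g) \<le> 0" using low' by (simp add: divide_right_mono order_trans)
    \<comment> \<open>The discrete problem treats b L; the factor -i \<alpha> of J turns its
      limiting eigenvalue \<zeta> into -i \<alpha> \<zeta>.\<close>
    show "aeq (JL_op \<alpha> \<beta> g) (\<lambda>y. (- \<i> * complex_of_real \<alpha> * \<zeta>) * g y)"
      unfolding aeq_def using vort_level_null[of \<beta> \<kappa>] AE_space
    proof eventually_elim
      case (elim y)
      then have y: "y \<in> I11" and vy: "v y - \<kappa> \<noteq> 0" by (auto simp: v_def)
      have "g y * (v y - \<kappa>) = complex_of_real (pi\<^sup>2) * v y * w y" using vy by (simp add: g_def)
      then have eq: "v y * g y - complex_of_real (pi\<^sup>2) * v y * w y = complex_of_real (pi\<^sup>2) * \<zeta> * g y"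
        by (simp add: \<kappa>_def algebra_simps)
      have "v y * L_op \<alpha> g y = (v y * g y - complex_of_real (pi\<^sup>2) * v y * w y) / complex_of_real (pi\<^sup>2)"
        by (simp add: L_op_def wg[OF y] field_simps)
      also have "\<dots> = \<zeta> * g y" unfolding eq by simp
      finally have "v y * L_op \<alpha> g y = \<zeta> * g y" .
      then show ?case by (simp add: JL_op_alt v_def mult.assoc)
    qed
  qed
qed

lemma index_formula:
  assumes a: "0 < \<alpha>" "\<alpha> < sqrt 3 * pi / 2"
  shows "k_c \<alpha> \<beta> + k_r \<alpha> \<beta> + k_i_nonpos \<alpha> \<beta> = 1"
proof -
  obtain f z where f: "f \<in> L2" "\<not> aeq f (\<lambda>_. 0)" and ev: "aeq (JL_op \<alpha> \<beta> f) (\<lambda>y. z * f y)"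
    and np: "Re (form \<alpha> f f) \<le> 0"
    using nonpositive_eigenfunction[OF a] by blast
  \<comment> \<open>An eigenvalue 0 would be invisible to all three counts.\<close>
  have z: "z \<noteq> 0"
  proof
    assume "z = 0"
    then have "aeq (JL_op \<alpha> \<beta> f) (\<lambda>_. 0)" using ev by simp
    then show False using JL_op_kernel[OF a f(1)] f(2) by blast
  qed
  show ?thesis
  proof (cases "Re z \<ge> 0")
    case True
    then show ?thesis using index_sum_eq_1[OF a(1) f ev np] z by blast
  next
    case False
    define g where "g y = cnj (f y)" for y
    have gL: "g \<in> L2" unfolding g_def by (rule L2_cnj[OF f(1)])
    have g0: "\<not> aeq g (\<lambda>_. 0)" using f(2) by (simp add: aeq_def g_def)
    have "aeq (JL_op \<alpha> \<beta> g) (\<lambda>y. (- cnj z) * g y)"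
      using ev unfolding aeq_def g_def JL_op_cnj[OF a(1) f(1)] by eventually_elim simp
    moreover have "Re (form \<alpha> g g) \<le> 0"
      using np form_cnj[OF a(1) f(1)] by (simp add: form_def g_def[abs_def])
    moreover have "Re (- cnj z) \<ge> 0" "- cnj z \<noteq> 0" using False z by auto
    ultimately show ?thesis using index_sum_eq_1[OF a(1) gL g0] by blast
  qed
qed

theorem theorem4p1:
  fixes \<beta> :: real
  shows "(\<forall>\<alpha>::real. \<alpha> \<ge> sqrt 3 * pi / 2 \<longrightarrow>
            (\<forall>f\<in>L2. Re (ip (L_op \<alpha> f) f) \<ge> 0) \<and> linearly_stable \<alpha> \<beta>) \<and>
         (\<forall>\<alpha>::real. 0 < \<alpha> \<and> \<alpha> < sqrt 3 * pi / 2 \<longrightarrow>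
            k_c \<alpha> \<beta> + k_r \<alpha> \<beta> + k_i_nonpos \<alpha> \<beta> = 1)"
  using L_op_nonneg linearly_stable_large_wavenumber index_formula by blast

end
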